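(* Let $\omega\subset\mathbb{R}^d$ be open, let $f\in\mathcal{E}'(\omega)$, let $f_\varepsilon=(f*\phi_\varepsilon)|_\omega$, $\varepsilon\in(0,1)$, and put $F=[(f_\varepsilon)_\varepsilon]\in\mathcal{G}(\omega)$. Then $$\mathrm{WF}_a f=\mathrm{WF}_{ga}F,$$ where the left side is the analytic wave front set of the distribution $f$ and the right side is the analytic wave front set of the generalized function $F$.
   Context: For $\omega\subset\mathbb{R}^d$ open, $\mathcal{E}_M(\omega)$ is the set of nets $(f_\varepsilon)_{\varepsilon\in(0,1)}$ of smooth functions on $\omega$ such that for every compact $K\subset\omega$ and $\alpha\in\mathbb{N}_0^d$ there is $a\in\mathbb{R}$ with $\sup_{x\in K}|f_\varepsilon^{(\alpha)}(x)|=O(\varepsilon^a)$ as $\varepsilon\to0$; $\mathcal{N}(\omega)$ is the ideal of nets for which this holds for every $a\in\mathbb{R}$, every $K$ and every $\alpha$. The Colombeau algebra is $\mathcal{G}(\omega)=\mathcal{E}_M(\omega)/\mathcal{N}(\omega)$; the class of $(f_\varepsilon)_\varepsilon$ is $[(f_\varepsilon)_\varepsilon]$. $\mathcal{E}'(\omega)$ is the space of distributions with compact support in $\omega$. Mollifiers: $\phi_\varepsilon=\varepsilon^{-d}\phi(\cdot/\varepsilon)$, $\varepsilon\in(0,1)$, where $\phi\in\mathcal{S}(\mathbb{R}^d)$ is fixed with $\int\phi(t)\,dt=1$ and $\int t^m\phi(t)\,dt=0$ for all $m\in\mathbb{N}_0^d$, $|m|>0$. Fourier transform: $\hat\phi(\xi)=\int_{\mathbb{R}^d}e^{-ix\xi}\phi(x)\,dx$.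 Cut-off sequences: for $x_0\in\omega$ there exist open sets $W,U$ with $x_0\in W\subset\subset U\subset\subset\omega$ and sequences $(\kappa_n)_n$ in $\mathcal{D}(U)$ with $\kappa_n\equiv1$ on $W$ for all $n\in\mathbb{N}$, such that for every $\alpha\in\mathbb{N}_0^d$ there is $C_\alpha>0$ with $|\kappa_n^{(\alpha+\beta)}(x)|\le C_\alpha(C_\alpha n)^{|\beta|}$ for $|\beta|\le n$, $n\in\mathbb{N}$. Call such $(W,U,(\kappa_n)_n)$ an admissible cut-off at $x_0$. $G\in\mathcal{G}(\omega)$ is $g$-microanalytic at $(x_0,\xi_0)\in\omega\times(\mathbb{R}^d\setminus\{0\})$ if there exist an admissible cut-off at $x_0$, an open cone $\Gamma$ around $\xi_0$, a representative $(g_\varepsilon)_\varepsilon$ of $G$, and $a>0$, $C>0$, $\varepsilon_0\in(0,1)$ such that $|\widehat{\kappa_ng_\varepsilon}(\xi)|\le C\varepsilon^{-a}\big(\frac{Cn}{1+|\xi|}\big)^n$ for $n\in\mathbb{N}$, $\xi\in\Gamma$, $\varepsilon\in(0,\varepsilon_0)$. $\mathrm{WF}_{ga}G$ is the complement in $\omega\times(\mathbb{R}^d\setminus\{0\})$ of the set of points where $G$ is $g$-microanalytic. A distribution $f\in\mathcal{D}'(\omega)$ is microanalytic at $(x_0,\xi_0)$ if there are an admissible cut-off at $x_0$, an open cone $\Gamma$ around $\xi_0$ and $C>0$ with $|\widehat{\kappa_nf}(\xi)|\le C\big(\frac{Cn}{1+|\xi|}\big)^n$ for $n\in\mathbb{N}$,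 $\xi\in\Gamma$; $\mathrm{WF}_af$ is the complement in $\omega\times(\mathbb{R}^d\setminus\{0\})$ of the set of such points. *)

theory Defs
  imports "HOL-Analysis.Analysis" "HOL-Library.Landau_Symbols"
begin

section \<open>Multi-indices, partial derivatives, smooth functions\<close>

type_synonym 'n multi_index = "nat ^ 'n"

definition mi_abs :: "'n::finite multi_index \<Rightarrow> nat" where
  "mi_abs \<alpha> = (\<Sum>i\<in>UNIV. \<alpha> $ i)"

definition mi_power :: "real ^ 'n \<Rightarrow> 'n::finite multi_index \<Rightarrow> real" where
  "mi_power x \<alpha> = (\<Prod>i\<in>UNIV. (x $ i) ^ (\<alpha> $ i))"

definition partial :: "'n \<Rightarrow> (real ^ 'n::finite \<Rightarrow> complex) \<Rightarrow> real ^ 'n \<Rightarrow> complex" where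
  "partial i f x = frechet_derivative f (at x) (axis i 1)"

definition smooth_on :: "(real ^ 'n::finite) set \<Rightarrow> (real ^ 'n \<Rightarrow> complex) \<Rightarrow> bool" where
  "smooth_on S f \<longleftrightarrow> (\<forall>js. foldr partial js f differentiable_on S)"

(* The list names each coordinate i exactly \<alpha>$i times. Its order is immaterial for smooth
   functions, since their partial derivatives commute. *)
definition mi_deriv :: "'n multi_index \<Rightarrow> (real ^ 'n::finite \<Rightarrow> complex) \<Rightarrow> real ^ 'n \<Rightarrow> complex" where
  "mi_deriv \<alpha> f = foldr partial (SOME js. \<forall>i. count_list js i = \<alpha> $ i) f"


section \<open>Test functions, Schwartz functions, Fourier transform\<close>

definition test_functions :: "(real ^ 'n::finite) set \<Rightarrow> (real ^ 'n \<Rightarrow> complex) set" where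
  "test_functions \<omega> = {\<psi>. smooth_on UNIV \<psi> \<and> compact (closure {x. \<psi> x \<noteq> 0}) \<and>
     closure {x. \<psi> x \<noteq> 0} \<subseteq> \<omega>}"

definition schwartz :: "(real ^ 'n::finite \<Rightarrow> complex) set" where
  "schwartz = {\<phi>. smooth_on UNIV \<phi> \<and>
     (\<forall>\<alpha> \<beta>. bdd_above (range (\<lambda>x. norm (of_real (mi_power x \<alpha>) * mi_deriv \<beta> \<phi> x))))}"

definition fourier :: "(real ^ 'n::finite \<Rightarrow> complex) \<Rightarrow> real ^ 'n \<Rightarrow> complex" where
  "fourier g \<xi> = (LINT x|lborel. exp (- \<i> * of_real (x \<bullet> \<xi>)) * g x)"

definition mollifier :: "(real ^ 'n::finite \<Rightarrow> complex) \<Rightarrow> real \<Rightarrow> real ^ 'n \<Rightarrow> complex" where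
  "mollifier \<phi> \<epsilon> x = of_real ((1 / \<epsilon>) ^ CARD('n)) * \<phi> (x /\<^sub>R \<epsilon>)"


section \<open>Distributions\<close>

(* A distribution on \<omega> is a functional of which only the values on test_functions \<omega> matter. *)
definition distributions :: "(real ^ 'n::finite) set \<Rightarrow> ((real ^ 'n \<Rightarrow> complex) \<Rightarrow> complex) set" where
  "distributions \<omega> = {u.
     (\<forall>\<psi>\<in>test_functions \<omega>. \<forall>\<eta>\<in>test_functions \<omega>. u (\<lambda>x. \<psi> x + \<eta> x) = u \<psi> + u \<eta>) \<and>
     (\<forall>c. \<forall>\<psi>\<in>test_functions \<omega>. u (\<lambda>x. c * \<psi> x) = c * u \<psi>) \<and>
     (\<forall>K. compact K \<and> K \<subseteq> \<omega> \<longrightarrow>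
       (\<exists>C N. \<forall>\<psi>\<in>test_functions \<omega>. closure {x. \<psi> x \<noteq> 0} \<subseteq> K \<longrightarrow>
          norm (u \<psi>) \<le> C * (\<Sum>\<alpha> | mi_abs \<alpha> \<le> N. SUP x. norm (mi_deriv \<alpha> \<psi> x))))}"

definition dist_support ::
    "(real ^ 'n::finite) set \<Rightarrow> ((real ^ 'n \<Rightarrow> complex) \<Rightarrow> complex) \<Rightarrow> (real ^ 'n) set" where
  "dist_support \<omega> u = {x\<in>\<omega>. \<forall>V. open V \<and> x \<in> V \<and> V \<subseteq> \<omega> \<longrightarrow> (\<exists>\<psi>\<in>test_functions V. u \<psi> \<noteq> 0)}"

definition compact_distributions ::
    "(real ^ 'n::finite) set \<Rightarrow> ((real ^ 'n \<Rightarrow> complex) \<Rightarrow> complex) set" where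
  "compact_distributions \<omega> = {u\<in>distributions \<omega>. compact (dist_support \<omega> u)}"

(* The canonical extension of a compactly supported distribution u on \<omega> to functions smooth
   on \<omega>: u(\<rho>\<psi>), where the cut-off \<rho> is 1 near the support of u. The value does not depend
   on the choice of \<rho>. *)
definition pairing ::
    "(real ^ 'n::finite) set \<Rightarrow> ((real ^ 'n \<Rightarrow> complex) \<Rightarrow> complex) \<Rightarrow> (real ^ 'n \<Rightarrow> complex) \<Rightarrow> complex"
where
  "pairing \<omega> u \<psi> =
     (let \<rho> = (SOME \<rho>. \<rho> \<in> test_functions \<omega> \<and>
                 (\<exists>V. open V \<and> dist_support \<omega> u \<subseteq> V \<and> (\<forall>x\<in>V. \<rho> x = 1)))
      in u (\<lambda>x. \<rho> x * \<psi> x))"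

definition dist_convol ::
    "(real ^ 'n::finite) set \<Rightarrow> ((real ^ 'n \<Rightarrow> complex) \<Rightarrow> complex) \<Rightarrow> (real ^ 'n \<Rightarrow> complex) \<Rightarrow>
     real ^ 'n \<Rightarrow> complex" where
  "dist_convol \<omega> u \<phi> x = pairing \<omega> u (\<lambda>y. \<phi> (x - y))"

definition dist_mult ::
    "(real ^ 'n::finite \<Rightarrow> complex) \<Rightarrow> ((real ^ 'n \<Rightarrow> complex) \<Rightarrow> complex) \<Rightarrow>
     (real ^ 'n \<Rightarrow> complex) \<Rightarrow> complex" where
  "dist_mult \<kappa> u \<psi> = u (\<lambda>x. \<kappa> x * \<psi> x)"

definition dist_fourier ::
    "(real ^ 'n::finite) set \<Rightarrow> ((real ^ 'n \<Rightarrow> complex) \<Rightarrow> complex) \<Rightarrow> real ^ 'n \<Rightarrow> complex" where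
  "dist_fourier \<omega> u \<xi> = pairing \<omega> u (\<lambda>x. exp (- \<i> * of_real (x \<bullet> \<xi>)))"


section \<open>The Colombeau algebra\<close>

(* Nets of functions on \<omega> are represented by total functions; only the values for 0 < \<epsilon> < 1
   and x in \<omega> matter, and nets differing elsewhere are identified in the quotient.
   The compact sets are nonempty because the supremum of {} is unspecified for reals. *)
definition moderate_nets :: "(real ^ 'n::finite) set \<Rightarrow> (real \<Rightarrow> real ^ 'n \<Rightarrow> complex) set" where
  "moderate_nets \<omega> = {f. (\<forall>\<epsilon>\<in>{0<..<1}. smooth_on \<omega> (f \<epsilon>)) \<and>
     (\<forall>K \<alpha>. compact K \<and> K \<subseteq> \<omega> \<and> K \<noteq> {} \<longrightarrow>
       (\<exists>a::real. (\<lambda>\<epsilon>. SUP x\<in>K. norm (mi_deriv \<alpha> (f \<epsilon>) x)) \<in> O[at_right 0](\<lambda>\<epsilon>. \<epsilon> powr a)))}"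

definition null_nets :: "(real ^ 'n::finite) set \<Rightarrow> (real \<Rightarrow> real ^ 'n \<Rightarrow> complex) set" where
  "null_nets \<omega> = {f. (\<forall>\<epsilon>\<in>{0<..<1}. smooth_on \<omega> (f \<epsilon>)) \<and>
     (\<forall>K \<alpha>. compact K \<and> K \<subseteq> \<omega> \<and> K \<noteq> {} \<longrightarrow>
       (\<forall>a::real. (\<lambda>\<epsilon>. SUP x\<in>K. norm (mi_deriv \<alpha> (f \<epsilon>) x)) \<in> O[at_right 0](\<lambda>\<epsilon>. \<epsilon> powr a)))}"

definition colombeau_rel ::
    "(real ^ 'n::finite) set \<Rightarrow> ((real \<Rightarrow> real ^ 'n \<Rightarrow> complex) \<times> (real \<Rightarrow> real ^ 'n \<Rightarrow> complex)) set"
where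
  "colombeau_rel \<omega> = {(f, g). f \<in> moderate_nets \<omega> \<and> g \<in> moderate_nets \<omega> \<and>
     (\<lambda>\<epsilon> x. f \<epsilon> x - g \<epsilon> x) \<in> null_nets \<omega>}"

definition colombeau :: "(real ^ 'n::finite) set \<Rightarrow> (real \<Rightarrow> real ^ 'n \<Rightarrow> complex) set set" where
  "colombeau \<omega> = moderate_nets \<omega> // colombeau_rel \<omega>"

definition colombeau_class ::
    "(real ^ 'n::finite) set \<Rightarrow> (real \<Rightarrow> real ^ 'n \<Rightarrow> complex) \<Rightarrow> (real \<Rightarrow> real ^ 'n \<Rightarrow> complex) set" where
  "colombeau_class \<omega> f = colombeau_rel \<omega> `` {f}"

lemma colombeau_class_in_colombeau:
  "f \<in> moderate_nets \<omega> \<Longrightarrow> colombeau_class \<omega> f \<in> colombeau \<omega>"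
  unfolding colombeau_class_def colombeau_def by (rule quotientI)


section \<open>Analytic wave front sets\<close>

definition compactly_inside :: "(real ^ 'n::finite) set \<Rightarrow> (real ^ 'n) set \<Rightarrow> bool" where
  "compactly_inside A B \<longleftrightarrow> compact (closure A) \<and> closure A \<subseteq> B"

definition admissible_cutoff ::
    "(real ^ 'n::finite) set \<Rightarrow> real ^ 'n \<Rightarrow> (real ^ 'n) set \<Rightarrow> (real ^ 'n) set \<Rightarrow>
     (nat \<Rightarrow> real ^ 'n \<Rightarrow> complex) \<Rightarrow> bool" where
  "admissible_cutoff \<omega> x\<^sub>0 W U \<kappa> \<longleftrightarrow>
     open W \<and> open U \<and> x\<^sub>0 \<in> W \<and> compactly_inside W U \<and> compactly_inside U \<omega> \<and>
     (\<forall>n\<ge>1. \<kappa> n \<in> test_functions U \<and> (\<forall>x\<in>W. \<kappa> n x = 1)) \<and>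
     (\<forall>\<alpha>. \<exists>C>0. \<forall>n\<ge>1. \<forall>\<beta>. mi_abs \<beta> \<le> n \<longrightarrow>
        (\<forall>x. norm (mi_deriv (\<alpha> + \<beta>) (\<kappa> n) x) \<le> C * (C * real n) ^ mi_abs \<beta>))"

(* Unlike the library predicate cone, which demands closure under multiplication by 0 and so
   would leave only the whole space. *)
definition open_cone_around :: "real ^ 'n::finite \<Rightarrow> (real ^ 'n) set \<Rightarrow> bool" where
  "open_cone_around \<xi>\<^sub>0 \<Gamma> \<longleftrightarrow> open \<Gamma> \<and> \<xi>\<^sub>0 \<in> \<Gamma> \<and> (\<forall>\<xi>\<in>\<Gamma>. \<forall>t>0. t *\<^sub>R \<xi> \<in> \<Gamma>)"

definition microanalytic_at ::
    "(real ^ 'n::finite) set \<Rightarrow> ((real ^ 'n \<Rightarrow> complex) \<Rightarrow> complex) \<Rightarrow> real ^ 'n \<Rightarrow> real ^ 'n \<Rightarrow> bool" where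
  "microanalytic_at \<omega> f x\<^sub>0 \<xi>\<^sub>0 \<longleftrightarrow>
     (\<exists>W U \<kappa> \<Gamma> C. admissible_cutoff \<omega> x\<^sub>0 W U \<kappa> \<and> open_cone_around \<xi>\<^sub>0 \<Gamma> \<and> C > 0 \<and>
        (\<forall>n\<ge>1. \<forall>\<xi>\<in>\<Gamma>.
           norm (dist_fourier \<omega> (dist_mult (\<kappa> n) f) \<xi>) \<le> C * (C * real n / (1 + norm \<xi>)) ^ n))"

definition WF_a ::
    "(real ^ 'n::finite) set \<Rightarrow> ((real ^ 'n \<Rightarrow> complex) \<Rightarrow> complex) \<Rightarrow> ((real ^ 'n) \<times> (real ^ 'n)) set" where
  "WF_a \<omega> f = \<omega> \<times> (UNIV - {0}) - {(x\<^sub>0, \<xi>\<^sub>0). microanalytic_at \<omega> f x\<^sub>0 \<xi>\<^sub>0}"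

(* G is an element of colombeau \<omega>, i.e. the set of its representatives. *)
definition g_microanalytic_at ::
    "(real ^ 'n::finite) set \<Rightarrow> (real \<Rightarrow> real ^ 'n \<Rightarrow> complex) set \<Rightarrow> real ^ 'n \<Rightarrow> real ^ 'n \<Rightarrow> bool" where
  "g_microanalytic_at \<omega> G x\<^sub>0 \<xi>\<^sub>0 \<longleftrightarrow>
     (\<exists>W U \<kappa> \<Gamma> C a \<epsilon>\<^sub>0. \<exists>g\<in>G. admissible_cutoff \<omega> x\<^sub>0 W U \<kappa> \<and> open_cone_around \<xi>\<^sub>0 \<Gamma> \<and>
        a > 0 \<and> C > 0 \<and> \<epsilon>\<^sub>0 \<in> {0<..<1} \<and>
        (\<forall>n\<ge>1. \<forall>\<xi>\<in>\<Gamma>. \<forall>\<epsilon>\<in>{0<..<\<epsilon>\<^sub>0}.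
           norm (fourier (\<lambda>x. \<kappa> n x * g \<epsilon> x) \<xi>)
             \<le> C * \<epsilon> powr (- a) * (C * real n / (1 + norm \<xi>)) ^ n))"

definition WF_ga ::
    "(real ^ 'n::finite) set \<Rightarrow> (real \<Rightarrow> real ^ 'n \<Rightarrow> complex) set \<Rightarrow> ((real ^ 'n) \<times> (real ^ 'n)) set" where
  "WF_ga \<omega> G = \<omega> \<times> (UNIV - {0}) - {(x\<^sub>0, \<xi>\<^sub>0). g_microanalytic_at \<omega> G x\<^sub>0 \<xi>\<^sub>0}"

end

theory Submission
  imports Defs "HOL-Probability.Probability"
begin

text \<open>Put \<open>T\<^sub>n(\<xi>)\<close> for the Fourier transform of \<open>\<kappa>\<^sub>n f\<close>.

  If \<open>F\<close> is g-microanalytic, then, since \<open>f * \<phi>\<^sub>\<epsilon> - f\<close> is weakly of order \<open>\<epsilon>\<close> and a null net is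
  at least that small, \<open>\<bar>T\<^sub>n(\<xi>)\<bar> \<le> C (\<epsilon>\<^bsup>-q\<^esup> B\<^sup>n + \<epsilon> (1 + \<bar>\<xi>\<bar>)\<^bsup>M\<^esup>)\<close> for all small \<open>\<epsilon>\<close>, where
  \<open>B = C n / (1 + \<bar>\<xi>\<bar>)\<close> and \<open>M\<close> does not depend on \<open>n\<close>. For \<open>n = (q + 1)(m + M)\<close> the choice
  \<open>\<epsilon> = B\<^bsup>m + M\<^esup>\<close> gives the analytic estimate of order \<open>m\<close> for the cut-offs \<open>\<kappa>\<^sub>n\<close>, relabelled by \<open>m\<close>.

  Conversely let \<open>f\<close> be microanalytic. Cutting off the mollifier near the origin changes \<open>F\<close> only by a
  null net. For the representative \<open>f * (\<beta> \<phi>\<^sub>\<epsilon>)\<close> so obtained, near \<open>x\<^sub>0\<close> one may replace \<open>f\<close> by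
  \<open>\<kappa>\<^sub>n f\<close>, whose Fourier transform is multiplied by functions bounded uniformly in \<open>\<epsilon>\<close>. The
  remaining multiplication by a cut-off supported near \<open>x\<^sub>0\<close>, namely \<open>\<kappa>\<^sub>n\<close> contracted towards \<open>x\<^sub>0\<close>, is a
  convolution on the Fourier side, which is estimated in a smaller cone.\<close>

section \<open>Partial derivatives of smooth functions\<close>

text \<open>The obstacle to passing from f to F is that f * \<open>\<phi>\<^sub>\<epsilon>\<close>
  near \<open>x\<^sub>0\<close> sees f everywhere, because \<phi> may be supported everywhere, while
  the hypothesis speaks of f near \<open>x\<^sub>0\<close> only. A mollifier of short range removes
  this. Even then f may be replaced by \<open>\<kappa>\<^sub>n\<close> f only at points well inside
  W, whereas \<open>\<kappa>\<^sub>n\<close> spreads over U; hence the contraction, which costs one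
  constant factor per derivative. In the resulting convolution either the argument of
  \<open>T\<^sub>n\<close> stays in the original cone, or the argument of the transformed cut-off is
  comparable with \<xi>. In each case one factor supplies the n-th power and polynomial bounds
  suffice for the other. In the other direction \<epsilon> cannot just tend to 0, since the estimate
  for g deteriorates like \<epsilon>^(-q). Of the q + 1 equal blocks of factors B, q cancel this
  loss and one remains; the M additional indices cancel (1 + |\<xi>|)^M. Distributions enter through
  continuous, polynomially bounded transforms only: f is always moved inside a Fourier integral,
  which reduces every estimate to one of ordinary integrals.\<close>

abbreviation pder :: "'n list \<Rightarrow> (real ^ 'n::finite \<Rightarrow> complex) \<Rightarrow> real ^ 'n \<Rightarrow> complex" where
  "pder js f \<equiv> foldr partial js f"

abbreviation smooth :: "(real ^ 'n::finite \<Rightarrow> complex) \<Rightarrow> bool" where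
  "smooth \<equiv> smooth_on UNIV"

lemma partial_eq: "(f has_derivative f') (at x) \<Longrightarrow> partial i f x = f' (axis i 1)"
  unfolding partial_def by (metis frechet_derivative_at)

lemma smooth_on_partial: "smooth_on S f \<Longrightarrow> smooth_on S (partial i f)"
  unfolding smooth_on_def
proof
  fix js assume "\<forall>js. pder js f differentiable_on S"
  then have "pder (js @ [i]) f differentiable_on S" by blast
  then show "pder js (partial i f) differentiable_on S" by simp
qed

lemma smooth_on_pder: "smooth_on S f \<Longrightarrow> smooth_on S (pder js f)"
  by (induction js) (auto intro: smooth_on_partial)

lemma smooth_on_imp_differentiable_on: "smooth_on S f \<Longrightarrow> f differentiable_on S"
  unfolding smooth_on_def by (drule spec[of _ "[]"]) simp

lemma smooth_on_imp_continuous_on: "smooth_on S f \<Longrightarrow> continuous_on S f"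
  by (rule differentiable_imp_continuous_on) (rule smooth_on_imp_differentiable_on)

lemma smooth_differentiable: "smooth f \<Longrightarrow> f differentiable (at x)"
  using smooth_on_imp_differentiable_on[of UNIV f] by (simp add: differentiable_on_def)

lemma smooth_has_derivative:
  "smooth f \<Longrightarrow> (f has_derivative frechet_derivative f (at x)) (at x)"
  using smooth_differentiable frechet_derivative_works by blast

lemma smooth_measurable: "smooth f \<Longrightarrow> f \<in> borel_measurable borel"
  by (rule borel_measurable_continuous_onI) (rule smooth_on_imp_continuous_on)

text \<open>\<open>smooth_on\<close> quantifies over all iterated partial derivatives. A class of
  differentiable functions that is closed under a single one settles them all by induction on the
  list.\<close>

lemma smooth_coinduct:
  assumes "P f"
    and diff: "\<And>f x. P f \<Longrightarrow> f differentiable (at x)"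
    and closed: "\<And>f i. P f \<Longrightarrow> P (partial i f)"
  shows "smooth f"
proof -
  have "P (pder js f)" for js
    by (induction js) (use assms(1) closed in auto)
  then show ?thesis
    unfolding smooth_on_def using diff by (auto intro!: differentiable_at_imp_differentiable_on)
qed

section \<open>Sums and products of smooth functions\<close>

lemma partial_add_at:
  assumes "f differentiable (at x)" "g differentiable (at x)"
  shows "partial i (\<lambda>x. f x + g x) x = partial i f x + partial i g x"
proof -
  have "((\<lambda>x. f x + g x) has_derivative
      (\<lambda>h. frechet_derivative f (at x) h + frechet_derivative g (at x) h)) (at x)"
    using assms by (intro has_derivative_add) (simp_all add: frechet_derivative_works)
  from partial_eq[OF this] show ?thesis by (simp add: partial_def)
qed

lemma partial_mult_at:
  assumes "f differentiable (at x)" "g differentiable (at x)"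
  shows "partial i (\<lambda>x. f x * g x) x = partial i f x * g x + f x * partial i g x"
proof -
  have "((\<lambda>x. f x * g x) has_derivative
      (\<lambda>h. f x * frechet_derivative g (at x) h + frechet_derivative f (at x) h * g x)) (at x)"
    using assms by (intro has_derivative_mult) (simp_all add: frechet_derivative_works)
  from partial_eq[OF this] show ?thesis by (simp add: partial_def)
qed

text \<open>The Leibniz rule leads from one product to a sum of two, so products alone do not form a
  closed class for \<open>smooth_coinduct\<close>; finite sums of products do.\<close>

inductive sum_of_products :: "(real ^ 'n::finite \<Rightarrow> complex) \<Rightarrow> bool" where
  prod: "smooth f \<Longrightarrow> smooth g \<Longrightarrow> sum_of_products (\<lambda>x. f x * g x)"
| add: "sum_of_products f \<Longrightarrow> sum_of_products g \<Longrightarrow> sum_of_products (\<lambda>x. f x + g x)"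

lemma sum_of_products_differentiable: "sum_of_products f \<Longrightarrow> f differentiable (at x)"
proof (induction rule: sum_of_products.induct)
  case (prod f g)
  then show ?case by (intro differentiable_mult smooth_differentiable)
next
  case (add f g)
  then show ?case by (intro differentiable_add)
qed

lemma sum_of_products_partial: "sum_of_products f \<Longrightarrow> sum_of_products (partial i f)"
proof (induction rule: sum_of_products.induct)
  case (prod f g)
  have "partial i (\<lambda>x. f x * g x) = (\<lambda>x. partial i f x * g x + f x * partial i g x)"
    using prod by (auto intro!: partial_mult_at smooth_differentiable)
  then show ?case using prod by (auto intro!: sum_of_products.intros smooth_on_partial)
next
  case (add f g)
  have "partial i (\<lambda>x. f x + g x) = (\<lambda>x. partial i f x + partial i g x)"
    using add by (auto intro!: partial_add_at sum_of_products_differentiable)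
  then show ?case using add by (auto intro!: sum_of_products.intros)
qed

lemma smooth_sum_of_products: "sum_of_products f \<Longrightarrow> smooth f"
  by (rule smooth_coinduct[of sum_of_products])
    (auto intro: sum_of_products_differentiable sum_of_products_partial)

lemma smooth_mult: "smooth f \<Longrightarrow> smooth g \<Longrightarrow> smooth (\<lambda>x. f x * g x)"
  by (rule smooth_sum_of_products, rule sum_of_products.prod)

lemma partial_const: "partial i (\<lambda>_. c) = (\<lambda>_. 0)"
  by (rule ext) (subst partial_eq[OF has_derivative_const], simp)

lemma smooth_const: "smooth (\<lambda>_. c)"
  by (rule smooth_coinduct[of "\<lambda>f. \<exists>c. f = (\<lambda>_. c)"]) (auto simp: partial_const)

text \<open>Each summand is written as 1 times itself, which puts the sum into the class already
  treated.\<close>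

lemma smooth_add: "smooth f \<Longrightarrow> smooth g \<Longrightarrow> smooth (\<lambda>x. f x + g x)"
  using smooth_sum_of_products[OF sum_of_products.add[of "\<lambda>x. 1 * f x" "\<lambda>x. 1 * g x"]]
    sum_of_products.prod[OF smooth_const[of 1], of f] sum_of_products.prod[OF smooth_const[of 1], of g]
  by simp

lemma smooth_minus: "smooth f \<Longrightarrow> smooth (\<lambda>x. - f x)"
  using smooth_mult[OF smooth_const[of "-1"], of f] by simp

lemma smooth_diff: "smooth f \<Longrightarrow> smooth g \<Longrightarrow> smooth (\<lambda>x. f x - g x)"
  using smooth_add[OF _ smooth_minus[of g], of f] by simp

lemma pder_add:
  assumes "smooth f" "smooth g"
  shows "pder js (\<lambda>x. f x + g x) = (\<lambda>x. pder js f x + pder js g x)"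
proof (induction js)
  case (Cons i js)
  show ?case
    by (rule ext) (use assms in \<open>simp add: Cons partial_add_at smooth_differentiable smooth_on_pder\<close>)
qed simp

lemma partial_mult:
  "smooth f \<Longrightarrow> smooth g \<Longrightarrow> partial i (\<lambda>x. f x * g x) = (\<lambda>x. partial i f x * g x + f x * partial i g x)"
  by (rule ext) (auto intro: partial_mult_at smooth_differentiable)

lemma pder_const: "pder js (\<lambda>_. c) = (\<lambda>_. if js = [] then c else 0)"
  by (induction js) (auto simp: partial_const)

lemma pder_cmult:
  assumes "smooth f"
  shows "pder js (\<lambda>x. c * f x) = (\<lambda>x. c * pder js f x)"
proof (induction js)
  case (Cons i js)
  show ?case
    by (simp add: Cons partial_mult[OF smooth_const smooth_on_pder[OF assms]] partial_const)
qed simp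

lemma pder_diff:
  assumes "smooth f" "smooth g"
  shows "pder js (\<lambda>x. f x - g x) = (\<lambda>x. pder js f x - pder js g x)"
  using pder_add[OF assms(1) smooth_mult[OF smooth_const[of "-1"] assms(2)]] pder_cmult[OF assms(2), of js "-1"]
  by simp

lemma norm_pder_mult_le:
  assumes "smooth f" "smooth g" "set js \<subseteq> J" "length js \<le> m" "0 \<le> A" "0 \<le> B"
    and "\<And>ks. set ks \<subseteq> J \<Longrightarrow> length ks \<le> m \<Longrightarrow> norm (pder ks f x) \<le> A"
    and "\<And>ks. set ks \<subseteq> J \<Longrightarrow> length ks \<le> m \<Longrightarrow> norm (pder ks g x) \<le> B"
  shows "norm (pder js (\<lambda>x. f x * g x) x) \<le> 2 ^ length js * A * B"
  using assms
\<comment> \<open>The last entry of the list acts first. Removing it leaves the remaining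
  derivatives of a sum of two products, to which the hypothesis applies with m lowered by
  one.\<close>
proof (induction js arbitrary: f g m rule: rev_induct)
  case Nil
  show ?case using Nil(7)[of "[]"] Nil(8)[of "[]"] Nil
    by (simp add: norm_mult mult_mono)
next
  case (snoc i js)
  obtain m' where m: "m = Suc m'" using snoc.prems by (cases m) auto
  have sm: "smooth (partial i f)" "smooth (partial i g)"
    using snoc.prems by (auto intro: smooth_on_partial)
  have pf: "norm (pder ks (partial i f) x) \<le> A" if "set ks \<subseteq> J" "length ks \<le> m'" for ks
    using snoc.prems(7)[of "ks @ [i]"] that snoc.prems m by auto
  have pg: "norm (pder ks (partial i g) x) \<le> B" if "set ks \<subseteq> J" "length ks \<le> m'" for ks
    using snoc.prems(8)[of "ks @ [i]"] that snoc.prems m by auto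
  have 1: "norm (pder js (\<lambda>x. partial i f x * g x) x) \<le> 2 ^ length js * A * B"
    by (rule snoc.IH[of _ _ m']) (use snoc.prems sm pf pg m in auto)
  have 2: "norm (pder js (\<lambda>x. f x * partial i g x) x) \<le> 2 ^ length js * A * B"
    by (rule snoc.IH[of _ _ m']) (use snoc.prems sm pf pg m in auto)
  have "pder (js @ [i]) (\<lambda>x. f x * g x) x
      = pder js (\<lambda>x. partial i f x * g x) x + pder js (\<lambda>x. f x * partial i g x) x"
    using snoc.prems sm by (simp add: partial_mult pder_add smooth_mult)
  then show ?case using norm_triangle_mono[OF 1 2] by (simp add: mult_ac)
qed

section \<open>Affine substitutions and locality of derivatives\<close>

lemma partial_affine:
  assumes "f differentiable (at (a *\<^sub>R x + b))"
  shows "partial i (\<lambda>x. f (a *\<^sub>R x + b)) x = of_real a * partial i f (a *\<^sub>R x + b)"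
proof -
  have f: "(f has_derivative frechet_derivative f (at (a *\<^sub>R x + b))) (at (a *\<^sub>R x + b))"
    using assms by (simp add: frechet_derivative_works)
  have "((\<lambda>x. a *\<^sub>R x + b) has_derivative (\<lambda>h. a *\<^sub>R h)) (at x)"
    by (auto intro!: derivative_eq_intros)
  from has_derivative_compose[OF this f]
  have "partial i (\<lambda>x. f (a *\<^sub>R x + b)) x = frechet_derivative f (at (a *\<^sub>R x + b)) (a *\<^sub>R axis i 1)"
    by (rule partial_eq)
  then show ?thesis
    using linear_scale[OF has_derivative_linear[OF f]] by (simp add: partial_def scaleR_conv_of_real)
qed

lemma smooth_affine:
  assumes "smooth f" shows "smooth (\<lambda>x. f (a *\<^sub>R x + b))"
\<comment> \<open>The scalar c in the class absorbs the factor a that the chain rule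
  produces.\<close>
proof (rule smooth_coinduct[of "\<lambda>g. \<exists>f c. smooth f \<and> g = (\<lambda>x. c * f (a *\<^sub>R x + b))"])
  show "\<exists>f' c. smooth f' \<and> (\<lambda>x. f (a *\<^sub>R x + b)) = (\<lambda>x. c * f' (a *\<^sub>R x + b))"
    using assms by (intro exI[of _ f] exI[of _ 1]) simp
next
  fix g x assume "\<exists>f c. smooth f \<and> g = (\<lambda>x. c * f (a *\<^sub>R x + b))"
  then obtain f c where f: "smooth f" "g = (\<lambda>x. c * f (a *\<^sub>R x + b))" by blast
  have "(\<lambda>x. f (a *\<^sub>R x + b)) differentiable (at x)"
    by (rule differentiable_compose[of f]) (auto intro!: smooth_differentiable f)
  then show "g differentiable (at x)" using f(2) by simp
next
  fix g i assume "\<exists>f c. smooth f \<and> g = (\<lambda>x. c * f (a *\<^sub>R x + b))"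
  then obtain f c where f: "smooth f" "g = (\<lambda>x. c * f (a *\<^sub>R x + b))" by blast
  have d: "(\<lambda>x. f (a *\<^sub>R x + b)) differentiable (at x)" for x
    by (rule differentiable_compose[of f]) (auto intro!: smooth_differentiable f)
  have "partial i g = (\<lambda>x. (c * of_real a) * partial i f (a *\<^sub>R x + b))"
    by (rule ext)
      (simp add: f(2) partial_mult_at[OF _ d] partial_const
        partial_affine[OF smooth_differentiable[OF f(1)]])
  then show "\<exists>f c. smooth f \<and> partial i g = (\<lambda>x. c * f (a *\<^sub>R x + b))"
    using smooth_on_partial[OF f(1)] by blast
qed

lemma pder_affine:
  assumes "smooth f"
  shows "pder js (\<lambda>x. f (a *\<^sub>R x + b)) = (\<lambda>x. of_real a ^ length js * pder js f (a *\<^sub>R x + b))"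
proof (induction js)
  case (Cons i js)
  have "partial i (\<lambda>x. of_real a ^ length js * pder js f (a *\<^sub>R x + b)) =
      (\<lambda>x. of_real a ^ length js * partial i (\<lambda>x. pder js f (a *\<^sub>R x + b)) x)"
    using pder_cmult[OF smooth_affine[OF smooth_on_pder[OF assms]], of "[i]"] by simp
  then show ?case
    by (simp add: Cons partial_affine[OF smooth_differentiable[OF smooth_on_pder[OF assms]]] mult_ac)
qed simp

text \<open>Differentiability is not at issue: the two functions have the same set of derivatives at
  x, so the choice behind \<open>frechet_derivative\<close> agrees, even if that set is
  empty.\<close>

lemma partial_cong_open:
  assumes "open S" "x \<in> S" "\<And>y. y \<in> S \<Longrightarrow> f y = g y"
  shows "partial i f x = partial i g x"
proof -
  have 1: "(g has_derivative D) (at x)" if "(f has_derivative D) (at x)" for D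
    by (rule has_derivative_transform_within_open[OF that assms(1,2)]) (rule assms(3))
  have 2: "(f has_derivative D) (at x)" if "(g has_derivative D) (at x)" for D
    by (rule has_derivative_transform_within_open[OF that assms(1,2)]) (rule assms(3)[symmetric])
  have "(\<lambda>D. (f has_derivative D) (at x)) = (\<lambda>D. (g has_derivative D) (at x))"
    using 1 2 by blast
  then show ?thesis unfolding partial_def frechet_derivative_def by simp
qed

lemma pder_cong_open:
  assumes "open S" "x \<in> S" "\<And>y. y \<in> S \<Longrightarrow> f y = g y"
  shows "pder js f x = pder js g x"
  using assms(2)
proof (induction js arbitrary: x)
  case (Cons i js)
  then show ?case
    by (simp, intro partial_cong_open[OF assms(1)]) auto
qed (use assms in simp)

lemma smooth_on_cong_open:
  assumes "open S" "\<And>y. y \<in> S \<Longrightarrow> f y = g y" "smooth_on S f"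
  shows "smooth_on S g"
  unfolding smooth_on_def
proof
  fix js
  have eq: "pder js f x = pder js g x" if "x \<in> S" for x
    using pder_cong_open[OF assms(1) that] assms(2) by blast
  have "pder js g differentiable (at x)" if x: "x \<in> S" for x
  proof -
    have "pder js f differentiable (at x)"
      using assms(1,3) x by (simp add: smooth_on_def differentiable_on_eq_differentiable_at)
    then obtain D where "(pder js f has_derivative D) (at x)" by (auto simp: differentiable_def)
    then have "(pder js g has_derivative D) (at x)"
      by (rule has_derivative_transform_within_open[OF _ assms(1) x]) (rule eq)
    then show ?thesis by (auto simp: differentiable_def)
  qed
  then show "pder js g differentiable_on S"
    by (auto intro!: differentiable_at_imp_differentiable_on)
qed

lemma smooth_on_subset: "smooth_on T f \<Longrightarrow> S \<subseteq> T \<Longrightarrow> smooth_on S f"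
  unfolding smooth_on_def using differentiable_on_subset by blast

lemma pder_zero_outside_support:
  assumes "x \<notin> closure {x. f x \<noteq> 0}"
  shows "pder js f x = 0"
proof -
  have "pder js f x = pder js (\<lambda>_. 0) x"
    by (rule pder_cong_open[of "- closure {x. f x \<noteq> 0}"])
      (use assms closure_subset[of "{x. f x \<noteq> 0}"] in auto)
  then show ?thesis by (simp add: pder_const)
qed

section \<open>Multi-indices as lists of coordinates\<close>

lemma ex_list_of_counts: "\<exists>js. \<forall>i::'n::finite. count_list js i = (\<alpha> :: 'n multi_index) $ i"
proof -
  have "\<exists>js. \<forall>i. count_list js i = (if i \<in> A then \<alpha> $ i else 0)" if "finite A" for A :: "'n set"
    using that
  proof induction
    case empty
    show ?case by (intro exI[of _ "[]"]) simp
  next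
    case (insert a A)
    then obtain js where js: "\<forall>i. count_list js i = (if i \<in> A then \<alpha> $ i else 0)" by blast
    have c: "count_list (replicate k a) i = (if i = a then k else 0)" for k i
      by (induction k) auto
    show ?case
      by (rule exI[of _ "replicate (\<alpha> $ a) a @ js"]) (use js insert in \<open>auto simp: c\<close>)
  qed
  from this[of UNIV] show ?thesis by simp
qed

text \<open>The chosen list depends on \<alpha> alone, so one js serves every f. This is how
  estimates pass between multi-indices and lists.\<close>

lemma mi_deriv_eq_pder:
  "\<exists>js. (\<forall>f. mi_deriv \<alpha> f = pder js f) \<and> (\<forall>i. count_list js i = \<alpha> $ i) \<and> length js = mi_abs \<alpha>"
proof -
  let ?js = "SOME js. \<forall>i. count_list js i = \<alpha> $ i"
  have c: "\<forall>i. count_list ?js i = \<alpha> $ i"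
    using someI_ex[OF ex_list_of_counts] .
  have "length ?js = (\<Sum>i\<in>UNIV. count_list ?js i)"
    by (subst sum_count_set) auto
  also have "\<dots> = mi_abs \<alpha>" unfolding mi_abs_def by (rule sum.cong) (use c in auto)
  finally have l: "length ?js = mi_abs \<alpha>" .
  show ?thesis by (rule exI[of _ ?js], intro conjI allI) (use c l in \<open>simp_all only: mi_deriv_def\<close>)
qed

lemma mi_deriv_0: "mi_deriv (0 :: 'n::finite multi_index) f = f"
proof -
  from mi_deriv_eq_pder[of "0 :: 'n multi_index"] obtain js where
    js: "(\<forall>f :: real ^ 'n \<Rightarrow> complex. mi_deriv 0 f = pder js f) \<and> (\<forall>i. count_list js i = 0 $ i) \<and> 
      length js = mi_abs (0 :: 'n multi_index)" ..
  then have "js = []" by (simp add: mi_abs_def)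
  with js show ?thesis by simp
qed

definition mi_single :: "'n \<Rightarrow> nat \<Rightarrow> 'n::finite multi_index" where
  "mi_single i k = (\<chi> j. if j = i then k else 0)"

lemma mi_abs_single [simp]: "mi_abs (mi_single i k) = k"
  by (simp add: mi_abs_def mi_single_def)

lemma mi_single_add: "mi_single i j + mi_single i k = mi_single i (j + k)"
  by (simp add: mi_single_def vec_eq_iff)

lemma mi_power_single: "mi_power x (mi_single i k) = (x $ i) ^ k"
proof -
  have "mi_power x (mi_single i k) = (\<Prod>j\<in>UNIV. if j = i then x $ i ^ k else 1)"
    unfolding mi_power_def by (rule prod.cong) (auto simp: mi_single_def)
  then show ?thesis by simp
qed

text \<open>Only one list has these counts, so here the choice of an ordering is forced. Pure
  derivatives can therefore be read off from hypotheses on \<open>mi_deriv\<close>.\<close>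

lemma mi_deriv_single: "mi_deriv (mi_single i k) f = pder (replicate k i) f"
proof -
  from mi_deriv_eq_pder[of "mi_single i k"] obtain js where
    "(\<forall>f. mi_deriv (mi_single i k) f = pder js f) \<and> (\<forall>j. count_list js j = mi_single i k $ j) \<and>
      length js = mi_abs (mi_single i k)" ..
  then have js: "mi_deriv (mi_single i k) f = pder js f" "count_list js j = mi_single i k $ j"
    "length js = k" for j by simp_all
  have "set js \<subseteq> {i}"
  proof
    fix j assume "j \<in> set js"
    then have "count_list js j \<noteq> 0" by (simp add: count_list_0_iff)
    then show "j \<in> {i}" using js(2)[of j] by (auto simp: mi_single_def split: if_splits)
  qed
  then have "js = replicate k i" by (intro replicate_eqI js(3)) auto
  then show ?thesis using js(1) by simp
qed

lemma eq_replicate: "set js \<subseteq> {i} \<Longrightarrow> js = replicate (length js) i"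
  by (rule replicate_eqI) auto

section \<open>Fourier integrals\<close>

text \<open>An integrable weight that turns pointwise bounds into bounds on integrals. The exponent
  is twice the dimension so that every coordinate receives two powers.\<close>

definition wt :: "real ^ 'n::finite \<Rightarrow> real" where
  "wt x = (1 / (1 + norm x)) ^ (2 * CARD('n))"

lemma wt_pos: "0 < wt x"
  unfolding wt_def by (intro zero_less_power divide_pos_pos) (auto simp: add_pos_nonneg)

lemma wt_nonneg [simp]: "0 \<le> wt x"
  using wt_pos[of x] by simp

lemma wt_mult_power: "wt (x :: real ^ 'n::finite) * (1 + norm x) ^ (2 * CARD('n)) = 1"
proof -
  have "1 + norm x \<noteq> 0" using norm_ge_zero[of x] by linarith
  then show ?thesis unfolding wt_def by (simp add: power_divide)
qed

text \<open>Lets one multiple of the weight at x dominate the weight on the unit ball around x, as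
  the dominated convergence of difference quotients requires.\<close>

lemma wt_le_wt_shift:
  fixes x h :: "real ^ 'n::finite"
  assumes "norm h \<le> 1"
  shows "wt (x + h) \<le> 2 ^ (2 * CARD('n)) * wt x"
proof -
  have "norm x \<le> norm (x + h) + norm h"
    using norm_triangle_ineq4[of "x + h" h] by simp
  then have "1 + norm x \<le> 2 * (1 + norm (x + h))"
    using assms norm_ge_zero[of "x + h"] by (smt (verit))
  then have "1 / (1 + norm (x + h)) \<le> 2 * (1 / (1 + norm x))"
    using add_pos_nonneg[OF zero_less_one norm_ge_zero[of x]]
      add_pos_nonneg[OF zero_less_one norm_ge_zero[of "x + h"]]
    by (simp add: divide_simps)
  then have "wt (x + h) \<le> (2 * (1 / (1 + norm x))) ^ (2 * CARD('n))"
    unfolding wt_def by (rule power_mono) simp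
  then show ?thesis unfolding wt_def by (simp add: power_mult_distrib power_divide)
qed

lemma wt_measurable [measurable]: "wt \<in> borel_measurable borel"
  unfolding wt_def[abs_def] by measurable

lemma wt_integrable [simp]: "integrable lborel (wt :: real ^ 'n::finite \<Rightarrow> real)"
proof (rule integrableI_bounded)
  have 1: "integrable lborel (\<lambda>x::real. inverse (1 + x\<^sup>2))"
    using integrable_inverse_1_plus_square by (simp add: set_integrable_def)
  then have fin: "(\<integral>\<^sup>+ x. ennreal (inverse (1 + x\<^sup>2)) \<partial>lborel) < \<infinity>"
    by (subst nn_integral_eq_integral) (auto simp: add_nonneg_nonneg)
  \<comment> \<open>Each of the d factors (1 + norm x)^(-2) lies below an integrable function of its
    own coordinate, which reduces the integral to one dimension.\<close>
  have le: "wt x \<le> (\<Prod>b\<in>Basis. inverse (1 + (x \<bullet> b)\<^sup>2))" for x :: "real ^ 'n"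
  proof -
    have "(1 / (1 + norm x))\<^sup>2 \<le> inverse (1 + (x \<bullet> b)\<^sup>2)" if "b \<in> Basis" for b :: "real ^ 'n"
    proof -
      have "\<bar>x \<bullet> b\<bar> \<le> norm x" using Basis_le_norm[OF that] .
      then have "(x \<bullet> b)\<^sup>2 \<le> (norm x)\<^sup>2" by (simp add: abs_le_square_iff[symmetric])
      then have "1 + (x \<bullet> b)\<^sup>2 \<le> (1 + norm x)\<^sup>2"
        by (simp add: power2_sum add_increasing2)
      then have "inverse ((1 + norm x)\<^sup>2) \<le> inverse (1 + (x \<bullet> b)\<^sup>2)"
        by (intro le_imp_inverse_le) (auto simp: add_pos_nonneg)
      then show ?thesis by (simp add: power_divide inverse_eq_divide)
    qed
    then have "(\<Prod>b\<in>(Basis :: (real ^ 'n) set). (1 / (1 + norm x))\<^sup>2)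
        \<le> (\<Prod>b\<in>Basis. inverse (1 + (x \<bullet> b)\<^sup>2))"
      by (intro prod_mono) auto
    then show ?thesis by (simp add: wt_def power_mult)
  qed
  have "(\<integral>\<^sup>+ x. ennreal (norm (wt (x :: real ^ 'n))) \<partial>lborel)
      \<le> (\<integral>\<^sup>+ x. (\<Prod>b\<in>Basis. ennreal (inverse (1 + ((x :: real ^ 'n) \<bullet> b)\<^sup>2))) \<partial>lborel)"
    by (intro nn_integral_mono) (auto simp: prod_ennreal le ennreal_leI add_nonneg_nonneg)
  also have "\<dots> = (\<Prod>b\<in>(Basis :: (real ^ 'n) set). (\<integral>\<^sup>+ x. ennreal (inverse (1 + x\<^sup>2)) \<partial>lborel))"
    by (rule nn_integral_lborel_prod) auto
  also have "\<dots> < \<infinity>" using fin by (simp add: power_less_top_ennreal)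
  finally show "(\<integral>\<^sup>+ x. ennreal (norm (wt (x :: real ^ 'n))) \<partial>lborel) < \<infinity>" .
qed simp

text \<open>Decay without any regularity: these are the densities whose Fourier integrals can be
  differentiated arbitrarily often.\<close>

definition rapidly_decreasing :: "(real ^ 'n::finite \<Rightarrow> complex) \<Rightarrow> bool" where
  "rapidly_decreasing w \<longleftrightarrow>
     w \<in> borel_measurable borel \<and> (\<forall>k. \<exists>C. \<forall>\<zeta>. norm (w \<zeta>) * (1 + norm \<zeta>) ^ k \<le> C)"

definition polynomially_bounded :: "(real ^ 'n::finite \<Rightarrow> complex) \<Rightarrow> bool" where
  "polynomially_bounded p \<longleftrightarrow>
     p \<in> borel_measurable borel \<and> (\<exists>C k. \<forall>\<zeta>. norm (p \<zeta>) \<le> C * (1 + norm \<zeta>) ^ k)"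

lemma rapidly_decreasing_mult:
  assumes "polynomially_bounded p" "rapidly_decreasing w"
  shows "rapidly_decreasing (\<lambda>\<zeta>. p \<zeta> * w \<zeta>)"
  unfolding rapidly_decreasing_def
proof (intro conjI allI)
  show "(\<lambda>\<zeta>. p \<zeta> * w \<zeta>) \<in> borel_measurable borel"
    using assms by (auto simp: polynomially_bounded_def rapidly_decreasing_def)
  fix k
  obtain C m where C: "\<And>\<zeta>. norm (p \<zeta>) \<le> C * (1 + norm \<zeta>) ^ m"
    using assms(1) unfolding polynomially_bounded_def by blast
  obtain D where D: "\<And>\<zeta>. norm (w \<zeta>) * (1 + norm \<zeta>) ^ (m + k) \<le> D"
    using assms(2) unfolding rapidly_decreasing_def by blast
  have "norm (p \<zeta> * w \<zeta>) * (1 + norm \<zeta>) ^ k \<le> \<bar>C\<bar> * D" for \<zeta>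
  proof -
    have "norm (p \<zeta>) \<le> \<bar>C\<bar> * (1 + norm \<zeta>) ^ m"
      using C[of \<zeta>] by (rule order_trans) (auto intro!: mult_right_mono)
    then have "norm (p \<zeta> * w \<zeta>) * (1 + norm \<zeta>) ^ k
        \<le> (\<bar>C\<bar> * (1 + norm \<zeta>) ^ m) * (norm (w \<zeta>) * (1 + norm \<zeta>) ^ k)"
      unfolding norm_mult mult.assoc[of "norm (p \<zeta>)"] by (rule mult_right_mono) simp
    also have "\<dots> = \<bar>C\<bar> * (norm (w \<zeta>) * (1 + norm \<zeta>) ^ (m + k))"
      by (simp add: power_add mult_ac)
    also have "\<dots> \<le> \<bar>C\<bar> * D" by (intro mult_left_mono D) auto
    finally show ?thesis .
  qed
  then show "\<exists>C. \<forall>\<zeta>. norm (p \<zeta> * w \<zeta>) * (1 + norm \<zeta>) ^ k \<le> C" by blast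
qed

lemma integrable_of_wt_bound:
  fixes w :: "real ^ 'n::finite \<Rightarrow> complex"
  assumes "w \<in> borel_measurable borel" "\<And>\<zeta>. norm (w \<zeta>) \<le> C * wt \<zeta>"
  shows "integrable lborel w"
proof (rule Bochner_Integration.integrable_bound)
  show "integrable lborel (\<lambda>x :: real ^ 'n. C * wt x)" by simp
  show "AE x in lborel. norm (w x) \<le> norm (C * wt x)"
    using assms(2) by (auto intro!: AE_I2 order_trans[OF assms(2)])
qed (use assms(1) in simp)

lemma norm_integral_wt_bound:
  fixes w :: "real ^ 'n::finite \<Rightarrow> complex"
  assumes "\<And>\<zeta>. norm (w \<zeta>) \<le> C * wt \<zeta>"
  shows "norm (LINT \<zeta>|lborel. w \<zeta>) \<le> C * (LINT x|lborel. wt (x :: real ^ 'n))"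
proof -
  have "norm (LINT \<zeta>|lborel. w \<zeta>) \<le> (LINT x|lborel. C * wt (x :: real ^ 'n))"
  proof (cases "integrable lborel w")
    case True
    then show ?thesis by (intro Bochner_Integration.integral_norm_bound_integral assms) auto
  next
    case False
    \<comment> \<open>The integral of a non-integrable function is 0 by convention, so only the sign
      of the bound matters.\<close>
    have "0 \<le> C * wt x" for x :: "real ^ 'n" using norm_ge_zero assms by (rule order_trans)
    then have "0 \<le> (LINT x|lborel. C * wt (x :: real ^ 'n))" by (intro Bochner_Integration.integral_nonneg)
    then show ?thesis using False by (simp add: not_integrable_integral_eq)
  qed
  then show ?thesis by simp
qed

lemma wt_bound_of_power_bound:
  fixes x :: "real ^ 'n::finite"
  assumes "a * (1 + norm x) ^ (2 * CARD('n)) \<le> C"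
  shows "a \<le> C * wt x"
proof -
  have "a = a * (1 + norm x) ^ (2 * CARD('n)) * wt x"
    using wt_mult_power[of x] by (simp add: mult_ac)
  also have "\<dots> \<le> C * wt x" by (rule mult_right_mono[OF assms]) simp
  finally show ?thesis .
qed

lemma rapidly_decreasing_wt_bound:
  assumes "rapidly_decreasing w"
  obtains C where "\<And>\<zeta>. norm (w \<zeta>) \<le> C * wt \<zeta>"
  using assms wt_bound_of_power_bound unfolding rapidly_decreasing_def by metis

lemma rapidly_decreasing_integrable: "rapidly_decreasing w \<Longrightarrow> integrable lborel w"
  using rapidly_decreasing_wt_bound integrable_of_wt_bound rapidly_decreasing_def by metis

lemma rapidly_decreasing_measurable [measurable_dest]:
  "rapidly_decreasing w \<Longrightarrow> w \<in> borel_measurable borel"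
  by (simp add: rapidly_decreasing_def)

section \<open>Plane waves and differentiation of Fourier integrals\<close>

definition wave :: "real ^ 'n::finite \<Rightarrow> real ^ 'n \<Rightarrow> complex" where
  "wave \<xi> x = exp (- \<i> * of_real (x \<bullet> \<xi>))"

text \<open>The symbol of \<open>pder js\<close>: differentiating a wave along j brings down the
  factor - \<i> \<zeta>_j.\<close>

definition mon :: "'n list \<Rightarrow> real ^ 'n::finite \<Rightarrow> complex" where
  "mon js \<zeta> = (\<Prod>j\<leftarrow>js. - \<i> * of_real (\<zeta> $ j))"

lemma fourier_eq: "fourier w \<xi> = (LINT x|lborel. wave \<xi> x * w x)"
  by (simp add: fourier_def wave_def)

lemma norm_wave [simp]: "norm (wave \<xi> x) = 1"
  by (simp add: wave_def norm_exp_eq_Re)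

lemma wave_commute: "wave \<xi> x = wave x \<xi>"
  by (simp add: wave_def inner_commute)

lemma wave_add: "wave \<xi> (x + y) = wave \<xi> x * wave \<xi> y"
  by (simp add: wave_def inner_add_left algebra_simps exp_add[symmetric])

lemma wave_uminus: "wave \<xi> (- x) = wave (- \<xi>) x"
  by (simp add: wave_def)

lemma wave_0 [simp]: "wave 0 x = 1" "wave \<xi> 0 = 1"
  by (simp_all add: wave_def)

lemma wave_measurable [measurable]: "wave \<xi> \<in> borel_measurable borel"
  unfolding wave_def[abs_def] by measurable

lemma wave_measurable' [measurable]: "(\<lambda>\<xi>. wave \<xi> x) \<in> borel_measurable borel"
  unfolding wave_def[abs_def] by measurable

lemma mon_Nil [simp]: "mon [] \<zeta> = 1"
  by (simp add: mon_def)

lemma mon_Cons: "mon (j # js) \<zeta> = - \<i> * of_real (\<zeta> $ j) * mon js \<zeta>"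
  by (simp add: mon_def)

lemma norm_mon_le: "norm (mon js \<zeta>) \<le> (1 + norm \<zeta>) ^ length js"
proof (induction js)
  case (Cons j js)
  have "\<bar>\<zeta> $ j\<bar> \<le> 1 + norm \<zeta>" using component_le_norm_cart[of \<zeta> j] by linarith
  then show ?case using Cons by (auto simp: mon_Cons norm_mult intro!: mult_mono)
qed simp

lemma continuous_mon: "continuous_on S (mon js)"
  by (induction js) (auto simp: mon_Cons[abs_def] mon_def intro!: continuous_intros)

lemma mon_measurable [measurable]: "mon js \<in> borel_measurable borel"
  by (rule borel_measurable_continuous_onI) (rule continuous_mon)

lemma polynomially_bounded_mon: "polynomially_bounded (mon js)"
  unfolding polynomially_bounded_def
  using norm_mon_le[of js] by (auto intro!: exI[of _ 1] exI[of _ "length js"])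

lemma polynomially_bounded_bounded:
  "p \<in> borel_measurable borel \<Longrightarrow> (\<And>x. norm (p x) \<le> C) \<Longrightarrow> polynomially_bounded p"
  unfolding polynomially_bounded_def by (intro conjI exI[of _ C] exI[of _ 0]) auto

lemma wave_integrable_mult:
  assumes "integrable lborel w"
  shows "integrable lborel (\<lambda>x. wave \<xi> x * w x)"
  by (rule Bochner_Integration.integrable_bound[OF assms]) (use assms in \<open>auto simp: norm_mult\<close>)

text \<open>The first-order Taylor remainder of the exponential is quadratic, uniformly in x. It
  serves twice: to differentiate a wave and to differentiate under the integral sign.\<close>

lemma norm_wave_remainder: "norm (wave \<xi> (x + h) - wave \<xi> x + \<i> * of_real (h \<bullet> \<xi>) * wave \<xi> x) \<le> (norm h * norm \<xi>)\<^sup>2"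
proof -
  have "wave \<xi> (x + h) - wave \<xi> x + \<i> * of_real (h \<bullet> \<xi>) * wave \<xi> x
      = wave \<xi> x * (iexp (- (h \<bullet> \<xi>)) - (\<Sum>k\<le>1. (\<i> * complex_of_real (- (h \<bullet> \<xi>))) ^ k / fact k))"
    by (simp add: wave_add algebra_simps) (simp add: wave_def algebra_simps)
  then have "norm (wave \<xi> (x + h) - wave \<xi> x + \<i> * of_real (h \<bullet> \<xi>) * wave \<xi> x)
      = norm (iexp (- (h \<bullet> \<xi>)) - (\<Sum>k\<le>1. (\<i> * complex_of_real (- (h \<bullet> \<xi>))) ^ k / fact k))"
    by (simp add: norm_mult)
  also have "\<dots> \<le> \<bar>- (h \<bullet> \<xi>)\<bar> ^ Suc 1 / fact (Suc 1)" by (rule iexp_approx1)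
  also have "\<dots> \<le> (norm h * norm \<xi>)\<^sup>2"
  proof -
    have "\<bar>h \<bullet> \<xi>\<bar> ^ 2 \<le> (norm h * norm \<xi>) ^ 2"
      by (rule power_mono) (auto simp: Cauchy_Schwarz_ineq2)
    then have "\<bar>h \<bullet> \<xi>\<bar> ^ 2 / 2 \<le> (norm h * norm \<xi>) ^ 2"
      using zero_le_power2[of "norm h * norm \<xi>"] by linarith
    then show ?thesis by (simp add: numeral_2_eq_2)
  qed
  finally show ?thesis .
qed

lemma has_derivative_of_quadratic_remainder:
  fixes f :: "real ^ 'n::finite \<Rightarrow> complex"
  assumes "bounded_linear L" "\<And>h. norm (f (y + h) - f y - L h) \<le> C * (norm h)\<^sup>2"
  shows "(f has_derivative L) (at y)"
proof (rule has_derivativeI_sandwich[of 1])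
  show "norm (f z - f y - L (z - y)) / norm (z - y) \<le> C * norm (z - y)" if "z \<noteq> y" for z
    using assms(2)[of "z - y"] that by (simp add: divide_simps power2_eq_square mult_ac)
  show "((\<lambda>z. C * norm (z - y)) \<longlongrightarrow> 0) (at y)"
    by (auto intro!: tendsto_eq_intros)
qed (use assms in auto)

lemma inner_vec_eq: "h \<bullet> \<xi> = (\<Sum>j\<in>UNIV. h $ j * \<xi> $ j)"
  by (simp add: inner_vec_def)

lemma wave_has_derivative:
  "(wave \<xi> has_derivative (\<lambda>h. - \<i> * of_real (h \<bullet> \<xi>) * wave \<xi> x)) (at x)"
proof (rule has_derivative_of_quadratic_remainder)
  show "bounded_linear (\<lambda>h. - \<i> * of_real (h \<bullet> \<xi>) * wave \<xi> x)"
    by (intro linear_conv_bounded_linear[THEN iffD1] linearI)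
      (auto simp: algebra_simps inner_add_left scaleR_conv_of_real[where 'a = complex])
  show "norm (wave \<xi> (x + h) - wave \<xi> x - - \<i> * of_real (h \<bullet> \<xi>) * wave \<xi> x) \<le> (norm \<xi>)\<^sup>2 * (norm h)\<^sup>2" for h
    using norm_wave_remainder[of \<xi> x h] by (simp add: power_mult_distrib mult_ac)
qed

lemma partial_wave: "partial j (wave \<xi>) = (\<lambda>x. mon [j] \<xi> * wave \<xi> x)"
  by (rule ext, subst partial_eq[OF wave_has_derivative]) (simp add: mon_def inner_axis' )

lemma wave_differentiable: "wave \<xi> differentiable (at x)"
  using wave_has_derivative by (rule differentiableI)

lemma partial_cmult_wave: "partial j (\<lambda>x. c * wave \<xi> x) = (\<lambda>x. (c * mon [j] \<xi>) * wave \<xi> x)"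
proof (rule ext)
  fix x
  have "partial j (\<lambda>x. c * wave \<xi> x) x = partial j (\<lambda>_. c) x * wave \<xi> x + c * partial j (wave \<xi>) x"
    by (rule partial_mult_at) (auto intro: wave_differentiable)
  then show "partial j (\<lambda>x. c * wave \<xi> x) x = (c * mon [j] \<xi>) * wave \<xi> x"
    by (simp only: partial_const partial_wave mult_zero_left add_0_left mult.assoc)
qed

lemma smooth_wave: "smooth (wave (\<xi> :: real ^ 'n::finite))"
proof (rule smooth_coinduct[of "\<lambda>f. \<exists>c. f = (\<lambda>x. c * wave \<xi> x)"])
  show "\<exists>c. wave \<xi> = (\<lambda>x. c * wave \<xi> x)" by (intro exI[of _ 1]) simp
next
  fix f :: "real ^ 'n \<Rightarrow> complex" and x assume "\<exists>c. f = (\<lambda>x. c * wave \<xi> x)"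
  then obtain c where "f = (\<lambda>x. c * wave \<xi> x)" ..
  then show "f differentiable (at x)"
    using differentiable_mult[OF differentiable_const wave_differentiable] by simp
next
  fix f :: "real ^ 'n \<Rightarrow> complex" and i assume "\<exists>c. f = (\<lambda>x. c * wave \<xi> x)"
  then obtain c where f: "f = (\<lambda>x. c * wave \<xi> x)" ..
  show "\<exists>c. partial i f = (\<lambda>x. c * wave \<xi> x)"
    unfolding f partial_cmult_wave by (rule exI) (rule refl)
qed

lemma pder_wave: "pder js (wave \<xi>) = (\<lambda>x. mon js \<xi> * wave \<xi> x)"
proof (induction js)
  case (Cons j js)
  show ?case
    by (simp add: Cons partial_cmult_wave mon_Cons mult_ac)
qed simp

text \<open>The remainders of the waves integrate to at most |h|^2 times the second absolute moment
  of w, so differentiation under the integral is a direct estimate.\<close>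

lemma fourier_has_derivative:
  fixes w :: "real ^ 'n::finite \<Rightarrow> complex"
  assumes "rapidly_decreasing w"
  shows "(fourier w has_derivative
    (\<lambda>h. \<Sum>j\<in>UNIV. of_real (h $ j) * fourier (\<lambda>\<zeta>. mon [j] \<zeta> * w \<zeta>) y)) (at y)"
proof (rule has_derivative_of_quadratic_remainder)
  let ?L = "\<lambda>h. \<Sum>j\<in>UNIV. of_real (h $ j) * fourier (\<lambda>\<zeta>. mon [j] \<zeta> * w \<zeta>) y"
  have lin: "bounded_linear (\<lambda>h :: real ^ 'n. of_real (h $ j) * c)" for j and c :: complex
    by (intro linear_conv_bounded_linear[THEN iffD1] linearI)
      (auto simp: algebra_simps scaleR_conv_of_real[where 'a = complex])
  then show "bounded_linear ?L" by (intro bounded_linear_sum)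
  have meas: "w \<in> borel_measurable borel" using assms by (rule rapidly_decreasing_measurable)
  have iw: "integrable lborel w" using assms by (rule rapidly_decreasing_integrable)
  have im: "integrable lborel (\<lambda>\<zeta>. mon [j] \<zeta> * w \<zeta>)" for j
    by (intro rapidly_decreasing_integrable rapidly_decreasing_mult polynomially_bounded_mon assms)
  have i2: "integrable lborel (\<lambda>\<zeta>. of_real ((norm \<zeta>)\<^sup>2) * w \<zeta>)"
  proof (intro rapidly_decreasing_integrable rapidly_decreasing_mult assms)
    have "(norm \<zeta>)\<^sup>2 \<le> (1 + norm \<zeta>) ^ 2" for \<zeta> :: "real ^ 'n" by (rule power_mono) auto
    then show "polynomially_bounded (\<lambda>\<zeta> :: real ^ 'n. of_real ((norm \<zeta>)\<^sup>2))"
      unfolding polynomially_bounded_def by (intro conjI exI[of _ 1] exI[of _ 2]) (auto simp: norm_power)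
  qed
  fix h :: "real ^ 'n"
  have *: "fourier (\<lambda>\<zeta>. mon [j] \<zeta> * w \<zeta>) y = (LINT \<zeta>|lborel. wave \<zeta> y * (mon [j] \<zeta> * w \<zeta>))" for j
    unfolding fourier_eq by (subst wave_commute) simp
  have ig: "integrable lborel (\<lambda>\<zeta>. wave \<zeta> z * w \<zeta>)" for z
    using wave_integrable_mult[OF iw, of z] by (simp add: wave_commute)
  have ig2: "integrable lborel (\<lambda>\<zeta>. of_real (h $ j) * (wave \<zeta> y * (mon [j] \<zeta> * w \<zeta>)))" for j
    using wave_integrable_mult[OF im, of y j] by (auto simp: wave_commute)
  have "?L h = (LINT \<zeta>|lborel. (\<Sum>j\<in>UNIV. of_real (h $ j) * (wave \<zeta> y * (mon [j] \<zeta> * w \<zeta>))))"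
    unfolding * using ig2 by (subst Bochner_Integration.integral_sum) auto
  also have "\<dots> = (LINT \<zeta>|lborel. - \<i> * of_real (h \<bullet> \<zeta>) * wave \<zeta> y * w \<zeta>)"
    by (rule Bochner_Integration.integral_cong)
      (auto simp: inner_vec_eq mon_def sum_distrib_left sum_distrib_right mult_ac sum_negf)
  finally have L: "?L h = (LINT \<zeta>|lborel. - \<i> * of_real (h \<bullet> \<zeta>) * wave \<zeta> y * w \<zeta>)" .
  have igs: "integrable lborel (\<lambda>\<zeta>. - \<i> * of_real (h \<bullet> \<zeta>) * wave \<zeta> y * w \<zeta>)"
  proof -
    have "integrable lborel (\<lambda>\<zeta>. (\<Sum>j\<in>UNIV. of_real (h $ j) * (wave \<zeta> y * (mon [j] \<zeta> * w \<zeta>))))"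
      using ig2 by (intro Bochner_Integration.integrable_sum)
    then show ?thesis
      by (rule iffD1[OF Bochner_Integration.integrable_cong, rotated -1])
        (auto simp: inner_vec_eq mon_def sum_distrib_left sum_distrib_right mult_ac sum_negf)
  qed
  have "fourier w (y + h) - fourier w y - ?L h
      = (LINT \<zeta>|lborel. wave \<zeta> (y + h) * w \<zeta> - wave \<zeta> y * w \<zeta> - - \<i> * of_real (h \<bullet> \<zeta>) * wave \<zeta> y * w \<zeta>)"
    unfolding L unfolding fourier_eq wave_commute[of "y + h"] wave_commute[of y]
    by (simp only: Bochner_Integration.integral_diff Bochner_Integration.integrable_diff ig igs)
  also have "norm \<dots> \<le> (LINT \<zeta>|lborel. (norm h)\<^sup>2 * norm (of_real ((norm \<zeta>)\<^sup>2) * w \<zeta>))"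
  proof (rule Bochner_Integration.integral_norm_bound_integral)
    show "norm (wave \<zeta> (y + h) * w \<zeta> - wave \<zeta> y * w \<zeta> - - \<i> * of_real (h \<bullet> \<zeta>) * wave \<zeta> y * w \<zeta>)
        \<le> (norm h)\<^sup>2 * norm (of_real ((norm \<zeta>)\<^sup>2) * w \<zeta>)" for \<zeta>
    proof -
      have "wave \<zeta> (y + h) * w \<zeta> - wave \<zeta> y * w \<zeta> - - \<i> * of_real (h \<bullet> \<zeta>) * wave \<zeta> y * w \<zeta>
          = (wave \<zeta> (y + h) - wave \<zeta> y + \<i> * of_real (h \<bullet> \<zeta>) * wave \<zeta> y) * w \<zeta>"
        by (simp add: algebra_simps)
      then show ?thesis
        using mult_right_mono[OF norm_wave_remainder[of \<zeta> y h], of "norm (w \<zeta>)"]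
        by (simp add: norm_mult power_mult_distrib norm_power mult_ac)
    qed
  qed (use ig igs i2 in auto)
  finally show "norm (fourier w (y + h) - fourier w y - ?L h)
      \<le> (LINT \<zeta>|lborel. norm (of_real ((norm \<zeta>)\<^sup>2) * w \<zeta>)) * (norm h)\<^sup>2"
    by (simp add: mult.commute)
qed

lemma partial_fourier:
  assumes "rapidly_decreasing w"
  shows "partial j (fourier w) = fourier (\<lambda>\<zeta>. mon [j] \<zeta> * w \<zeta>)"
proof (rule ext)
  fix y
  have "partial j (fourier w) y =
      (\<Sum>i\<in>UNIV. if i = j then fourier (\<lambda>\<zeta>. mon [j] \<zeta> * w \<zeta>) y else 0)"
    unfolding partial_eq[OF fourier_has_derivative[OF assms]]
    by (rule sum.cong) (auto simp: axis_def)
  then show "partial j (fourier w) y = fourier (\<lambda>\<zeta>. mon [j] \<zeta> * w \<zeta>) y" by simp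
qed

lemma smooth_fourier:
  fixes w :: "real ^ 'n::finite \<Rightarrow> complex"
  assumes "rapidly_decreasing w" shows "smooth (fourier w)"
proof (rule smooth_coinduct[of "\<lambda>f. \<exists>w. rapidly_decreasing w \<and> f = fourier w"])
  show "\<exists>w'. rapidly_decreasing w' \<and> fourier w = fourier w'" using assms by blast
next
  fix f :: "real ^ 'n \<Rightarrow> complex" and x assume "\<exists>w. rapidly_decreasing w \<and> f = fourier w"
  then show "f differentiable (at x)" using differentiableI[OF fourier_has_derivative] by blast
next
  fix f :: "real ^ 'n \<Rightarrow> complex" and i assume "\<exists>w. rapidly_decreasing w \<and> f = fourier w"
  then show "\<exists>w. rapidly_decreasing w \<and> partial i f = fourier w"
    using partial_fourier rapidly_decreasing_mult[OF polynomially_bounded_mon] by blast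
qed

lemma pder_fourier:
  assumes "rapidly_decreasing w"
  shows "pder js (fourier w) = fourier (\<lambda>\<zeta>. mon js \<zeta> * w \<zeta>)"
proof (induction js)
  case (Cons j js)
  have "pder (j # js) (fourier w) = partial j (fourier (\<lambda>\<zeta>. mon js \<zeta> * w \<zeta>))"
    by (simp add: Cons)
  also have "\<dots> = fourier (\<lambda>\<zeta>. mon [j] \<zeta> * (mon js \<zeta> * w \<zeta>))"
    by (rule partial_fourier) (intro rapidly_decreasing_mult polynomially_bounded_mon assms)
  finally show ?case by (simp add: mon_Cons mult_ac)
qed simp

lemma nonneg_of_wt_bound: "norm z \<le> B * wt x \<Longrightarrow> 0 \<le> B"
  using mult_neg_pos[OF _ wt_pos[of x], of B] norm_ge_zero[of z] by linarith

section \<open>Integration by parts and decay of Fourier transforms\<close>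

lemma integral_shift:
  fixes g :: "real ^ 'n::finite \<Rightarrow> complex"
  assumes "g \<in> borel_measurable borel"
  shows "(LINT x|lborel. g (x + h)) = (LINT x|lborel. g x)"
proof -
  have "(LINT x|lborel. g x) = (LINT x|distr lborel borel ((+) h). g x)"
    by (simp add: lborel_distr_plus)
  also have "\<dots> = (LINT x|lborel. g (h + x))"
    using assms by (intro integral_distr) auto
  finally show ?thesis by (simp add: add.commute)
qed

lemma integrable_shift:
  fixes g :: "real ^ 'n::finite \<Rightarrow> complex"
  assumes "integrable lborel g"
  shows "integrable lborel (\<lambda>x. g (x + h))"
proof -
  have "integrable (distr lborel borel ((+) h)) g"
    using assms by (simp add: lborel_distr_plus)
  then have "integrable lborel (\<lambda>x. g (h + x))"
    by (subst (asm) integrable_distr_eq) (use assms in auto)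
  then show ?thesis by (simp add: add.commute)
qed

text \<open>The integral of a difference quotient vanishes by translation invariance.\<close>

lemma integral_partial_eq_0:
  fixes g :: "real ^ 'n::finite \<Rightarrow> complex"
  assumes g: "smooth g" "\<And>x. norm (g x) \<le> B * wt x" "\<And>x. norm (partial i g x) \<le> B * wt x"
  shows "(LINT x|lborel. partial i g x) = 0"
proof -
  let ?h = "\<lambda>n. (1 / real (Suc n)) *\<^sub>R (axis i 1 :: real ^ 'n)"
  let ?s = "\<lambda>n x. of_real (real (Suc n)) * (g (x + ?h n) - g x)"
  have m: "g \<in> borel_measurable borel" "partial i g \<in> borel_measurable borel"
    using g(1) by (auto intro!: smooth_measurable smooth_on_partial)
  have ig: "integrable lborel g" using m(1) g(2) by (rule integrable_of_wt_bound)
  have B: "0 \<le> B" by (rule nonneg_of_wt_bound[OF g(2)[of 0]])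
  have "(\<lambda>n. LINT x|lborel. ?s n x) \<longlonglongrightarrow> (LINT x|lborel. partial i g x)"
  proof (rule integral_dominated_convergence)
    show "integrable lborel (\<lambda>x :: real ^ 'n. B * 2 ^ (2 * CARD('n)) * wt x)" by simp
    show "AE x in lborel. (\<lambda>n. ?s n x) \<longlonglongrightarrow> partial i g x"
    proof (rule AE_I2)
      fix x
      let ?D = "frechet_derivative g (at x)"
      have D: "(g has_derivative ?D) (at x)" using g(1) by (rule smooth_has_derivative)
      then have "((\<lambda>h. norm (g (x + h) - g x - ?D h) / norm h) \<longlongrightarrow> 0) (at 0)"
        by (simp add: has_derivative_at)
      moreover have "filterlim ?h (at 0) sequentially"
      proof -
        have "?h \<longlonglongrightarrow> 0 *\<^sub>R (axis i 1 :: real ^ 'n)"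
          by (intro tendsto_scaleR tendsto_const) (rule LIMSEQ_Suc[OF lim_1_over_n])
        then show ?thesis by (auto simp: filterlim_at axis_eq_0_iff)
      qed
      ultimately have "(\<lambda>n. norm (g (x + ?h n) - g x - ?D (?h n)) / norm (?h n)) \<longlonglongrightarrow> 0"
        by (rule filterlim_compose)
      moreover have "norm (g (x + ?h n) - g x - ?D (?h n)) / norm (?h n) = norm (?s n x - partial i g x)" for n
      proof -
        have "?D (?h n) = (1 / real (Suc n)) *\<^sub>R partial i g x"
          using linear_scale[OF has_derivative_linear[OF D]] by (simp add: partial_def)
        then have "?s n x - partial i g x = of_real (real (Suc n)) * (g (x + ?h n) - g x - ?D (?h n))"
          by (simp add: scaleR_conv_of_real algebra_simps del: of_nat_Suc)
        then show ?thesis by (simp add: norm_mult norm_axis_1 mult.commute del: of_nat_Suc)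
      qed
      ultimately have "(\<lambda>n. norm (?s n x - partial i g x)) \<longlonglongrightarrow> 0" by simp
      then show "(\<lambda>n. ?s n x) \<longlonglongrightarrow> partial i g x"
        by (rule LIM_zero_cancel[OF tendsto_norm_zero_cancel])
    qed
    show "AE x in lborel. norm (?s n x) \<le> B * 2 ^ (2 * CARD('n)) * wt x" for n
    proof (rule AE_I2)
      fix x
      let ?f = "\<lambda>t. g (x + t *\<^sub>R axis i 1)"
      have d: "(?f has_derivative (\<lambda>s. s *\<^sub>R partial i g (x + t *\<^sub>R axis i 1))) (at t within {0..1})" for t
      proof -
        have D: "(g has_derivative frechet_derivative g (at (x + t *\<^sub>R axis i 1))) (at (x + t *\<^sub>R axis i 1))"
          using g(1) by (rule smooth_has_derivative)
        have "((\<lambda>t. x + t *\<^sub>R axis i 1) has_derivative (\<lambda>s. s *\<^sub>R axis i 1)) (at t within {0..1})"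
          by (auto intro!: derivative_eq_intros)
        from has_derivative_compose[OF this D] show ?thesis
          using linear_scale[OF has_derivative_linear[OF D]] by (simp add: partial_def)
      qed
      \<comment> \<open>Mean value inequality on a segment of length at most 1:
        \<open>wt_le_wt_shift\<close> moves the bounds at the intermediate points to a single one at
        x, uniform in n.\<close>
      have "norm (?f (1 / real (Suc n)) - ?f 0) \<le> B * 2 ^ (2 * CARD('n)) * wt x * norm (1 / real (Suc n) - 0)"
      proof (rule differentiable_bound[OF _ d])
        show "onorm (\<lambda>s. s *\<^sub>R partial i g (x + t *\<^sub>R axis i 1)) \<le> B * 2 ^ (2 * CARD('n)) * wt x"
          if "t \<in> {0..1}" for t
        proof (rule onorm_bound)
          have "wt (x + t *\<^sub>R axis i 1) \<le> 2 ^ (2 * CARD('n)) * wt x"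
            by (rule wt_le_wt_shift) (use that in \<open>simp add: norm_axis_1\<close>)
          then have "B * wt (x + t *\<^sub>R axis i 1) \<le> B * (2 ^ (2 * CARD('n)) * wt x)"
            using B by (rule mult_left_mono)
          from order_trans[OF g(3)[of "x + t *\<^sub>R axis i 1"] this]
          have n: "norm (partial i g (x + t *\<^sub>R axis i 1)) \<le> B * 2 ^ (2 * CARD('n)) * wt x"
            by (simp only: mult.assoc)
          show "norm (s *\<^sub>R partial i g (x + t *\<^sub>R axis i 1)) \<le> B * 2 ^ (2 * CARD('n)) * wt x * norm s" for s
            using mult_right_mono[OF n, of "norm s"] by (simp add: mult.commute)
        qed (use B in simp)
      qed (auto simp: divide_simps)
      then have "real (Suc n) * norm (g (x + ?h n) - g x) \<le> B * 2 ^ (2 * CARD('n)) * wt x"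
        by (simp add: divide_simps mult.commute del: of_nat_Suc)
      then show "norm (?s n x) \<le> B * 2 ^ (2 * CARD('n)) * wt x"
        by (simp add: norm_mult del: of_nat_Suc)
    qed
  qed (use m in auto)
  moreover have z: "(LINT x|lborel. ?s n x) = 0" for n
    using ig integrable_shift[OF ig] integral_shift[OF m(1)]
    by (simp add: Bochner_Integration.integral_diff del: of_nat_Suc)
  ultimately have "(\<lambda>n. 0) \<longlonglongrightarrow> (LINT x|lborel. partial i g x)" by (simp only: z)
  then show ?thesis by (simp add: LIMSEQ_const_iff)
qed

text \<open>Integration by parts: the derivative of wave times \<psi> has integral 0, and the
  product rule splits this integral into the two sides.\<close>

lemma fourier_partial_eq:
  fixes \<psi> :: "real ^ 'n::finite \<Rightarrow> complex"
  assumes "smooth \<psi>" "\<And>x. norm (\<psi> x) \<le> B * wt x" "\<And>x. norm (partial i \<psi> x) \<le> B' * wt x"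
  shows "fourier (partial i \<psi>) \<xi> = \<i> * of_real (\<xi> $ i) * fourier \<psi> \<xi>"
proof -
  let ?g = "\<lambda>x. wave \<xi> x * \<psi> x"
  have eq: "partial i ?g = (\<lambda>x. mon [i] \<xi> * (wave \<xi> x * \<psi> x) + wave \<xi> x * partial i \<psi> x)"
    by (simp only: partial_mult[OF smooth_wave assms(1)] partial_wave mult.assoc)
  have nm: "norm (mon [i] \<xi>) = \<bar>\<xi> $ i\<bar>" by (simp add: mon_def norm_mult)
  have B: "0 \<le> B" "0 \<le> B'"
    by (rule nonneg_of_wt_bound[OF assms(2)[of 0]], rule nonneg_of_wt_bound[OF assms(3)[of 0]])
  have i1: "integrable lborel (\<lambda>x. wave \<xi> x * \<psi> x)"
    by (intro wave_integrable_mult integrable_of_wt_bound[OF _ assms(2)] smooth_measurable assms(1))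
  have i2: "integrable lborel (\<lambda>x. wave \<xi> x * partial i \<psi> x)"
    by (intro wave_integrable_mult integrable_of_wt_bound[OF _ assms(3)] smooth_measurable smooth_on_partial assms(1))
  have "(LINT x|lborel. partial i ?g x) = 0"
  proof (rule integral_partial_eq_0)
    show "smooth ?g" by (intro smooth_mult smooth_wave assms(1))
    fix x
    have "norm (?g x) \<le> B * wt x" using assms(2)[of x] by (simp add: norm_mult)
    also have "\<dots> \<le> (B + (\<bar>\<xi> $ i\<bar> * B + B')) * wt x" using B by (intro mult_right_mono) auto
    finally show "norm (?g x) \<le> (B + (\<bar>\<xi> $ i\<bar> * B + B')) * wt x" .
    have "norm (partial i ?g x) \<le> \<bar>\<xi> $ i\<bar> * norm (\<psi> x) + norm (partial i \<psi> x)"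
      unfolding eq by (rule norm_triangle_le) (simp add: norm_mult nm)
    also have "\<dots> \<le> \<bar>\<xi> $ i\<bar> * (B * wt x) + B' * wt x"
      by (intro add_mono mult_left_mono assms) auto
    also have "\<dots> \<le> (B + (\<bar>\<xi> $ i\<bar> * B + B')) * wt x" using B by (simp add: algebra_simps)
    finally show "norm (partial i ?g x) \<le> (B + (\<bar>\<xi> $ i\<bar> * B + B')) * wt x" .
  qed
  then have "mon [i] \<xi> * fourier \<psi> \<xi> + fourier (partial i \<psi>) \<xi> = 0"
    unfolding eq fourier_eq using i1 i2 by simp
  then show ?thesis by (simp add: mon_def eq_neg_iff_add_eq_0 add.commute)
qed

text \<open>Only pure derivatives are used, so that no statement about the symmetry of mixed
  derivatives is required.\<close>

definition decreasing :: "(real ^ 'n::finite \<Rightarrow> complex) \<Rightarrow> bool" where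
  "decreasing \<psi> \<longleftrightarrow> smooth \<psi> \<and>
     (\<forall>i m k. \<exists>C. \<forall>x. norm (pder (replicate m i) \<psi> x) * (1 + norm x) ^ k \<le> C)"

lemma decreasing_smooth: "decreasing \<psi> \<Longrightarrow> smooth \<psi>"
  by (simp add: decreasing_def)

lemma decreasing_wt_bound:
  assumes "decreasing \<psi>"
  shows "\<exists>B. \<forall>x. norm (pder (replicate m i) \<psi> x) \<le> B * wt x"
  using assms wt_bound_of_power_bound unfolding decreasing_def by metis

lemma decreasing_wt_bound_0:
  assumes "decreasing \<psi>"
  shows "\<exists>B. \<forall>x. norm (\<psi> x) \<le> B * wt x"
  using decreasing_wt_bound[OF assms, of 0] by simp

lemma decreasing_integrable: "decreasing \<psi> \<Longrightarrow> integrable lborel \<psi>"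
  using decreasing_wt_bound_0 integrable_of_wt_bound smooth_measurable decreasing_smooth by metis

lemma fourier_pure_pder:
  assumes "decreasing \<psi>"
  shows "fourier (pder (replicate m i) \<psi>) \<xi> = (\<i> * of_real (\<xi> $ i)) ^ m * fourier \<psi> \<xi>"
proof (induction m)
  case (Suc m)
  obtain B B' where "\<forall>x. norm (pder (replicate m i) \<psi> x) \<le> B * wt x"
    "\<forall>x. norm (pder (replicate (Suc m) i) \<psi> x) \<le> B' * wt x"
    using decreasing_wt_bound[OF assms] by metis
  then have "fourier (partial i (pder (replicate m i) \<psi>)) \<xi>
      = \<i> * of_real (\<xi> $ i) * fourier (pder (replicate m i) \<psi>) \<xi>"
    by (intro fourier_partial_eq[of _ B _ B'] smooth_on_pder decreasing_smooth[OF assms]) auto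
  then show ?case using Suc by simp
qed simp

lemma norm_fourier_le:
  fixes \<psi> :: "real ^ 'n::finite \<Rightarrow> complex"
  assumes "\<And>x. norm (\<psi> x) \<le> B * wt x"
  shows "norm (fourier \<psi> \<xi>) \<le> B * (LINT x|lborel. wt (x :: real ^ 'n))"
  unfolding fourier_eq by (rule norm_integral_wt_bound) (use assms in \<open>simp add: norm_mult\<close>)

text \<open>Some coordinate is at least norm \<xi> divided by the dimension, so powers of that
  coordinate control powers of the norm; the maximum with 1 covers small \<xi>. This is why pure
  derivatives yield decay in all directions.\<close>

lemma one_plus_norm_power_le:
  fixes \<xi> :: "real ^ 'n::finite"
  shows "\<exists>i. (1 + norm \<xi>) ^ k \<le> (2 * real CARD('n) * max 1 \<bar>\<xi> $ i\<bar>) ^ k"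
proof -
  let ?d = "real CARD('n)"
  have d: "1 \<le> ?d" by (simp add: Suc_le_eq)
  have "\<exists>i. norm \<xi> \<le> ?d * \<bar>\<xi> $ i\<bar>"
  proof (rule ccontr)
    assume "\<not> ?thesis"
    then have "\<bar>\<xi> $ i\<bar> < norm \<xi> / ?d" for i using d by (auto simp: divide_simps mult.commute not_le)
    then have "(\<Sum>i\<in>UNIV. \<bar>\<xi> $ i\<bar>) < (\<Sum>i\<in>(UNIV :: 'n set). norm \<xi> / ?d)"
      by (intro sum_strict_mono) auto
    then show False using norm_le_l1_cart[of \<xi>] by simp
  qed
  then obtain i where i: "norm \<xi> \<le> ?d * \<bar>\<xi> $ i\<bar>" ..
  let ?m = "max 1 \<bar>\<xi> $ i\<bar>"
  have "?d * \<bar>\<xi> $ i\<bar> \<le> ?d * ?m" "1 * 1 \<le> ?d * ?m"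
    using d by (intro mult_left_mono mult_mono; simp)+
  then have "1 + norm \<xi> \<le> 2 * ?d * ?m" using i by linarith
  then have "(1 + norm \<xi>) ^ k \<le> (2 * ?d * ?m) ^ k" by (intro power_mono) auto
  then show ?thesis ..
qed

text \<open>For the coordinate that controls \<xi>, either the k-th pure derivative gives the decay
  or, if the coordinate is at most 1, the bound on \<psi> itself. The constant is explicit in k,
  because k later grows with the index of the cut-offs.\<close>

lemma fourier_decay:
  fixes \<psi> :: "real ^ 'n::finite \<Rightarrow> complex"
  assumes "decreasing \<psi>" "\<And>x. norm (\<psi> x) \<le> B * wt x"
    and "\<And>i x. norm (pder (replicate k i) \<psi> x) \<le> B * wt x"
  shows "norm (fourier \<psi> \<xi>) * (1 + norm \<xi>) ^ k
    \<le> (2 * real CARD('n)) ^ k * (B * (LINT x|lborel. wt (x :: real ^ 'n)))"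
proof -
  let ?d = "real CARD('n)" and ?I = "B * (LINT x|lborel. wt (x :: real ^ 'n))"
  obtain i where i: "(1 + norm \<xi>) ^ k \<le> (2 * ?d * max 1 \<bar>\<xi> $ i\<bar>) ^ k"
    using one_plus_norm_power_le by blast
  have 1: "norm (fourier \<psi> \<xi>) \<le> ?I" using assms(2) by (rule norm_fourier_le)
  have "norm (fourier (pder (replicate k i) \<psi>) \<xi>) \<le> ?I" using assms(3) by (rule norm_fourier_le)
  then have 2: "\<bar>\<xi> $ i\<bar> ^ k * norm (fourier \<psi> \<xi>) \<le> ?I"
    unfolding fourier_pure_pder[OF assms(1)] by (simp add: norm_mult norm_power)
  let ?m = "max 1 \<bar>\<xi> $ i\<bar>"
  from i have "norm (fourier \<psi> \<xi>) * (1 + norm \<xi>) ^ k \<le> norm (fourier \<psi> \<xi>) * (2 * ?d * ?m) ^ k"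
    by (rule mult_left_mono) simp
  also have "\<dots> = (2 * ?d) ^ k * (?m ^ k * norm (fourier \<psi> \<xi>))"
    by (simp add: power_mult_distrib mult_ac)
  also have "\<dots> \<le> (2 * ?d) ^ k * ?I"
  proof (rule mult_left_mono)
    show "?m ^ k * norm (fourier \<psi> \<xi>) \<le> ?I"
      using 1 2 by (cases "\<bar>\<xi> $ i\<bar> \<le> 1") (auto simp: max_def)
  qed simp
  finally show ?thesis .
qed

lemma fourier_measurable:
  fixes w :: "real ^ 'n::finite \<Rightarrow> complex"
  assumes [measurable]: "w \<in> borel_measurable borel"
  shows "fourier w \<in> borel_measurable borel"
  unfolding fourier_def[abs_def] by measurable

lemma rapidly_decreasing_fourier:
  fixes \<psi> :: "real ^ 'n::finite \<Rightarrow> complex"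
  assumes "decreasing \<psi>"
  shows "rapidly_decreasing (fourier \<psi>)"
  unfolding rapidly_decreasing_def
proof (intro conjI allI)
  show "fourier \<psi> \<in> borel_measurable borel"
    by (intro fourier_measurable smooth_measurable decreasing_smooth assms)
  fix k
  obtain B0 where B0: "\<forall>x. norm (\<psi> x) \<le> B0 * wt x" using decreasing_wt_bound_0[OF assms] ..
  have "\<forall>i. \<exists>B. \<forall>x. norm (pder (replicate k i) \<psi> x) \<le> B * wt x"
    using decreasing_wt_bound[OF assms] by blast
  then obtain B where B: "\<And>i x. norm (pder (replicate k i) \<psi> x) \<le> B i * wt x" by metis
  define M where "M = \<bar>B0\<bar> + (\<Sum>i\<in>UNIV. \<bar>B i\<bar>)"
  have "B i \<le> M" for i
    using member_le_sum[of i UNIV "\<lambda>i. \<bar>B i\<bar>"] unfolding M_def by force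
  then have 1: "norm (pder (replicate k i) \<psi> x) \<le> M * wt x" for i x
    using B order_trans mult_right_mono[OF _ wt_nonneg] by metis
  have "0 \<le> (\<Sum>i\<in>UNIV. \<bar>B i\<bar>)" by (rule sum_nonneg) simp
  then have "B0 \<le> M" unfolding M_def by linarith
  then have 2: "norm (\<psi> x) \<le> M * wt x" for x
    using B0 order_trans mult_right_mono[OF _ wt_nonneg] by metis
  show "\<exists>C. \<forall>\<zeta>. norm (fourier \<psi> \<zeta>) * (1 + norm \<zeta>) ^ k \<le> C"
    using fourier_decay[OF assms 2 1] by blast
qed

text \<open>Fubini for product densities with a bounded kernel; the kernels in use are products of
  plane waves.\<close>

lemma integral_swap_kernel:
  fixes u v :: "real ^ 'n::finite \<Rightarrow> complex" and k :: "real ^ 'n \<Rightarrow> real ^ 'n \<Rightarrow> complex"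
  assumes "integrable lborel u" "integrable lborel v"
    and k [measurable]: "(\<lambda>(x, y). k x y) \<in> borel_measurable (borel \<Otimes>\<^sub>M borel)"
    and "\<And>x y. norm (k x y) \<le> 1"
  shows "(LINT x|lborel. LINT y|lborel. u x * v y * k x y) = (LINT y|lborel. LINT x|lborel. u x * v y * k x y)"
proof (rule lborel_pair.Fubini_integral[symmetric])
  have [measurable]: "u \<in> borel_measurable borel" "v \<in> borel_measurable borel"
    using assms(1,2) by (auto dest: borel_measurable_integrable)
  have k1: "(\<lambda>y. k x y) \<in> borel_measurable borel" for x
    using measurable_compose[OF measurable_Pair1' k] by (auto simp: comp_def)
  have ky: "integrable lborel (\<lambda>y. u x * v y * k x y)" for x
  proof (rule Bochner_Integration.integrable_bound)
    show "integrable lborel (\<lambda>y. u x * v y)" using assms(2) by simp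
    show "AE y in lborel. norm (u x * v y * k x y) \<le> norm (u x * v y)"
      using assms(4) by (intro AE_I2) (simp add: norm_mult mult_left_le)
  qed (use k1 in measurable)
  show "integrable (lborel \<Otimes>\<^sub>M lborel) (\<lambda>(x, y). u x * v y * k x y)"
  proof (rule lborel_pair.Fubini_integrable)
    show "(\<lambda>(x, y). u x * v y * k x y) \<in> borel_measurable (lborel \<Otimes>\<^sub>M lborel)" by measurable
    show "integrable lborel (\<lambda>x. LINT y|lborel. norm (case (x, y) of (x, y) \<Rightarrow> u x * v y * k x y))"
    proof (rule Bochner_Integration.integrable_bound)
      show "integrable lborel (\<lambda>x. (LINT y|lborel. norm (v y)) * norm (u x))" using assms(1) by simp
      show "AE x in lborel. norm (LINT y|lborel. norm (case (x, y) of (x, y) \<Rightarrow> u x * v y * k x y))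
          \<le> norm ((LINT y|lborel. norm (v y)) * norm (u x))"
      proof (rule AE_I2)
        fix x
        have "(LINT y|lborel. norm (u x * v y * k x y)) \<le> (LINT y|lborel. norm (u x) * norm (v y))"
          using integrable_norm[OF ky[of x]] assms(2,4)
          by (intro Bochner_Integration.integral_mono) (auto simp: norm_mult mult_left_le)
        then show "norm (LINT y|lborel. norm (case (x, y) of (x, y) \<Rightarrow> u x * v y * k x y))
          \<le> norm ((LINT y|lborel. norm (v y)) * norm (u x))"
          by (simp add: mult.commute)
      qed
    qed measurable
    show "AE x in lborel. integrable lborel (\<lambda>y. case (x, y) of (x, y) \<Rightarrow> u x * v y * k x y)"
      using ky by simp
  qed
qed

lemma wave_pair_measurable [measurable]:
  "f \<in> borel_measurable M \<Longrightarrow> g \<in> borel_measurable M \<Longrightarrow> (\<lambda>z. wave (f z) (g z)) \<in> borel_measurable M"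
  unfolding wave_def by measurable

text \<open>A convolution theorem that does not rest on inversion: \<open>fourier w\<close> is a
  superposition of waves, and each of them shifts the transform of \<kappa>. The argument is \<xi> +
  \<zeta> because both transforms carry the same sign.\<close>

lemma fourier_mult_fourier:
  fixes \<kappa> w :: "real ^ 'n::finite \<Rightarrow> complex"
  assumes "integrable lborel \<kappa>" "integrable lborel w"
  shows "fourier (\<lambda>x. \<kappa> x * fourier w x) \<xi> = (LINT \<zeta>|lborel. w \<zeta> * fourier \<kappa> (\<xi> + \<zeta>))"
proof -
  let ?k = "\<lambda>x \<zeta>. wave (\<xi> + \<zeta>) x"
  have k: "wave \<xi> x * wave x \<zeta> = ?k x \<zeta>" for x \<zeta>
    by (metis wave_add wave_commute)
  have "fourier (\<lambda>x. \<kappa> x * fourier w x) \<xi> = (LINT x|lborel. LINT \<zeta>|lborel. \<kappa> x * w \<zeta> * ?k x \<zeta>)"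
    unfolding fourier_eq k[symmetric]
    by (simp only: integral_mult_right_zero[symmetric] mult_ac)
  also have "\<dots> = (LINT \<zeta>|lborel. LINT x|lborel. \<kappa> x * w \<zeta> * ?k x \<zeta>)"
    by (rule integral_swap_kernel) (use assms in auto)
  also have "\<dots> = (LINT \<zeta>|lborel. w \<zeta> * fourier \<kappa> (\<xi> + \<zeta>))"
    unfolding fourier_eq by (simp only: integral_mult_right_zero[symmetric] mult_ac)
  finally show ?thesis .
qed


section \<open>Fourier inversion\<close>

lemma integral_affine:
  fixes g :: "real ^ 'n::finite \<Rightarrow> complex"
  assumes g [measurable]: "g \<in> borel_measurable borel" and a: "a \<noteq> 0"
  shows "(LINT x|lborel. g x) = of_real (\<bar>a\<bar> ^ CARD('n)) * (LINT x|lborel. g (t + a *\<^sub>R x))"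
proof -
  have "(LINT x|lborel. g x)
      = (LINT x|density (distr lborel borel (\<lambda>x. t + a *\<^sub>R x)) (\<lambda>_. ennreal (\<bar>a\<bar> ^ CARD('n))). g x)"
    using lborel_affine[OF a, of t] by (simp add: ennreal_power)
  also have "\<dots> = (LINT x|distr lborel borel (\<lambda>x. t + a *\<^sub>R x). \<bar>a\<bar> ^ CARD('n) *\<^sub>R g x)"
    by (rule integral_density) auto
  also have "\<dots> = (LINT x|lborel. \<bar>a\<bar> ^ CARD('n) *\<^sub>R g (t + a *\<^sub>R x))"
    by (rule integral_distr) auto
  finally show ?thesis by (simp add: scaleR_conv_of_real[where 'a = complex])
qed

lemma integrable_affine:
  fixes g :: "real ^ 'n::finite \<Rightarrow> complex"
  assumes "integrable lborel g" and a: "a \<noteq> 0"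
  shows "integrable lborel (\<lambda>x. g (t + a *\<^sub>R x))"
proof -
  have [measurable]: "g \<in> borel_measurable borel" using assms(1) by (auto dest: borel_measurable_integrable)
  have "integrable (density (distr lborel borel (\<lambda>x. t + a *\<^sub>R x)) (\<lambda>_. ennreal (\<bar>a\<bar> ^ CARD('n)))) g"
    using lborel_affine[OF a, of t] assms(1) by (simp add: ennreal_power)
  then have "integrable (distr lborel borel (\<lambda>x. t + a *\<^sub>R x)) (\<lambda>x. \<bar>a\<bar> ^ CARD('n) *\<^sub>R g x)"
    by (subst (asm) integrable_density) auto
  then have "integrable lborel (\<lambda>x. \<bar>a\<bar> ^ CARD('n) *\<^sub>R g (t + a *\<^sub>R x))"
    by (subst (asm) integrable_distr_eq) auto
  from integrable_scaleR_right[OF this, of "inverse (\<bar>a\<bar> ^ CARD('n))"]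
  show ?thesis using a by simp
qed

definition gauss :: "real ^ 'n::finite \<Rightarrow> complex" where
  "gauss x = of_real (exp (- (norm x)\<^sup>2 / 2))"

lemma gauss_measurable [measurable]: "gauss \<in> borel_measurable borel"
  unfolding gauss_def[abs_def] by measurable

lemma norm_gauss_le: "norm (gauss x) \<le> 1"
  by (simp add: gauss_def)

lemma product_lborel:
  fixes h :: "real ^ 'n::finite \<Rightarrow> real \<Rightarrow> complex"
  assumes h: "\<And>b. b \<in> Basis \<Longrightarrow> integrable lborel (h b)"
  shows "integrable lborel (\<lambda>x. \<Prod>b\<in>Basis. h b (x \<bullet> b))"
    and "(LINT x|lborel. (\<Prod>b\<in>Basis. h b (x \<bullet> b))) = (\<Prod>b\<in>Basis. integral\<^sup>L lborel (h b))"
proof -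
  interpret product_sigma_finite "\<lambda>_ :: real ^ 'n. lborel :: real measure"
    by standard
  have m [measurable]: "\<And>b. b \<in> Basis \<Longrightarrow> h b \<in> borel_measurable borel"
    using h by (auto dest: borel_measurable_integrable)
  have eq: "(\<Prod>b\<in>Basis. h b ((\<Sum>c\<in>Basis. f c *\<^sub>R c) \<bullet> b)) = (\<Prod>b\<in>Basis. h b (f b))" for f
    by (rule prod.cong) auto
  have mp: "(\<lambda>x :: real ^ 'n. \<Prod>b\<in>Basis. h b (x \<bullet> b)) \<in> borel_measurable borel"
    by (intro borel_measurable_prod measurable_compose[OF _ m]) auto
  show "integrable lborel (\<lambda>x. \<Prod>b\<in>Basis. h b (x \<bullet> b))"
    by (subst lborel_eq, subst integrable_distr_eq)
      (use mp product_integrable_prod[of Basis h] h in \<open>simp_all add: eq\<close>)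
  show "(LINT x|lborel. (\<Prod>b\<in>Basis. h b (x \<bullet> b))) = (\<Prod>b\<in>Basis. integral\<^sup>L lborel (h b))"
    by (subst lborel_eq, subst integral_distr)
      (use mp product_integral_prod[of Basis h] h in \<open>simp_all add: eq\<close>)
qed

text \<open>Up to normalisation this is the characteristic function of the standard normal
  distribution.\<close>

lemma gauss_1d:
  "integrable lborel (\<lambda>t. iexp (- s * t) * of_real (exp (- t\<^sup>2 / 2)))"
  "(LINT t|lborel. iexp (- s * t) * of_real (exp (- t\<^sup>2 / 2))) = of_real (sqrt (2 * pi)) * of_real (exp (- s\<^sup>2 / 2))"
proof -
  have eq: "iexp (- s * t) * of_real (exp (- t\<^sup>2 / 2)) =
      of_real (sqrt (2 * pi)) * (std_normal_density t *\<^sub>R iexp (- s * t))" for t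
    by (simp add: std_normal_density_def scaleR_conv_of_real)
  have "integrable lborel (\<lambda>t. std_normal_density t *\<^sub>R iexp (- s * t))"
    by (rule Bochner_Integration.integrable_bound[of _ std_normal_density])
      (use integrable_std_normal_moment[of 0] in auto)
  then show "integrable lborel (\<lambda>t. iexp (- s * t) * of_real (exp (- t\<^sup>2 / 2)))"
    unfolding eq by (rule integrable_mult_right)
  have "(LINT t|lborel. std_normal_density t *\<^sub>R iexp (- s * t)) = char std_normal_distribution (- s)"
    unfolding char_def by (subst integral_density) (auto simp: normal_density_nonneg)
  also have "\<dots> = of_real (exp (- s\<^sup>2 / 2))" by (simp add: char_std_normal_distribution)
  finally show "(LINT t|lborel. iexp (- s * t) * of_real (exp (- t\<^sup>2 / 2))) = of_real (sqrt (2 * pi)) * of_real (exp (- s\<^sup>2 / 2))"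
    unfolding eq integral_mult_right_zero by simp
qed

lemma gauss_eq_prod: "gauss x = (\<Prod>b\<in>Basis. of_real (exp (- (x \<bullet> b)\<^sup>2 / 2)))"
proof -
  have "- (norm x)\<^sup>2 / 2 = (\<Sum>b\<in>Basis. - (x \<bullet> b)\<^sup>2 / 2)"
    by (subst power2_norm_eq_inner, subst euclidean_inner)
      (simp add: power2_eq_square sum_negf sum_divide_distrib)
  then show ?thesis unfolding gauss_def by (simp add: exp_sum flip: of_real_prod)
qed

lemma wave_mult_gauss_eq_prod:
  "wave \<xi> x * gauss x = (\<Prod>b\<in>Basis. iexp (- (\<xi> \<bullet> b) * (x \<bullet> b)) * of_real (exp (- (x \<bullet> b)\<^sup>2 / 2)))"
proof -
  have "- \<i> * of_real (x \<bullet> \<xi>) = (\<Sum>b\<in>Basis. \<i> * of_real (- (\<xi> \<bullet> b) * (x \<bullet> b)))"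
    by (subst euclidean_inner) (simp add: sum_distrib_left sum_negf mult_ac)
  then have "wave \<xi> x = (\<Prod>b\<in>Basis. iexp (- (\<xi> \<bullet> b) * (x \<bullet> b)))"
    unfolding wave_def by (simp add: exp_sum)
  then show ?thesis by (simp add: gauss_eq_prod prod.distrib)
qed

text \<open>Equals (2 pi)^(d/2), so that its square is the constant of Fourier inversion; the type
  argument carries the dimension d.\<close>

definition fourier_const :: "'n::finite itself \<Rightarrow> complex" where
  "fourier_const _ = of_real (sqrt (2 * pi)) ^ CARD('n)"

lemma fourier_const_nonzero: "fourier_const x \<noteq> 0"
  by (simp add: fourier_const_def)

lemma wave_gauss_integrable: "integrable lborel (\<lambda>x. wave \<xi> x * gauss x)"
  unfolding wave_mult_gauss_eq_prod by (rule product_lborel) (rule gauss_1d)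

lemma gauss_integrable: "integrable lborel gauss"
  using wave_gauss_integrable[of 0] by simp

lemma fourier_gauss: "fourier (gauss :: real ^ 'n::finite \<Rightarrow> complex) \<xi> = fourier_const TYPE('n) * gauss \<xi>"
proof -
  have "fourier gauss \<xi> = (\<Prod>b\<in>Basis. of_real (sqrt (2 * pi)) * of_real (exp (- (\<xi> \<bullet> b)\<^sup>2 / 2)))"
    unfolding fourier_eq wave_mult_gauss_eq_prod
    by (subst product_lborel(2)) (use gauss_1d in auto)
  then show ?thesis by (simp add: prod.distrib gauss_eq_prod fourier_const_def)
qed

lemma fourier_gauss_scaled:
  fixes u :: "real ^ 'n::finite"
  assumes "0 < \<delta>"
  shows "of_real (\<delta> ^ CARD('n)) * fourier (\<lambda>\<eta>. gauss (\<delta> *\<^sub>R \<eta>)) u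
    = fourier_const TYPE('n) * gauss (u /\<^sub>R \<delta>)"
proof -
  have w: "wave (u /\<^sub>R \<delta>) (\<delta> *\<^sub>R x) = wave u x" for x
  proof -
    have "(\<delta> *\<^sub>R x) \<bullet> (u /\<^sub>R \<delta>) = x \<bullet> u" using assms by simp
    then show ?thesis by (simp only: wave_def)
  qed
  have "fourier gauss (u /\<^sub>R \<delta>) = of_real (\<bar>\<delta>\<bar> ^ CARD('n)) *
      (LINT x|lborel. wave (u /\<^sub>R \<delta>) (0 + \<delta> *\<^sub>R x) * gauss (0 + \<delta> *\<^sub>R x))"
    unfolding fourier_eq by (rule integral_affine) (use assms in auto)
  then show ?thesis unfolding fourier_gauss using assms by (simp add: w fourier_eq)
qed

text \<open>Gaussian summation: the inversion integral is damped by a wide Gaussian, and Fubini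
  turns it into an average of \<psi> against a narrow Gaussian around y. Both forms have a limit by
  dominated convergence.\<close>

theorem fourier_inversion:
  fixes \<psi> :: "real ^ 'n::finite \<Rightarrow> complex"
  assumes cont: "continuous_on UNIV \<psi>" and int: "integrable lborel \<psi>" "integrable lborel (fourier \<psi>)"
    and bd: "\<And>x. norm (\<psi> x) \<le> B"
  shows "fourier (fourier \<psi>) (- y) = (fourier_const TYPE('n))\<^sup>2 * \<psi> y"
proof -
  let ?\<delta> = "\<lambda>n. 1 / real (Suc n)"
  let ?C = "fourier_const TYPE('n)"
  have [measurable]: "\<psi> \<in> borel_measurable borel" using cont by (rule borel_measurable_continuous_onI)
  have [measurable]: "fourier \<psi> \<in> borel_measurable borel" by (rule fourier_measurable) measurable
  have \<delta>: "?\<delta> \<longlonglongrightarrow> 0" by (rule LIMSEQ_Suc[OF lim_1_over_n])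
  have gc: "isCont (gauss :: real ^ 'n \<Rightarrow> complex) x" for x
    unfolding gauss_def[abs_def] by (intro continuous_intros) auto
  \<comment> \<open>A Gaussian of width 1 / ?\<delta> n makes the double integral absolutely
    convergent.\<close>
  define A where "A n = (LINT \<eta>|lborel. wave (- y) \<eta> * fourier \<psi> \<eta> * gauss (?\<delta> n *\<^sub>R \<eta>))" for n
  have "A \<longlonglongrightarrow> (LINT \<eta>|lborel. wave (- y) \<eta> * fourier \<psi> \<eta>)"
    unfolding A_def
  proof (rule integral_dominated_convergence)
    show "integrable lborel (\<lambda>\<eta>. norm (fourier \<psi> \<eta>))" using int(2) by simp
    show "AE \<eta> in lborel. (\<lambda>n. wave (- y) \<eta> * fourier \<psi> \<eta> * gauss (?\<delta> n *\<^sub>R \<eta>)) \<longlonglongrightarrow> wave (- y) \<eta> * fourier \<psi> \<eta>"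
    proof (rule AE_I2)
      fix \<eta> :: "real ^ 'n"
      have "(\<lambda>n. ?\<delta> n *\<^sub>R \<eta>) \<longlonglongrightarrow> 0" using tendsto_scaleR[OF \<delta> tendsto_const[of \<eta>]] by simp
      then have "(\<lambda>n. gauss (?\<delta> n *\<^sub>R \<eta>)) \<longlonglongrightarrow> gauss (0 :: real ^ 'n)"
        by (rule isCont_tendsto_compose[OF gc])
      then have "(\<lambda>n. wave (- y) \<eta> * fourier \<psi> \<eta> * gauss (?\<delta> n *\<^sub>R \<eta>))
          \<longlonglongrightarrow> wave (- y) \<eta> * fourier \<psi> \<eta> * gauss (0 :: real ^ 'n)"
        by (intro tendsto_mult tendsto_const)
      then show "(\<lambda>n. wave (- y) \<eta> * fourier \<psi> \<eta> * gauss (?\<delta> n *\<^sub>R \<eta>)) \<longlonglongrightarrow> wave (- y) \<eta> * fourier \<psi> \<eta>"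
        by (simp add: gauss_def)
    qed
    show "AE \<eta> in lborel. norm (wave (- y) \<eta> * fourier \<psi> \<eta> * gauss (?\<delta> n *\<^sub>R \<eta>)) \<le> norm (fourier \<psi> \<eta>)" for n
      by (rule AE_I2) (simp add: norm_mult mult_left_le norm_gauss_le)
  qed measurable
  then have lim1: "A \<longlonglongrightarrow> fourier (fourier \<psi>) (- y)" by (simp add: fourier_eq[of "fourier \<psi>"])
  have A: "A n = ?C * (LINT z|lborel. \<psi> (y + ?\<delta> n *\<^sub>R z) * gauss z)" for n
  proof -
    have \<delta>0: "0 < ?\<delta> n" by simp
    let ?k = "\<lambda>\<eta> x. wave (- y) \<eta> * wave \<eta> x"
    have k: "?k \<eta> x = wave (x - y) \<eta>" for \<eta> x
      unfolding wave_commute[of "- y" \<eta>] wave_commute[of "x - y" \<eta>]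
      using wave_add[of \<eta> x "- y"] by (simp add: mult.commute)
    have "A n = (LINT \<eta>|lborel. LINT x|lborel. gauss (?\<delta> n *\<^sub>R \<eta>) * \<psi> x * ?k \<eta> x)"
      unfolding A_def fourier_eq by (simp only: integral_mult_right_zero[symmetric] mult_ac)
    also have "\<dots> = (LINT x|lborel. LINT \<eta>|lborel. gauss (?\<delta> n *\<^sub>R \<eta>) * \<psi> x * ?k \<eta> x)"
    proof (rule integral_swap_kernel)
      show "integrable lborel (\<lambda>\<eta> :: real ^ 'n. gauss (?\<delta> n *\<^sub>R \<eta>))"
        using integrable_affine[OF gauss_integrable, of "?\<delta> n" 0] by simp
    qed (use int in \<open>auto simp: norm_mult\<close>)
    also have "\<dots> = (LINT x|lborel. \<psi> x * fourier (\<lambda>\<eta>. gauss (?\<delta> n *\<^sub>R \<eta>)) (x - y))"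
      unfolding fourier_eq k by (simp only: integral_mult_right_zero[symmetric] mult_ac)
    \<comment> \<open>Substituting x = y + ?\<delta> n z undoes the concentration of the Gaussian,
      so that the limit only concerns the argument of \<psi>.\<close>
    also have "\<dots> = of_real (\<bar>?\<delta> n\<bar> ^ CARD('n)) *
        (LINT z|lborel. \<psi> (y + ?\<delta> n *\<^sub>R z) * fourier (\<lambda>\<eta>. gauss (?\<delta> n *\<^sub>R \<eta>)) (y + ?\<delta> n *\<^sub>R z - y))"
      by (rule integral_affine) (use fourier_measurable in measurable)
    also have "\<dots> = (LINT z|lborel. \<psi> (y + ?\<delta> n *\<^sub>R z) *
        (of_real (?\<delta> n ^ CARD('n)) * fourier (\<lambda>\<eta>. gauss (?\<delta> n *\<^sub>R \<eta>)) (?\<delta> n *\<^sub>R z)))"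
      by (simp only: integral_mult_right_zero[symmetric] mult_ac abs_of_pos[OF \<delta>0] add_diff_cancel_left')
    also have "\<dots> = (LINT z|lborel. \<psi> (y + ?\<delta> n *\<^sub>R z) * (?C * gauss z))"
      unfolding fourier_gauss_scaled[OF \<delta>0] using \<delta>0 by simp
    also have "\<dots> = ?C * (LINT z|lborel. \<psi> (y + ?\<delta> n *\<^sub>R z) * gauss z)"
      by (simp only: integral_mult_right_zero[symmetric] mult_ac)
    finally show ?thesis .
  qed
  have "(\<lambda>n. LINT z|lborel. \<psi> (y + ?\<delta> n *\<^sub>R z) * gauss z) \<longlonglongrightarrow> (LINT z|lborel. \<psi> y * gauss (z :: real ^ 'n))"
  proof (rule integral_dominated_convergence[where w = "\<lambda>z :: real ^ 'n. B * norm (gauss z)"])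
    show "integrable lborel (\<lambda>z :: real ^ 'n. B * norm (gauss z))"
      by (intro integrable_mult_right integrable_norm gauss_integrable)
    show "AE z in lborel. (\<lambda>n. \<psi> (y + ?\<delta> n *\<^sub>R z) * gauss z) \<longlonglongrightarrow> \<psi> y * gauss z"
    proof (rule AE_I2)
      fix z :: "real ^ 'n"
      have "(\<lambda>n. y + ?\<delta> n *\<^sub>R z) \<longlonglongrightarrow> y + 0 *\<^sub>R z"
        by (intro tendsto_add tendsto_scaleR \<delta> tendsto_const)
      then have "(\<lambda>n. y + ?\<delta> n *\<^sub>R z) \<longlonglongrightarrow> y" by simp
      moreover have "isCont \<psi> y" using cont by (simp add: continuous_on_eq_continuous_at)
      ultimately have "(\<lambda>n. \<psi> (y + ?\<delta> n *\<^sub>R z)) \<longlonglongrightarrow> \<psi> y" using isCont_tendsto_compose by blast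
      then show "(\<lambda>n. \<psi> (y + ?\<delta> n *\<^sub>R z) * gauss z) \<longlonglongrightarrow> \<psi> y * gauss z"
        by (intro tendsto_mult tendsto_const)
    qed
    show "AE z in lborel. norm (\<psi> (y + ?\<delta> n *\<^sub>R z) * gauss z) \<le> B * norm (gauss z)" for n
      by (rule AE_I2) (simp add: norm_mult mult_right_mono bd del: of_nat_Suc)
  qed measurable
  then have "A \<longlonglongrightarrow> ?C * (LINT z|lborel. \<psi> y * gauss (z :: real ^ 'n))"
    unfolding A by (intro tendsto_mult tendsto_const)
  moreover have "(LINT z|lborel. \<psi> y * gauss (z :: real ^ 'n)) = \<psi> y * ?C"
    using fourier_gauss[of "0 :: real ^ 'n"] by (simp add: fourier_eq) (simp add: gauss_def)
  ultimately have "A \<longlonglongrightarrow> ?C * (\<psi> y * ?C)" by (simp only:)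
  with lim1 have "fourier (fourier \<psi>) (- y) = ?C * (\<psi> y * ?C)" by (rule LIMSEQ_unique)
  then show ?thesis by (simp add: power2_eq_square mult_ac)
qed

corollary decreasing_fourier_inversion:
  fixes \<psi> :: "real ^ 'n::finite \<Rightarrow> complex"
  assumes "decreasing \<psi>"
  shows "fourier (fourier \<psi>) (- y) = (fourier_const TYPE('n))\<^sup>2 * \<psi> y"
proof -
  obtain B where B: "\<And>x. norm (\<psi> x) * (1 + norm x) ^ 0 \<le> B"
    using assms unfolding decreasing_def by (metis foldr.simps(1) id_apply replicate_0)
  show ?thesis
  proof (rule fourier_inversion)
    show "continuous_on UNIV \<psi>" by (intro smooth_on_imp_continuous_on decreasing_smooth assms)
    show "integrable lborel (fourier \<psi>)"
      by (intro rapidly_decreasing_integrable rapidly_decreasing_fourier assms)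
    show "norm (\<psi> x) \<le> B" for x using B[of x] by simp
  qed (rule decreasing_integrable[OF assms])
qed

section \<open>Test functions and distributions\<close>

lemma test_functionsD:
  assumes "\<psi> \<in> test_functions \<omega>"
  shows "smooth \<psi>" "compact (closure {x. \<psi> x \<noteq> 0})" "closure {x. \<psi> x \<noteq> 0} \<subseteq> \<omega>"
  using assms by (auto simp: test_functions_def)

lemma test_functionsI:
  assumes "smooth \<psi>" "compact K" "K \<subseteq> \<omega>" "\<And>x. x \<notin> K \<Longrightarrow> \<psi> x = 0"
  shows "\<psi> \<in> test_functions \<omega>"
proof -
  have "{x. \<psi> x \<noteq> 0} \<subseteq> K" using assms(4) by blast
  then have s: "closure {x. \<psi> x \<noteq> 0} \<subseteq> K"
    using assms(2) by (intro closure_minimal compact_imp_closed)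
  then have "closure {x. \<psi> x \<noteq> 0} = K \<inter> closure {x. \<psi> x \<noteq> 0}" by blast
  then have "compact (closure {x. \<psi> x \<noteq> 0})"
    using compact_Int_closed[OF assms(2) closed_closure] by metis
  then show ?thesis using assms(1,3) s unfolding test_functions_def by blast
qed

lemma zero_outside_closure_support: "x \<notin> closure {x. \<psi> x \<noteq> 0} \<Longrightarrow> \<psi> x = 0"
  using closure_subset[of "{x. \<psi> x \<noteq> 0}"] by blast

lemma test_functions_mono: "\<psi> \<in> test_functions S \<Longrightarrow> S \<subseteq> T \<Longrightarrow> \<psi> \<in> test_functions T"
  by (auto simp: test_functions_def)

lemma test_functions_mult:
  assumes "\<psi> \<in> test_functions \<omega>" "smooth h"
  shows "(\<lambda>x. \<psi> x * h x) \<in> test_functions \<omega>"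
  by (rule test_functionsI[OF smooth_mult[OF test_functionsD(1)[OF assms(1)] assms(2)]
        test_functionsD(2,3)[OF assms(1)]])
    (drule zero_outside_closure_support, simp)

lemma test_functions_mult_left:
  assumes "\<psi> \<in> test_functions \<omega>" "smooth h"
  shows "(\<lambda>x. h x * \<psi> x) \<in> test_functions \<omega>"
  using test_functions_mult[OF assms] by (simp add: mult.commute)

lemma test_functions_add:
  assumes "\<psi> \<in> test_functions \<omega>" "\<eta> \<in> test_functions \<omega>"
  shows "(\<lambda>x. \<psi> x + \<eta> x) \<in> test_functions \<omega>"
proof (rule test_functionsI)
  show "smooth (\<lambda>x. \<psi> x + \<eta> x)" by (intro smooth_add test_functionsD(1)[OF assms(1)] test_functionsD(1)[OF assms(2)])
  show "compact (closure {x. \<psi> x \<noteq> 0} \<union> closure {x. \<eta> x \<noteq> 0})"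
    by (intro compact_Un test_functionsD(2)[OF assms(1)] test_functionsD(2)[OF assms(2)])
  show "closure {x. \<psi> x \<noteq> 0} \<union> closure {x. \<eta> x \<noteq> 0} \<subseteq> \<omega>"
    by (intro Un_least test_functionsD(3)[OF assms(1)] test_functionsD(3)[OF assms(2)])
  show "\<psi> x + \<eta> x = 0" if "x \<notin> closure {x. \<psi> x \<noteq> 0} \<union> closure {x. \<eta> x \<noteq> 0}" for x
    using that zero_outside_closure_support[of x \<psi>] zero_outside_closure_support[of x \<eta>] by simp
qed

lemma test_functions_cmult: "\<psi> \<in> test_functions \<omega> \<Longrightarrow> (\<lambda>x. c * \<psi> x) \<in> test_functions \<omega>"
  by (rule test_functions_mult_left[OF _ smooth_const])

lemma test_functions_zero: "(\<lambda>x. 0) \<in> test_functions \<omega>"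
  by (rule test_functionsI[OF smooth_const compact_empty]) simp_all

lemma test_function_bounded_mult:
  assumes "\<psi> \<in> test_functions \<omega>" "continuous_on UNIV p"
  shows "\<exists>B. \<forall>x. norm (pder js \<psi> x) * (p x :: real) \<le> B"
proof -
  let ?K = "closure {x. \<psi> x \<noteq> 0}"
  have "continuous_on UNIV (\<lambda>x. norm (pder js \<psi> x) * p x)"
    by (intro continuous_intros assms smooth_on_imp_continuous_on smooth_on_pder test_functionsD(1)[OF assms(1)])
  then have "continuous_on ?K (\<lambda>x. norm (pder js \<psi> x) * p x)"
    by (rule continuous_on_subset) simp
  then have "compact ((\<lambda>x. norm (pder js \<psi> x) * p x) ` ?K)"
    using test_functionsD(2)[OF assms(1)] by (rule compact_continuous_image)
  from compact_imp_bounded[OF this]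
  obtain B where B: "\<forall>y\<in>(\<lambda>x. norm (pder js \<psi> x) * p x) ` ?K. norm y \<le> B"
    unfolding bounded_iff ..
  have "norm (pder js \<psi> x) * p x \<le> max B 0" for x
  proof (cases "x \<in> ?K")
    case True
    then have "norm (norm (pder js \<psi> x) * p x) \<le> B" by (intro B[rule_format] imageI)
    then show ?thesis by simp
  next
    case False
    then show ?thesis using pder_zero_outside_support[of x \<psi> js] by simp
  qed
  then show ?thesis by (intro exI allI)
qed

lemma test_function_decreasing:
  assumes "\<psi> \<in> test_functions \<omega>" shows "decreasing \<psi>"
  unfolding decreasing_def
  by (intro conjI allI test_functionsD(1)[OF assms] test_function_bounded_mult[OF assms] continuous_intros)

lemma finite_lists_le: "finite {js :: 'n::finite list. length js \<le> N}"
  using finite_lists_length_le[of "UNIV :: 'n set" N] by simp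

lemma test_function_bounded:
  fixes \<psi> :: "real ^ 'n::finite \<Rightarrow> complex"
  assumes "\<psi> \<in> test_functions \<omega>"
  shows "\<exists>A\<ge>0. \<forall>js x. length js \<le> N \<longrightarrow> norm (pder js \<psi> x) \<le> A"
proof -
  have "\<forall>js. \<exists>B. \<forall>x. norm (pder js \<psi> x) \<le> B"
    using test_function_bounded_mult[OF assms continuous_on_const[of _ 1]] by simp
  then obtain B where B: "\<And>js x. norm (pder js \<psi> x) \<le> B js" by metis
  let ?A = "\<Sum>js\<in>{js. length js \<le> N}. \<bar>B js\<bar>"
  have "norm (pder js \<psi> x) \<le> ?A" if "length js \<le> N" for js x
  proof -
    have "\<bar>B js\<bar> \<le> ?A" using that finite_lists_le by (intro member_le_sum) auto
    then show ?thesis using B[of js x] by linarith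
  qed
  moreover have "0 \<le> ?A" by (rule sum_nonneg) simp
  ultimately show ?thesis by blast
qed

section \<open>Linearity and continuity estimates of distributions\<close>

lemma distributions_add:
  "u \<in> distributions \<omega> \<Longrightarrow> \<psi> \<in> test_functions \<omega> \<Longrightarrow> \<eta> \<in> test_functions \<omega> \<Longrightarrow>
    u (\<lambda>x. \<psi> x + \<eta> x) = u \<psi> + u \<eta>"
  by (simp add: distributions_def)

lemma distributions_cmult:
  "u \<in> distributions \<omega> \<Longrightarrow> \<psi> \<in> test_functions \<omega> \<Longrightarrow> u (\<lambda>x. c * \<psi> x) = c * u \<psi>"
  by (simp add: distributions_def)

lemma distributions_zero: "u \<in> distributions \<omega> \<Longrightarrow> u (\<lambda>x. 0) = 0"
  using distributions_cmult[OF _ test_functions_zero, of u \<omega> 0] by simp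

lemma distributions_diff:
  assumes "u \<in> distributions \<omega>" "\<psi> \<in> test_functions \<omega>" "\<eta> \<in> test_functions \<omega>"
  shows "u (\<lambda>x. \<psi> x - \<eta> x) = u \<psi> - u \<eta>"
  using distributions_add[OF assms(1,2) test_functions_cmult[OF assms(3), of "-1"]]
    distributions_cmult[OF assms(1,3), of "-1"] by simp

text \<open>Replaces the sum of suprema over multi-indices by one bound B on all lists of at most N
  derivatives; the number of multi-indices is absorbed in C. The quantifiers put C and N before
  \<psi>.\<close>

lemma distributions_bound:
  fixes u :: "(real ^ 'n::finite \<Rightarrow> complex) \<Rightarrow> complex"
  assumes "u \<in> distributions \<omega>" "compact K" "K \<subseteq> \<omega>"
  shows "\<exists>C\<ge>0. \<exists>N. \<forall>\<psi>\<in>test_functions \<omega>. closure {x. \<psi> x \<noteq> 0} \<subseteq> K \<longrightarrow>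
    (\<forall>B. (\<forall>js x. length js \<le> N \<longrightarrow> norm (pder js \<psi> x) \<le> B) \<longrightarrow> norm (u \<psi>) \<le> C * B)"
proof -
  obtain C N where CN: "\<forall>\<psi>\<in>test_functions \<omega>. closure {x. \<psi> x \<noteq> 0} \<subseteq> K \<longrightarrow>
      norm (u \<psi>) \<le> C * (\<Sum>\<alpha> | mi_abs \<alpha> \<le> N. SUP x. norm (mi_deriv \<alpha> \<psi> x))"
    using assms unfolding distributions_def by blast
  let ?S = "{\<alpha> :: 'n multi_index. mi_abs \<alpha> \<le> N}"
  have "norm (u \<psi>) \<le> (\<bar>C\<bar> * real (card ?S)) * B"
    if \<psi>: "\<psi> \<in> test_functions \<omega>" "closure {x. \<psi> x \<noteq> 0} \<subseteq> K"
      and B: "\<forall>js x. length js \<le> N \<longrightarrow> norm (pder js \<psi> x) \<le> B" for \<psi> B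
  proof -
    have m: "norm (mi_deriv \<alpha> \<psi> x) \<le> B" if "\<alpha> \<in> ?S" for \<alpha> x
      using mi_deriv_eq_pder[of \<alpha>] B that by fastforce
    have le: "(SUP x. norm (mi_deriv \<alpha> \<psi> x)) \<le> B" if "\<alpha> \<in> ?S" for \<alpha>
      using m[OF that] by (intro cSUP_least) auto
    have ge: "0 \<le> (SUP x. norm (mi_deriv \<alpha> \<psi> x))" if "\<alpha> \<in> ?S" for \<alpha>
    proof -
      have "norm (mi_deriv \<alpha> \<psi> 0) \<le> (SUP x. norm (mi_deriv \<alpha> \<psi> x))"
        using m[OF that] by (intro cSUP_upper bdd_aboveI[of _ B]) auto
      then show ?thesis using norm_ge_zero order_trans by blast
    qed
    have "norm (u \<psi>) \<le> C * (\<Sum>\<alpha>\<in>?S. SUP x. norm (mi_deriv \<alpha> \<psi> x))" using CN \<psi> by blast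
    also have "\<dots> \<le> \<bar>C\<bar> * (\<Sum>\<alpha>\<in>?S. SUP x. norm (mi_deriv \<alpha> \<psi> x))"
      by (intro mult_right_mono sum_nonneg ge) auto
    also have "\<dots> \<le> \<bar>C\<bar> * (real (card ?S) * B)"
      by (intro mult_left_mono sum_bounded_above le) auto
    finally show ?thesis by (simp add: mult.assoc)
  qed
  then show ?thesis by (intro exI[of _ "\<bar>C\<bar> * real (card ?S)"] conjI exI[of _ N]) auto
qed

text \<open>C and N are fixed before \<kappa>, so the estimate is uniform along a whole cut-off
  sequence. V is measured on K only, because two waves of nearby frequencies are close only on
  bounded sets.\<close>

lemma distributions_mult_bound:
  fixes u :: "(real ^ 'n::finite \<Rightarrow> complex) \<Rightarrow> complex"
  assumes "u \<in> distributions \<omega>" "compact K" "K \<subseteq> \<omega>"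
  obtains C N where "0 \<le> C"
    and "\<And>\<kappa> A V \<delta>. \<kappa> \<in> test_functions \<omega> \<Longrightarrow> closure {x. \<kappa> x \<noteq> 0} \<subseteq> K \<Longrightarrow> 0 \<le> A \<Longrightarrow>
      (\<And>js x. length js \<le> N \<Longrightarrow> norm (pder js \<kappa> x) \<le> A) \<Longrightarrow> smooth V \<Longrightarrow> 0 \<le> \<delta> \<Longrightarrow>
      (\<And>js y. length js \<le> N \<Longrightarrow> y \<in> K \<Longrightarrow> norm (pder js V y) \<le> \<delta>) \<Longrightarrow>
      norm (u (\<lambda>x. \<kappa> x * V x)) \<le> C * A * \<delta>"
proof -
  obtain C N where C: "0 \<le> C" and CN: "\<forall>\<psi>\<in>test_functions \<omega>. closure {x. \<psi> x \<noteq> 0} \<subseteq> K \<longrightarrow>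
    (\<forall>B. (\<forall>js x. length js \<le> N \<longrightarrow> norm (pder js \<psi> x) \<le> B) \<longrightarrow> norm (u \<psi>) \<le> C * B)"
    using distributions_bound[OF assms] by blast
  show thesis
  proof (rule that[of "C * 2 ^ N" N])
    fix \<kappa> A V and \<delta> :: real
    assume \<kappa>: "\<kappa> \<in> test_functions \<omega>" "closure {x. \<kappa> x \<noteq> 0} \<subseteq> K" "0 \<le> A"
      "\<And>js x. length js \<le> N \<Longrightarrow> norm (pder js \<kappa> x) \<le> A"
      and V: "smooth V" "0 \<le> \<delta>" "\<And>js y. length js \<le> N \<Longrightarrow> y \<in> K \<Longrightarrow> norm (pder js V y) \<le> \<delta>"
    let ?\<psi> = "\<lambda>x. \<kappa> x * V x"
    have sub: "closure {x. ?\<psi> x \<noteq> 0} \<subseteq> closure {x. \<kappa> x \<noteq> 0}" by (rule closure_mono) auto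
    have "norm (pder js ?\<psi> x) \<le> 2 ^ N * A * \<delta>" if "length js \<le> N" for js x
    proof (cases "x \<in> K")
      case True
      have "norm (pder js ?\<psi> x) \<le> 2 ^ length js * A * \<delta>"
        by (rule norm_pder_mult_le[of _ _ _ UNIV N])
          (use \<kappa> V True that test_functionsD(1)[OF \<kappa>(1)] in auto)
      also have "\<dots> \<le> 2 ^ N * A * \<delta>"
        using that \<kappa> V by (intro mult_right_mono power_increasing) auto
      finally show ?thesis .
    next
      case False
      then have "pder js ?\<psi> x = 0" using sub \<kappa>(2) by (intro pder_zero_outside_support) blast
      then show ?thesis using \<kappa> V by simp
    qed
    then have "norm (u ?\<psi>) \<le> C * (2 ^ N * A * \<delta>)"
      by (rule CN[rule_format, OF test_functions_mult[OF \<kappa>(1) V(1)] order_trans[OF sub \<kappa>(2)]])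
    then show "norm (u ?\<psi>) \<le> C * 2 ^ N * A * \<delta>" by (simp add: mult_ac)
  qed (use C in simp)
qed

text \<open>Names the cut-off chosen inside \<open>pairing\<close>, so that a pairing becomes a
  plain evaluation of u.\<close>

definition support_cutoff :: 
    "(real ^ 'n::finite) set \<Rightarrow> ((real ^ 'n \<Rightarrow> complex) \<Rightarrow> complex) \<Rightarrow> real ^ 'n \<Rightarrow> complex" where
  "support_cutoff \<omega> u = (SOME \<rho>. \<rho> \<in> test_functions \<omega> \<and>
                 (\<exists>V. open V \<and> dist_support \<omega> u \<subseteq> V \<and> (\<forall>x\<in>V. \<rho> x = 1)))"

lemma pairing_eq: "pairing \<omega> u \<psi> = u (\<lambda>x. support_cutoff \<omega> u x * \<psi> x)"
  by (simp add: pairing_def support_cutoff_def Let_def)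

text \<open>No bump function is constructed from scratch: every admissible cut-off supplies one, and
  translation and rescaling give all the others.\<close>

locale smooth_bump =
  fixes \<eta> :: "real ^ 'n::finite \<Rightarrow> complex" and p\<^sub>0 V\<^sub>0
  assumes test: "\<eta> \<in> test_functions UNIV" and V0: "open V\<^sub>0" "p\<^sub>0 \<in> V\<^sub>0"
    and one: "\<And>x. x \<in> V\<^sub>0 \<Longrightarrow> \<eta> x = 1"
begin

lemma bump_in_ball:
  fixes p :: "real ^ 'n"
  assumes "0 < s"
  shows "\<exists>b\<in>test_functions (ball p s). \<exists>V. open V \<and> p \<in> V \<and> (\<forall>x\<in>V. b x = 1)"
proof -
  obtain R where R: "0 < R" "\<And>z. z \<in> closure {x. \<eta> x \<noteq> 0} \<Longrightarrow> norm z \<le> R"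
    using compact_imp_bounded[OF test_functionsD(2)[OF test]] unfolding bounded_pos by blast
  \<comment> \<open>The map x -> \<mu> x + c sends p to \<open>p\<^sub>0\<close>, and points mapped
    into the support of \<eta>, which has radius R about the origin, are within (R +
    |\<open>p\<^sub>0\<close>|) / \<mu> of p. The added 1 makes this smaller than s.\<close>
  define \<mu> where "\<mu> = (R + norm p\<^sub>0 + 1) / s"
  have \<mu>: "0 < \<mu>" using assms R(1) by (simp add: \<mu>_def add_pos_nonneg)
  define c where "c = p\<^sub>0 - \<mu> *\<^sub>R p"
  define b where "b x = \<eta> (\<mu> *\<^sub>R x + c)" for x
  have far: "b x = 0" if "x \<notin> cball p ((R + norm p\<^sub>0) / \<mu>)" for x
  proof -
    have *: "R + norm p\<^sub>0 < \<mu> * norm (x - p)"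
      using that \<mu> by (simp add: dist_norm norm_minus_commute divide_simps mult.commute)
    have "(\<mu> *\<^sub>R x + c) - p\<^sub>0 = \<mu> *\<^sub>R (x - p)" by (simp add: c_def scaleR_diff_right)
    then have "\<mu> * norm (x - p) = norm ((\<mu> *\<^sub>R x + c) - p\<^sub>0)" using \<mu> by simp
    also have "\<dots> \<le> norm (\<mu> *\<^sub>R x + c) + norm p\<^sub>0" by (rule norm_triangle_ineq4)
    finally have "R < norm (\<mu> *\<^sub>R x + c)" using * by simp
    then have "\<mu> *\<^sub>R x + c \<notin> closure {x. \<eta> x \<noteq> 0}" using R(2) by fastforce
    then show ?thesis unfolding b_def by (rule zero_outside_closure_support)
  qed
  have "(R + norm p\<^sub>0) / \<mu> < s" using assms R(1) by (simp add: \<mu>_def divide_simps add_pos_nonneg)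
  then have "cball p ((R + norm p\<^sub>0) / \<mu>) \<subseteq> ball p s" by auto
  then have "b \<in> test_functions (ball p s)"
    using far unfolding b_def
    by (intro test_functionsI[OF smooth_affine[OF test_functionsD(1)[OF test]] compact_cball])
  moreover have "open ((\<lambda>x. \<mu> *\<^sub>R x + c) -` V\<^sub>0)"
    by (intro open_vimage V0 continuous_intros)
  moreover have "p \<in> (\<lambda>x. \<mu> *\<^sub>R x + c) -` V\<^sub>0" using V0 by (simp add: c_def)
  moreover have "\<forall>x\<in>(\<lambda>x. \<mu> *\<^sub>R x + c) -` V\<^sub>0. b x = 1" using one by (simp add: b_def)
  ultimately show ?thesis by blast
qed

lemma bump_in_open:
  fixes S :: "(real ^ 'n) set"
  assumes "open S" "p \<in> S"
  shows "\<exists>b\<in>test_functions S. \<exists>V. open V \<and> p \<in> V \<and> (\<forall>x\<in>V. b x = 1)"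
proof -
  obtain s where "0 < s" "ball p s \<subseteq> S" using assms openE by blast
  then show ?thesis using bump_in_ball[of s p] test_functions_mono by blast
qed

lemma plateau:
  fixes S :: "(real ^ 'n) set"
  assumes "open S" "compact K" "K \<subseteq> S"
  shows "\<exists>b\<in>test_functions S. \<exists>V. open V \<and> K \<subseteq> V \<and> (\<forall>x\<in>V. b x = 1)"
proof -
  have "\<forall>p\<in>K. \<exists>b V. b \<in> test_functions S \<and> open V \<and> p \<in> V \<and> (\<forall>x\<in>V. b x = 1)"
    using bump_in_open[OF assms(1)] assms(3) by blast
  then obtain b V where bV: "\<And>p. p \<in> K \<Longrightarrow> b p \<in> test_functions S" "\<And>p. p \<in> K \<Longrightarrow> open (V p)"
      "\<And>p. p \<in> K \<Longrightarrow> p \<in> V p" "\<And>p x. p \<in> K \<Longrightarrow> x \<in> V p \<Longrightarrow> b p x = 1"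
    by metis
  obtain P where P: "P \<subseteq> K" "finite P" "K \<subseteq> (\<Union>p\<in>P. V p)"
    using compactE_image[OF assms(2), of K V] bV(2,3) by blast
  from P(2,1) have "\<exists>c\<in>test_functions S. \<forall>x\<in>(\<Union>p\<in>P. V p). c x = 1"
  proof (induction P rule: finite_induct)
    case empty
    show ?case using test_functions_zero by auto
  next
    case (insert p P)
    then obtain c where c: "c \<in> test_functions S" "\<And>x. x \<in> (\<Union>p\<in>P. V p) \<Longrightarrow> c x = 1" by auto
    \<comment> \<open>1 - ?c is the product of 1 - c and 1 - b p, so ?c equals 1 wherever c or b p
      does.\<close>
    let ?c = "\<lambda>x. c x * (1 - b p x) + b p x"
    have bp: "b p \<in> test_functions S" using insert bV by blast
    have "?c \<in> test_functions S"
      by (intro test_functions_add test_functions_mult smooth_diff smooth_const test_functionsD(1)[OF bp] c bp)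
    moreover have "?c x = 1" if "x \<in> (\<Union>p\<in>insert p P. V p)" for x
      using that c(2)[of x] bV(4)[of p x] insert.prems by (cases "x \<in> V p") auto
    ultimately show ?case by (intro bexI[of _ ?c] ballI)
  qed
  moreover have "open (\<Union>p\<in>P. V p)" using bV(2) P(1) by blast
  ultimately show ?thesis using P(3) by blast
qed

lemma vanishes_off_support:
  fixes \<omega> :: "(real ^ 'n) set"
  assumes add: "\<And>\<psi> \<eta>. \<psi> \<in> test_functions \<omega> \<Longrightarrow> \<eta> \<in> test_functions \<omega> \<Longrightarrow> u (\<lambda>x. \<psi> x + \<eta> x) = u \<psi> + u \<eta>"
    and \<psi>: "\<psi> \<in> test_functions \<omega>" and disj: "closure {x. \<psi> x \<noteq> 0} \<inter> dist_support \<omega> u = {}"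
  shows "u \<psi> = 0"
proof -
  let ?K = "closure {x. \<psi> x \<noteq> 0}"
  have local: "\<exists>b V. open V \<and> p \<in> V \<and> (\<forall>x\<in>V. b x = 1) \<and> b \<in> test_functions \<omega> \<and> (\<forall>h. smooth h \<longrightarrow> u (\<lambda>x. h x * b x) = 0)"
    if "p \<in> ?K" for p
  proof -
    have "p \<in> \<omega>" "p \<notin> dist_support \<omega> u" using that disj test_functionsD(3)[OF \<psi>] by auto
    then obtain S where S: "open S" "p \<in> S" "S \<subseteq> \<omega>" "\<And>\<psi>. \<psi> \<in> test_functions S \<Longrightarrow> u \<psi> = 0"
      unfolding dist_support_def by blast
    obtain b V where bV: "b \<in> test_functions S" "open V" "p \<in> V" "\<forall>x\<in>V. b x = 1"
      using bump_in_open[OF S(1,2)] by blast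
    have "u (\<lambda>x. h x * b x) = 0" if "smooth h" for h
      using S(4)[OF test_functions_mult_left[OF bV(1) that]] .
    moreover have "b \<in> test_functions \<omega>" using bV(1) S(3) by (rule test_functions_mono)
    ultimately show ?thesis using bV by (intro exI[of _ b] exI[of _ V] conjI allI impI)
  qed
  obtain b V where bV: "\<And>p. p \<in> ?K \<Longrightarrow> open (V p)" "\<And>p. p \<in> ?K \<Longrightarrow> p \<in> V p"
      "\<And>p x. p \<in> ?K \<Longrightarrow> x \<in> V p \<Longrightarrow> b p x = 1" "\<And>p. p \<in> ?K \<Longrightarrow> b p \<in> test_functions \<omega>"
      "\<And>p h. p \<in> ?K \<Longrightarrow> smooth h \<Longrightarrow> u (\<lambda>x. h x * b p x) = 0"
  proof -
    let ?Q = "\<lambda>p z. open (snd z) \<and> p \<in> snd z \<and> (\<forall>x\<in>snd z. fst z x = 1) \<and> fst z \<in> test_functions \<omega> \<and>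
      (\<forall>h. smooth h \<longrightarrow> u (\<lambda>x. h x * fst z x) = 0)"
    have "\<forall>p\<in>?K. \<exists>z. ?Q p z"
      using local by (simp only: split_paired_Ex fst_conv snd_conv) (rule ballI)
    from bchoice[OF this] obtain g where g: "\<forall>p\<in>?K. ?Q p (g p)" ..
    show thesis
    proof (rule that[of "\<lambda>p. snd (g p)" "\<lambda>p. fst (g p)"])
      fix p assume "p \<in> ?K"
      with g have Q: "?Q p (g p)" by (rule bspec)
      show "open (snd (g p))" "p \<in> snd (g p)" "fst (g p) \<in> test_functions \<omega>"
        using Q by (simp_all only: simp_thms)
      show "fst (g p) x = 1" if "x \<in> snd (g p)" for x using Q that by (simp only: simp_thms)
      show "u (\<lambda>x. h x * fst (g p) x) = 0" if "smooth h" for h using Q that by (simp only: simp_thms)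
    qed
  qed
  obtain P where P: "P \<subseteq> ?K" "finite P" "?K \<subseteq> (\<Union>p\<in>P. V p)"
    using compactE_image[OF test_functionsD(2)[OF \<psi>], of ?K V] bV(1,2) by blast
  \<comment> \<open>The invariant: h is the product of the factors used so far; it vanishes near the
    points already treated, and u does not notice it.\<close>
  from P(2,1) have "\<exists>h. smooth h \<and> (\<forall>x\<in>(\<Union>p\<in>P. V p). h x = 0) \<and> u \<psi> = u (\<lambda>x. h x * \<psi> x)"
  proof (induction P rule: finite_induct)
    case empty
    show ?case by (rule exI[of _ "\<lambda>_. 1"]) (simp add: smooth_const)
  next
    case (insert p P)
    then obtain h where h: "smooth h" "\<And>x. x \<in> (\<Union>p\<in>P. V p) \<Longrightarrow> h x = 0" "u \<psi> = u (\<lambda>x. h x * \<psi> x)"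
      by auto
    have pK: "p \<in> ?K" using insert by blast
    let ?h = "\<lambda>x. h x * (1 - b p x)"
    have sb: "smooth (b p)" using bV(4)[OF pK] by (rule test_functionsD)
    have sh: "smooth ?h" by (intro smooth_mult smooth_diff smooth_const h sb)
    have s\<psi>: "smooth \<psi>" using \<psi> by (rule test_functionsD)
    have "u (\<lambda>x. ?h x * \<psi> x + (h x * \<psi> x) * b p x) = u (\<lambda>x. ?h x * \<psi> x) + u (\<lambda>x. (h x * \<psi> x) * b p x)"
      by (rule add)
        (intro test_functions_mult_left \<psi> sh bV(4)[OF pK] smooth_mult h s\<psi>)+
    also have "u (\<lambda>x. (h x * \<psi> x) * b p x) = 0"
      by (rule bV(5)[OF pK]) (intro smooth_mult h s\<psi>)
    finally have "u \<psi> = u (\<lambda>x. ?h x * \<psi> x)" using h(3) by (simp add: algebra_simps)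
    moreover have "?h x = 0" if "x \<in> (\<Union>p\<in>insert p P. V p)" for x
      using that h(2)[of x] bV(3)[OF pK, of x] by auto
    ultimately show ?case using sh by (intro exI[of _ ?h] conjI ballI)
  qed
  then obtain h where h: "\<And>x. x \<in> (\<Union>p\<in>P. V p) \<Longrightarrow> h x = 0" "u \<psi> = u (\<lambda>x. h x * \<psi> x)" by auto
  have "h x * \<psi> x = 0" for x
    using h(1)[of x] P(3) zero_outside_closure_support[of x \<psi>] by (cases "x \<in> ?K") auto
  then have "(\<lambda>x. h x * \<psi> x) = (\<lambda>x. 0)" by (rule ext)
  then have "u \<psi> = u (\<lambda>x. 0)" using h(2) by (simp only:)
  moreover have "u (\<lambda>x. 0) = 0" using add[OF test_functions_zero test_functions_zero] by simp
  ultimately show ?thesis by simp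
qed

lemma distribution_eq_near_support:
  fixes \<omega> :: "(real ^ 'n) set"
  assumes u: "u \<in> distributions \<omega>" and \<psi>: "\<psi> \<in> test_functions \<omega>" "\<theta> \<in> test_functions \<omega>"
    and V: "open V" "dist_support \<omega> u \<subseteq> V" "\<And>x. x \<in> V \<Longrightarrow> \<psi> x = \<theta> x"
  shows "u \<psi> = u \<theta>"
proof -
  let ?d = "\<lambda>x. \<psi> x + (-1) * \<theta> x"
  have t: "?d \<in> test_functions \<omega>" by (intro test_functions_add test_functions_cmult \<psi>)
  have "{x. ?d x \<noteq> 0} \<subseteq> - V" using V(3) by auto
  then have "closure {x. ?d x \<noteq> 0} \<subseteq> - V" using V(1) by (intro closure_minimal) auto
  then have "closure {x. ?d x \<noteq> 0} \<inter> dist_support \<omega> u = {}" using V(2) by blast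
  then have "u ?d = 0" by (intro vanishes_off_support[OF distributions_add[OF u] t])
  then show ?thesis using distributions_diff[OF u \<psi>] by simp
qed

lemma support_cutoff:
  fixes \<omega> :: "(real ^ 'n) set"
  assumes "open \<omega>" "compact K" "dist_support \<omega> u \<subseteq> K" "K \<subseteq> \<omega>"
  shows "support_cutoff \<omega> u \<in> test_functions \<omega>"
    and "\<exists>V. open V \<and> dist_support \<omega> u \<subseteq> V \<and> (\<forall>x\<in>V. support_cutoff \<omega> u x = 1)"
proof -
  obtain b V where "b \<in> test_functions \<omega>" "open V" "K \<subseteq> V" "\<forall>x\<in>V. b x = 1"
    using plateau[OF assms(1,2,4)] by blast
  then have "\<exists>\<rho>. \<rho> \<in> test_functions \<omega> \<and> (\<exists>V. open V \<and> dist_support \<omega> u \<subseteq> V \<and> (\<forall>x\<in>V. \<rho> x = 1))"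
    using assms(3) by blast
  from someI_ex[OF this]
  show "support_cutoff \<omega> u \<in> test_functions \<omega>"
    "\<exists>V. open V \<and> dist_support \<omega> u \<subseteq> V \<and> (\<forall>x\<in>V. support_cutoff \<omega> u x = 1)"
    unfolding support_cutoff_def by (rule conjunct1, rule conjunct2)
qed

text \<open>Frees the Fourier transform from the unspecified cut-off \<rho> in
  \<open>pairing\<close>. The difference of the two sides is \<kappa> u applied to (1 - \<rho>)
  times a wave, which vanishes near the support of \<kappa> u.\<close>

lemma dist_fourier_dist_mult:
  fixes \<omega> :: "(real ^ 'n) set"
  assumes \<omega>: "open \<omega>" and u: "u \<in> distributions \<omega>" and \<kappa>: "\<kappa> \<in> test_functions \<omega>"
  shows "dist_fourier \<omega> (dist_mult \<kappa> u) \<xi> = u (\<lambda>x. \<kappa> x * wave \<xi> x)"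
proof -
  let ?K = "closure {x. \<kappa> x \<noteq> 0}" and ?v = "dist_mult \<kappa> u"
  note s\<kappa> = test_functionsD(1)[OF \<kappa>]
  have add: "?v (\<lambda>x. \<psi> x + \<eta> x) = ?v \<psi> + ?v \<eta>" if "\<psi> \<in> test_functions \<omega>" "\<eta> \<in> test_functions \<omega>" for \<psi> \<eta>
    using distributions_add[OF u test_functions_mult_left[OF that(1) s\<kappa>] test_functions_mult_left[OF that(2) s\<kappa>]]
    by (simp add: dist_mult_def distrib_left)
  have supp: "dist_support \<omega> ?v \<subseteq> ?K"
  proof
    fix x assume x: "x \<in> dist_support \<omega> ?v"
    show "x \<in> ?K"
    proof (rule ccontr)
      assume "x \<notin> ?K"
      then have "open (\<omega> \<inter> - ?K) \<and> x \<in> \<omega> \<inter> - ?K \<and> \<omega> \<inter> - ?K \<subseteq> \<omega>"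
        using x \<omega> by (auto simp: dist_support_def)
      then obtain \<psi> where \<psi>: "\<psi> \<in> test_functions (\<omega> \<inter> - ?K)" "?v \<psi> \<noteq> 0"
        using x unfolding dist_support_def by blast
      have "\<kappa> y * \<psi> y = 0" for y
        using zero_outside_closure_support[of y \<kappa>] zero_outside_closure_support[of y \<psi>] test_functionsD(3)[OF \<psi>(1)]
        by (cases "y \<in> ?K") auto
      then have "(\<lambda>y. \<kappa> y * \<psi> y) = (\<lambda>y. 0)" by (rule ext)
      then show False using \<psi>(2) distributions_zero[OF u] by (simp only: dist_mult_def simp_thms)
    qed
  qed
  define \<rho> where "\<rho> = support_cutoff \<omega> ?v"
  obtain V where V: "open V" "dist_support \<omega> ?v \<subseteq> V" "\<And>x. x \<in> V \<Longrightarrow> \<rho> x = 1" and \<rho>: "\<rho> \<in> test_functions \<omega>"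
    using support_cutoff[OF \<omega> test_functionsD(2)[OF \<kappa>] supp test_functionsD(3)[OF \<kappa>]] unfolding \<rho>_def by blast
  obtain b S where b: "b \<in> test_functions \<omega>" "?K \<subseteq> S" "\<And>x. x \<in> S \<Longrightarrow> b x = 1"
    using plateau[OF \<omega> test_functionsD(2)[OF \<kappa>] test_functionsD(3)[OF \<kappa>]] by blast
  \<comment> \<open>(1 - \<rho>) times a wave need not have compact support. The factor b, which is
    1 on the support of \<kappa>, repairs this without changing the product with \<kappa>.\<close>
  let ?\<psi> = "\<lambda>x. b x * ((1 - \<rho> x) * wave \<xi> x)"
  have t: "?\<psi> \<in> test_functions \<omega>"
    by (intro test_functions_mult b smooth_mult smooth_diff smooth_const smooth_wave test_functionsD(1)[OF \<rho>])
  have "{x. ?\<psi> x \<noteq> 0} \<subseteq> - V" using V(3) by auto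
  then have "closure {x. ?\<psi> x \<noteq> 0} \<subseteq> - V" using V(1) by (intro closure_minimal) auto
  then have "closure {x. ?\<psi> x \<noteq> 0} \<inter> dist_support \<omega> ?v = {}" using V(2) by blast
  then have 0: "?v ?\<psi> = 0" by (intro vanishes_off_support[OF add t])
  have eq: "\<kappa> x * ?\<psi> x = \<kappa> x * wave \<xi> x - \<kappa> x * (\<rho> x * wave \<xi> x)" for x
    using b(2) b(3)[of x] zero_outside_closure_support[of x \<kappa>] by (cases "x \<in> ?K") (auto simp: algebra_simps)
  have "u (\<lambda>x. \<kappa> x * wave \<xi> x - \<kappa> x * (\<rho> x * wave \<xi> x)) = 0"
    using 0 unfolding dist_mult_def eq .
  then have "u (\<lambda>x. \<kappa> x * wave \<xi> x) = u (\<lambda>x. \<kappa> x * (\<rho> x * wave \<xi> x))"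
    by (subst (asm) distributions_diff[OF u])
      (intro test_functions_mult \<kappa> smooth_mult smooth_wave test_functionsD(1)[OF \<rho>] | simp)+
  then show ?thesis
    unfolding dist_fourier_def pairing_eq \<rho>_def[symmetric] dist_mult_def wave_def by simp
qed

end

section \<open>Interchanging a distribution with a Fourier integral\<close>

lemma smooth_sum:
  assumes "finite S" "\<And>a. a \<in> S \<Longrightarrow> smooth (g a)"
  shows "smooth (\<lambda>x. \<Sum>a\<in>S. g a x)"
  using assms by (induction S rule: finite_induct) (auto intro: smooth_add smooth_const)

lemma pder_sum:
  assumes "finite S" "\<And>a. a \<in> S \<Longrightarrow> smooth (g a)"
  shows "pder js (\<lambda>x. \<Sum>a\<in>S. g a x) = (\<lambda>x. \<Sum>a\<in>S. pder js (g a) x)"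
  using assms by (induction S rule: finite_induct) (auto simp: pder_add pder_const smooth_sum)

lemma distributions_wave_sum:
  assumes "u \<in> distributions \<omega>" "\<kappa> \<in> test_functions \<omega>" "finite S"
  shows "u (\<lambda>x. \<kappa> x * (\<Sum>a\<in>S. c a * wave a x)) = (\<Sum>a\<in>S. c a * u (\<lambda>x. \<kappa> x * wave a x))"
  using assms(3)
proof (induction S rule: finite_induct)
  case empty
  then show ?case using distributions_zero[OF assms(1)] by simp
next
  case (insert a S)
  have t: "(\<lambda>x. \<kappa> x * wave a x) \<in> test_functions \<omega>"
    by (intro test_functions_mult assms smooth_wave)
  have t2: "(\<lambda>x. \<kappa> x * (\<Sum>a\<in>S. c a * wave a x)) \<in> test_functions \<omega>"
    using insert by (intro test_functions_mult assms smooth_sum smooth_mult smooth_const smooth_wave)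
  have "u (\<lambda>x. c a * (\<kappa> x * wave a x) + \<kappa> x * (\<Sum>a\<in>S. c a * wave a x))
      = c a * u (\<lambda>x. \<kappa> x * wave a x) + u (\<lambda>x. \<kappa> x * (\<Sum>a\<in>S. c a * wave a x))"
    using distributions_add[OF assms(1) test_functions_cmult[OF t] t2] distributions_cmult[OF assms(1) t]
    by simp
  then show ?case using insert by (simp add: distrib_left mult_ac)
qed

text \<open>Only the frequency is discretised: w is integrated exactly over the level sets of s, and
  F is evaluated at the values of s.\<close>

lemma integral_simple_compose:
  fixes w :: "real ^ 'n::finite \<Rightarrow> complex" and s :: "real ^ 'n \<Rightarrow> real ^ 'n" and F :: "real ^ 'n \<Rightarrow> complex"
  assumes "simple_function borel s" "integrable lborel w"
  shows "integrable lborel (\<lambda>\<zeta>. w \<zeta> * F (s \<zeta>))"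
    and "(LINT \<zeta>|lborel. w \<zeta> * F (s \<zeta>)) = (\<Sum>a\<in>range s. (LINT \<zeta>|lborel. w \<zeta> * indicator (s -` {a}) \<zeta>) * F a)"
proof -
  have fin: "finite (range s)" using simple_functionD(1)[OF assms(1)] by simp
  have eq: "w \<zeta> * F (s \<zeta>) = (\<Sum>a\<in>range s. w \<zeta> * indicator (s -` {a}) \<zeta> * F a)" for \<zeta>
  proof -
    have "(\<Sum>a\<in>range s. w \<zeta> * indicator (s -` {a}) \<zeta> * F a)
        = (\<Sum>a\<in>range s. if a = s \<zeta> then w \<zeta> * F (s \<zeta>) else 0)"
      by (rule sum.cong) (auto simp: indicator_def)
    then show ?thesis using fin by simp
  qed
  have int: "integrable lborel (\<lambda>\<zeta>. w \<zeta> * indicator (s -` {a}) \<zeta>)" for a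
  proof (rule Bochner_Integration.integrable_bound[OF assms(2)])
    have "s -` {a} \<in> sets borel" using simple_functionD(2)[OF assms(1), of "{a}"] by simp
    then show "(\<lambda>\<zeta>. w \<zeta> * indicator (s -` {a}) \<zeta>) \<in> borel_measurable lborel"
      using borel_measurable_integrable[OF assms(2)] by measurable
  qed (auto intro!: AE_I2 simp: indicator_def)
  show "integrable lborel (\<lambda>\<zeta>. w \<zeta> * F (s \<zeta>))"
    unfolding eq using int by (intro Bochner_Integration.integrable_sum integrable_mult_left)
  show "(LINT \<zeta>|lborel. w \<zeta> * F (s \<zeta>)) = (\<Sum>a\<in>range s. (LINT \<zeta>|lborel. w \<zeta> * indicator (s -` {a}) \<zeta>) * F a)"
    unfolding eq using int by (subst Bochner_Integration.integral_sum) auto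
qed

lemma norm_wave_diff_le: "norm (wave \<zeta> y - wave \<zeta>' y) \<le> norm y * norm (\<zeta> - \<zeta>')"
proof -
  have "wave \<zeta> y = wave \<zeta>' y * wave (\<zeta> - \<zeta>') y"
    using wave_add[of y \<zeta>' "\<zeta> - \<zeta>'"] by (simp add: wave_commute)
  then have "wave \<zeta> y - wave \<zeta>' y = wave \<zeta>' y * (wave (\<zeta> - \<zeta>') y - 1)" by (simp add: algebra_simps)
  then have "norm (wave \<zeta> y - wave \<zeta>' y) = norm (iexp (- (y \<bullet> (\<zeta> - \<zeta>'))) - 1)"
    by (simp add: norm_mult) (simp add: wave_def)
  also have "\<dots> \<le> \<bar>y \<bullet> (\<zeta> - \<zeta>')\<bar>" using iexp_approx1[of "- (y \<bullet> (\<zeta> - \<zeta>'))" 0] by simp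
  also have "\<dots> \<le> norm y * norm (\<zeta> - \<zeta>')" by (rule Cauchy_Schwarz_ineq2)
  finally show ?thesis .
qed

text \<open>Bounds every derivative of order at most N of the difference of two waves on the ball of
  radius R, independently of the point; it depends on the two frequencies alone and can be
  integrated over \<zeta>.\<close>

definition wave_osc :: "nat \<Rightarrow> real \<Rightarrow> real ^ 'n::finite \<Rightarrow> real ^ 'n \<Rightarrow> real" where
  "wave_osc N R \<zeta> \<zeta>' =
     (\<Sum>js\<in>{js. length js \<le> N}. norm (mon js \<zeta> - mon js \<zeta>') + norm (mon js \<zeta>) * (R * norm (\<zeta> - \<zeta>')))"

lemma wave_osc_nonneg: "0 \<le> R \<Longrightarrow> 0 \<le> wave_osc N R \<zeta> \<zeta>'"
  unfolding wave_osc_def by (intro sum_nonneg add_nonneg_nonneg mult_nonneg_nonneg) auto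

lemma norm_mon_wave_diff_le:
  assumes "length js \<le> N" "norm y \<le> R" "0 \<le> R"
  shows "norm (mon js \<zeta> * wave \<zeta> y - mon js \<zeta>' * wave \<zeta>' y) \<le> wave_osc N R \<zeta> \<zeta>'"
proof -
  have "mon js \<zeta> * wave \<zeta> y - mon js \<zeta>' * wave \<zeta>' y
      = mon js \<zeta> * (wave \<zeta> y - wave \<zeta>' y) + (mon js \<zeta> - mon js \<zeta>') * wave \<zeta>' y"
    by (simp add: algebra_simps)
  also have "norm \<dots> \<le> norm (mon js \<zeta>) * (R * norm (\<zeta> - \<zeta>')) + norm (mon js \<zeta> - mon js \<zeta>')"
    using order_trans[OF norm_wave_diff_le mult_right_mono[OF assms(2) norm_ge_zero]]
    by (intro norm_triangle_mono) (auto simp: norm_mult intro!: mult_left_mono)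
  also have "\<dots> \<le> wave_osc N R \<zeta> \<zeta>'"
    unfolding wave_osc_def
    using member_le_sum[of js "{js. length js \<le> N}" "\<lambda>js. norm (mon js \<zeta> - mon js \<zeta>') + norm (mon js \<zeta>) * (R * norm (\<zeta> - \<zeta>'))"]
      assms finite_lists_le[of N] by (simp add: add.commute)
  finally show ?thesis .
qed

lemma wave_osc_tendsto:
  assumes "(s \<longlongrightarrow> \<zeta>) F"
  shows "((\<lambda>k. wave_osc N R \<zeta> (s k)) \<longlongrightarrow> 0) F"
proof -
  have "((\<lambda>k. mon js (s k)) \<longlongrightarrow> mon js \<zeta>) F" for js
    using continuous_mon[of UNIV js] assms by (rule continuous_on_tendsto_compose) auto
  then have "((\<lambda>k. norm (mon js \<zeta> - mon js (s k)) + norm (mon js \<zeta>) * (R * norm (\<zeta> - s k))) \<longlongrightarrow>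
      norm (mon js \<zeta> - mon js \<zeta>) + norm (mon js \<zeta>) * (R * norm (\<zeta> - \<zeta>))) F" for js
    by (intro tendsto_intros assms)
  then have "((\<lambda>k. wave_osc N R \<zeta> (s k)) \<longlongrightarrow>
      (\<Sum>js\<in>{js. length js \<le> N}. norm (mon js \<zeta> - mon js \<zeta>) + norm (mon js \<zeta>) * (R * norm (\<zeta> - \<zeta>)))) F"
    unfolding wave_osc_def by (intro tendsto_sum)
  then show ?thesis by simp
qed

text \<open>The bound on \<zeta>' is the one that the approximating simple functions satisfy.
  Polynomial growth in \<zeta> yields a dominating function once multiplied by w.\<close>

lemma wave_osc_le:
  fixes \<zeta> :: "real ^ 'n::finite"
  assumes "norm \<zeta>' \<le> 2 * norm \<zeta>" "0 \<le> R"
  shows "wave_osc N R \<zeta> \<zeta>' \<le> real (card {js :: 'n list. length js \<le> N}) * (2 + 3 * R) * (2 * (1 + norm \<zeta>)) ^ (N + 1)"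
proof -
  let ?b = "2 * (1 + norm \<zeta>)"
  have b: "1 \<le> ?b" using norm_ge_zero[of \<zeta>] by argo
  have "norm (mon js \<zeta> - mon js \<zeta>') + norm (mon js \<zeta>) * (R * norm (\<zeta> - \<zeta>')) \<le> (2 + 3 * R) * ?b ^ (N + 1)"
    if "length js \<le> N" for js
  proof -
    have m: "norm (mon js z) \<le> ?b ^ N" if z: "norm z \<le> 2 * norm \<zeta>" for z :: "real ^ 'n"
    proof -
      have "norm (mon js z) \<le> (1 + norm z) ^ length js" by (rule norm_mon_le)
      also have "\<dots> \<le> ?b ^ length js" using z by (intro power_mono) auto
      also have "\<dots> \<le> ?b ^ N" using b \<open>length js \<le> N\<close> by (intro power_increasing) auto
      finally show ?thesis .
    qed
    have m1: "norm (mon js \<zeta>) \<le> ?b ^ N" and m2: "norm (mon js \<zeta>') \<le> ?b ^ N"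
    by (rule m, simp, rule m, rule assms)
    have d: "norm (\<zeta> - \<zeta>') \<le> 3 * ?b"
      using norm_triangle_ineq4[of \<zeta> \<zeta>'] assms(1) norm_ge_zero[of \<zeta>] by argo
    have "norm (mon js \<zeta> - mon js \<zeta>') \<le> 2 * ?b ^ N" using norm_triangle_ineq4[of "mon js \<zeta>" "mon js \<zeta>'"] m1 m2 by linarith
    also have "\<dots> \<le> 2 * ?b ^ (N + 1)" using power_increasing[of N "N + 1" ?b] b by simp
    finally have 1: "norm (mon js \<zeta> - mon js \<zeta>') \<le> 2 * ?b ^ (N + 1)" .
    have "norm (mon js \<zeta>) * (R * norm (\<zeta> - \<zeta>')) \<le> ?b ^ N * (R * (3 * ?b))"
      using assms(2) d m1 b by (intro mult_mono mult_left_mono mult_nonneg_nonneg) auto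
    then show ?thesis using 1 by (simp add: algebra_simps)
  qed
  then have "wave_osc N R \<zeta> \<zeta>' \<le> real (card {js :: 'n list. length js \<le> N}) * ((2 + 3 * R) * ?b ^ (N + 1))"
    unfolding wave_osc_def by (intro sum_bounded_above) auto
  then show ?thesis by (simp add: mult.assoc)
qed

text \<open>The Fourier transform of \<kappa> u without the detour through \<open>pairing\<close>;
  \<open>dist_fourier_dist_mult\<close> identifies the two.\<close>

definition wave_transform ::
    "((real ^ 'n::finite \<Rightarrow> complex) \<Rightarrow> complex) \<Rightarrow> (real ^ 'n \<Rightarrow> complex) \<Rightarrow> real ^ 'n \<Rightarrow> complex" where
  "wave_transform u \<kappa> \<zeta> = u (\<lambda>x. \<kappa> x * wave \<zeta> x)"

lemma wave_transform_bound:
  fixes u :: "(real ^ 'n::finite \<Rightarrow> complex) \<Rightarrow> complex"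
  assumes "u \<in> distributions \<omega>" "compact K" "K \<subseteq> \<omega>"
  obtains C N where "0 \<le> C"
    and "\<And>\<kappa> A \<zeta>. \<kappa> \<in> test_functions \<omega> \<Longrightarrow> closure {x. \<kappa> x \<noteq> 0} \<subseteq> K \<Longrightarrow> 0 \<le> A \<Longrightarrow>
      (\<And>js x. length js \<le> N \<Longrightarrow> norm (pder js \<kappa> x) \<le> A) \<Longrightarrow>
      norm (wave_transform u \<kappa> \<zeta>) \<le> C * A * (1 + norm \<zeta>) ^ N"
proof -
  obtain C N where C: "0 \<le> C" and CN: "\<And>\<kappa> A V \<delta>. \<kappa> \<in> test_functions \<omega> \<Longrightarrow> closure {x. \<kappa> x \<noteq> 0} \<subseteq> K \<Longrightarrow> 0 \<le> A \<Longrightarrow>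
      (\<And>js x. length js \<le> N \<Longrightarrow> norm (pder js \<kappa> x) \<le> A) \<Longrightarrow> smooth V \<Longrightarrow> 0 \<le> \<delta> \<Longrightarrow>
      (\<And>js y. length js \<le> N \<Longrightarrow> y \<in> K \<Longrightarrow> norm (pder js V y) \<le> \<delta>) \<Longrightarrow>
      norm (u (\<lambda>x. \<kappa> x * V x)) \<le> C * A * \<delta>"
    by (rule distributions_mult_bound[OF assms]) (erule that[rotated])
  show thesis
  proof (rule that[OF C, of N])
    fix \<kappa> A and \<zeta> :: "real ^ 'n"
    assume \<kappa>: "\<kappa> \<in> test_functions \<omega>" "closure {x. \<kappa> x \<noteq> 0} \<subseteq> K" "0 \<le> A"
      "\<And>js x. length js \<le> N \<Longrightarrow> norm (pder js \<kappa> x) \<le> A"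
    have "norm (pder js (wave \<zeta>) y) \<le> (1 + norm \<zeta>) ^ N" if "length js \<le> N" for js y
    proof -
      have "norm (pder js (wave \<zeta>) y) \<le> (1 + norm \<zeta>) ^ length js"
        using norm_mon_le[of js \<zeta>] by (simp add: pder_wave norm_mult)
      also have "\<dots> \<le> (1 + norm \<zeta>) ^ N" using that by (intro power_increasing) auto
      finally show ?thesis .
    qed
    then show "norm (wave_transform u \<kappa> \<zeta>) \<le> C * A * (1 + norm \<zeta>) ^ N"
      unfolding wave_transform_def by (intro CN \<kappa> smooth_wave) auto
  qed
qed

lemma wave_transform_osc_bound:
  fixes u :: "(real ^ 'n::finite \<Rightarrow> complex) \<Rightarrow> complex"
  assumes u: "u \<in> distributions \<omega>" and \<kappa>: "\<kappa> \<in> test_functions \<omega>"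
  obtains C N R where "0 \<le> C" "0 \<le> R"
    "\<And>V \<delta>. smooth V \<Longrightarrow> 0 \<le> \<delta> \<Longrightarrow>
      (\<And>js y. length js \<le> N \<Longrightarrow> norm y \<le> R \<Longrightarrow> norm (pder js V y) \<le> \<delta>) \<Longrightarrow>
      norm (u (\<lambda>x. \<kappa> x * V x)) \<le> C * \<delta>"
proof -
  let ?K = "closure {x. \<kappa> x \<noteq> 0}"
  obtain C N where C: "0 \<le> C" and CN: "\<And>\<kappa>' A V \<delta>. \<kappa>' \<in> test_functions \<omega> \<Longrightarrow> closure {x. \<kappa>' x \<noteq> 0} \<subseteq> ?K \<Longrightarrow> 0 \<le> A \<Longrightarrow>
      (\<And>js x. length js \<le> N \<Longrightarrow> norm (pder js \<kappa>' x) \<le> A) \<Longrightarrow> smooth V \<Longrightarrow> 0 \<le> \<delta> \<Longrightarrow>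
      (\<And>js y. length js \<le> N \<Longrightarrow> y \<in> ?K \<Longrightarrow> norm (pder js V y) \<le> \<delta>) \<Longrightarrow>
      norm (u (\<lambda>x. \<kappa>' x * V x)) \<le> C * A * \<delta>"
    by (rule distributions_mult_bound[OF u test_functionsD(2,3)[OF \<kappa>]]) (erule that[rotated])
  obtain A where A: "0 \<le> A" "\<forall>js x. length js \<le> N \<longrightarrow> norm (pder js \<kappa> x) \<le> A"
    using test_function_bounded[OF \<kappa>, of N] by (elim exE conjE)
  obtain R where R: "0 < R" "\<forall>y\<in>?K. norm y \<le> R"
    using compact_imp_bounded[OF test_functionsD(2)[OF \<kappa>]] unfolding bounded_pos by (elim exE conjE)
  show thesis
  proof (rule that[of "C * A" R N])
    show "norm (u (\<lambda>x. \<kappa> x * V x)) \<le> C * A * \<delta>"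
      if "smooth V" "0 \<le> \<delta>" "\<And>js y. length js \<le> N \<Longrightarrow> norm y \<le> R \<Longrightarrow> norm (pder js V y) \<le> \<delta>" for V \<delta>
      by (rule CN[OF \<kappa> order_refl A(1)]) (use A(2) R(2) that in auto)
  qed (use C A R in auto)
qed

text \<open>Waves of nearby frequencies are close, together with their derivatives, on the support
  of \<kappa>. Continuity provides measurability of the transform and the pointwise limit in the
  interchange theorem.\<close>

lemma continuous_wave_transform:
  fixes u :: "(real ^ 'n::finite \<Rightarrow> complex) \<Rightarrow> complex"
  assumes u: "u \<in> distributions \<omega>" and \<kappa>: "\<kappa> \<in> test_functions \<omega>"
  shows "continuous_on UNIV (wave_transform u \<kappa>)"
proof -
  obtain C N R where CR: "0 \<le> C" "0 \<le> R"
    "\<And>V \<delta>. smooth V \<Longrightarrow> 0 \<le> \<delta> \<Longrightarrow>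
      (\<And>js y. length js \<le> N \<Longrightarrow> norm y \<le> R \<Longrightarrow> norm (pder js V y) \<le> \<delta>) \<Longrightarrow>
      norm (u (\<lambda>x. \<kappa> x * V x)) \<le> C * \<delta>"
    by (rule wave_transform_osc_bound[OF u \<kappa>]) (erule that[rotated -1])
  have le: "norm (wave_transform u \<kappa> \<zeta> - wave_transform u \<kappa> \<zeta>') \<le> C * wave_osc N R \<zeta> \<zeta>'" for \<zeta> \<zeta>'
  proof -
    have "wave_transform u \<kappa> \<zeta> - wave_transform u \<kappa> \<zeta>' = u (\<lambda>x. \<kappa> x * (wave \<zeta> x - wave \<zeta>' x))"
      unfolding wave_transform_def right_diff_distrib
      by (rule distributions_diff[OF u, symmetric]) (intro test_functions_mult \<kappa> smooth_wave)+
    also have "norm \<dots> \<le> C * wave_osc N R \<zeta> \<zeta>'"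
    proof (rule CR(3))
      show "smooth (\<lambda>x. wave \<zeta> x - wave \<zeta>' x)" by (intro smooth_diff smooth_wave)
      show "0 \<le> wave_osc N R \<zeta> \<zeta>'" using CR(2) by (rule wave_osc_nonneg)
      show "norm (pder js (\<lambda>x. wave \<zeta> x - wave \<zeta>' x) y) \<le> wave_osc N R \<zeta> \<zeta>'"
        if "length js \<le> N" "norm y \<le> R" for js y
        unfolding pder_diff[OF smooth_wave smooth_wave] pder_wave
        using that CR(2) by (rule norm_mon_wave_diff_le)
    qed
    finally show ?thesis .
  qed
  show ?thesis
    unfolding continuous_on_def
  proof
    fix \<zeta> :: "real ^ 'n"
    have "((\<lambda>\<zeta>'. C * wave_osc N R \<zeta> \<zeta>') \<longlongrightarrow> C * 0) (at \<zeta>)"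
      by (intro tendsto_mult tendsto_const wave_osc_tendsto tendsto_ident_at)
    then have lim: "((\<lambda>\<zeta>'. C * wave_osc N R \<zeta> \<zeta>') \<longlongrightarrow> 0) (at \<zeta>)" by simp
    have "((\<lambda>\<zeta>'. wave_transform u \<kappa> \<zeta> - wave_transform u \<kappa> \<zeta>') \<longlongrightarrow> 0) (at \<zeta>)"
      by (rule Lim_null_comparison[OF always_eventually lim]) (intro allI le)
    from tendsto_minus[OF this]
    have "((\<lambda>\<zeta>'. wave_transform u \<kappa> \<zeta>' - wave_transform u \<kappa> \<zeta>) \<longlongrightarrow> 0) (at \<zeta>)" by simp
    then show "(wave_transform u \<kappa> \<longlongrightarrow> wave_transform u \<kappa> \<zeta>) (at \<zeta> within UNIV)"
      by (rule LIM_zero_cancel)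
  qed
qed

lemma wave_transform_polynomially_bounded:
  fixes u :: "(real ^ 'n::finite \<Rightarrow> complex) \<Rightarrow> complex"
  assumes u: "u \<in> distributions \<omega>" and \<kappa>: "\<kappa> \<in> test_functions \<omega>"
  shows "polynomially_bounded (wave_transform u \<kappa>)"
proof -
  let ?K = "closure {x. \<kappa> x \<noteq> 0}"
  obtain C N where C: "0 \<le> C" and CN: "\<And>\<kappa>' A \<zeta>. \<kappa>' \<in> test_functions \<omega> \<Longrightarrow> closure {x. \<kappa>' x \<noteq> 0} \<subseteq> ?K \<Longrightarrow> 0 \<le> A \<Longrightarrow>
      (\<And>js x. length js \<le> N \<Longrightarrow> norm (pder js \<kappa>' x) \<le> A) \<Longrightarrow>
      norm (wave_transform u \<kappa>' \<zeta>) \<le> C * A * (1 + norm \<zeta>) ^ N"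
    by (rule wave_transform_bound[OF u test_functionsD(2,3)[OF \<kappa>]]) (erule that[rotated])
  obtain A where A: "0 \<le> A" "\<forall>js x. length js \<le> N \<longrightarrow> norm (pder js \<kappa> x) \<le> A"
    using test_function_bounded[OF \<kappa>, of N] by (elim exE conjE)
  have "norm (wave_transform u \<kappa> \<zeta>) \<le> C * A * (1 + norm \<zeta>) ^ N" for \<zeta>
    by (rule CN[OF \<kappa> order_refl A(1)]) (use A(2) in auto)
  moreover have "wave_transform u \<kappa> \<in> borel_measurable borel"
    by (rule borel_measurable_continuous_onI[OF continuous_wave_transform[OF u \<kappa>]])
  ultimately show ?thesis unfolding polynomially_bounded_def by (intro conjI exI allI)
qed

text \<open>The Fourier integral is approximated by integrals over simple functions, that is, by finite
  linear combinations of waves, to which linearity applies.\<close>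

theorem distribution_fourier_interchange:
  fixes u :: "(real ^ 'n::finite \<Rightarrow> complex) \<Rightarrow> complex"
  assumes u: "u \<in> distributions \<omega>" and \<kappa>: "\<kappa> \<in> test_functions \<omega>" and w: "rapidly_decreasing w"
  shows "u (\<lambda>x. \<kappa> x * fourier w x) = (LINT \<zeta>|lborel. w \<zeta> * wave_transform u \<kappa> \<zeta>)"
proof -
  let ?T = "wave_transform u \<kappa>"
  obtain C N R where CR: "0 \<le> C" "0 \<le> R"
    "\<And>V \<delta>. smooth V \<Longrightarrow> 0 \<le> \<delta> \<Longrightarrow>
      (\<And>js y. length js \<le> N \<Longrightarrow> norm y \<le> R \<Longrightarrow> norm (pder js V y) \<le> \<delta>) \<Longrightarrow>
      norm (u (\<lambda>x. \<kappa> x * V x)) \<le> C * \<delta>"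
    by (rule wave_transform_osc_bound[OF u \<kappa>]) (erule that[rotated -1])
  have iw: "integrable lborel w" using w by (rule rapidly_decreasing_integrable)
  have wm [measurable]: "w \<in> borel_measurable borel" using w by (rule rapidly_decreasing_measurable)
  have Tm [measurable]: "?T \<in> borel_measurable borel"
    by (rule borel_measurable_continuous_onI[OF continuous_wave_transform[OF u \<kappa>]])
  have "(\<lambda>x :: real ^ 'n. x) \<in> borel_measurable borel" by simp
  from borel_measurable_implies_sequence_metric[OF this, of 0]
  obtain s :: "nat \<Rightarrow> real ^ 'n \<Rightarrow> real ^ 'n" where sf: "\<And>k. simple_function borel (s k)"
    and lim: "\<And>x. (\<lambda>k. s k x) \<longlonglongrightarrow> x" and sb: "\<And>k x. norm (s k x) \<le> 2 * norm x"
    by (auto simp: dist_norm)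
  have sm [measurable]: "s k \<in> borel_measurable borel" for k
    using sf by (rule borel_measurable_simple_function)
  let ?D = "\<lambda>k \<zeta>. wave_osc N R \<zeta> (s k \<zeta>)"
  define M where "M = real (card {js :: 'n list. length js \<le> N}) * (2 + 3 * R)"
  have Dle: "?D k \<zeta> \<le> M * (2 * (1 + norm \<zeta>)) ^ (N + 1)" for k \<zeta>
    unfolding M_def by (rule wave_osc_le[OF sb CR(2)])
  have D0: "0 \<le> ?D k \<zeta>" for k \<zeta> using CR(2) by (rule wave_osc_nonneg)
  have Dm [measurable]: "?D k \<in> borel_measurable borel" for k
    unfolding wave_osc_def by measurable
  have dom: "integrable lborel (\<lambda>\<zeta>. norm (of_real (M * (2 * (1 + norm \<zeta>)) ^ (N + 1)) * w \<zeta>))"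
  proof (intro integrable_norm rapidly_decreasing_integrable rapidly_decreasing_mult w)
    show "polynomially_bounded (\<lambda>\<zeta> :: real ^ 'n. of_real (M * (2 * (1 + norm \<zeta>)) ^ (N + 1)))"
      unfolding polynomially_bounded_def
    proof (intro conjI exI allI)
      show "(\<lambda>\<zeta> :: real ^ 'n. complex_of_real (M * (2 * (1 + norm \<zeta>)) ^ (N + 1))) \<in> borel_measurable borel"
        by measurable
      show "norm (complex_of_real (M * (2 * (1 + norm \<zeta>)) ^ (N + 1))) \<le> (\<bar>M\<bar> * 2 ^ (N + 1)) * (1 + norm \<zeta>) ^ (N + 1)"
        for \<zeta> :: "real ^ 'n"
        unfolding norm_of_real abs_mult power_mult_distrib by simp
    qed
  qed
  have wD_le: "norm (norm (w \<zeta>) * ?D k \<zeta>) \<le> norm (of_real (M * (2 * (1 + norm \<zeta>)) ^ (N + 1)) * w \<zeta>)" for k \<zeta>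
  proof -
    have "norm (norm (w \<zeta>) * ?D k \<zeta>) = norm (w \<zeta>) * ?D k \<zeta>" using D0 by simp
    also have "\<dots> \<le> norm (w \<zeta>) * \<bar>M * (2 * (1 + norm \<zeta>)) ^ (N + 1)\<bar>"
      by (rule mult_left_mono[OF order_trans[OF Dle abs_ge_self] norm_ge_zero])
    also have "\<dots> = norm (of_real (M * (2 * (1 + norm \<zeta>)) ^ (N + 1)) * w \<zeta>)"
      by (simp only: norm_mult norm_of_real mult.commute)
    finally show ?thesis .
  qed
  have iwD: "integrable lborel (\<lambda>\<zeta>. norm (w \<zeta>) * ?D k \<zeta>)" for k
  proof (rule Bochner_Integration.integrable_bound[OF dom])
    show "(\<lambda>\<zeta>. norm (w \<zeta>) * ?D k \<zeta>) \<in> borel_measurable lborel" by measurable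
  qed (rule AE_I2, rule order_trans[OF wD_le], simp)
  \<comment> \<open>Bounds, on the ball of radius R, all derivatives up to order N of the difference
    between \<open>fourier w\<close> and its k-th approximation.\<close>
  define \<delta> where "\<delta> k = (LINT \<zeta>|lborel. norm (w \<zeta>) * ?D k \<zeta>)" for k
  have \<delta>0: "0 \<le> \<delta> k" for k
    unfolding \<delta>_def using D0 by (intro Bochner_Integration.integral_nonneg mult_nonneg_nonneg norm_ge_zero)
  have "\<delta> \<longlonglongrightarrow> (LINT \<zeta> :: real ^ 'n|lborel. 0)"
    unfolding \<delta>_def
  proof (rule integral_dominated_convergence[OF _ _ dom])
    show "AE \<zeta> in lborel. (\<lambda>k. norm (w \<zeta>) * ?D k \<zeta>) \<longlonglongrightarrow> 0"
    proof (rule AE_I2)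
      fix \<zeta>
      have "(\<lambda>k. norm (w \<zeta>) * ?D k \<zeta>) \<longlonglongrightarrow> norm (w \<zeta>) * 0"
        by (intro tendsto_mult tendsto_const wave_osc_tendsto lim)
      then show "(\<lambda>k. norm (w \<zeta>) * ?D k \<zeta>) \<longlonglongrightarrow> 0" by simp
    qed
    show "AE \<zeta> in lborel. norm (norm (w \<zeta>) * ?D k \<zeta>) \<le> norm (of_real (M * (2 * (1 + norm \<zeta>)) ^ (N + 1)) * w \<zeta>)" for k
      by (rule AE_I2) (rule wD_le)
  qed measurable
  then have \<delta>lim: "(\<lambda>k. C * \<delta> k) \<longlonglongrightarrow> 0" using tendsto_mult_right_zero by simp
  define c where "c k a = (LINT \<zeta>|lborel. w \<zeta> * indicator (s k -` {a}) \<zeta>)" for k a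
  have fin: "finite (range (s k))" for k using simple_functionD(1)[OF sf] by simp
  \<comment> \<open>The Fourier integral with the frequency replaced by s k, hence a finite sum of
    waves.\<close>
  define F where "F k = (\<lambda>y. \<Sum>a\<in>range (s k). c k a * wave a y)" for k
  have smF: "smooth (F k)" for k
    unfolding F_def by (intro smooth_sum fin smooth_mult smooth_const smooth_wave)
  have pF: "pder js (F k) y = (LINT \<zeta>|lborel. w \<zeta> * (mon js (s k \<zeta>) * wave (s k \<zeta>) y))" for js k y
  proof -
    have "pder js (F k) = (\<lambda>y. \<Sum>a\<in>range (s k). pder js (\<lambda>y. c k a * wave a y) y)"
      unfolding F_def by (rule pder_sum[OF fin]) (intro smooth_mult smooth_const smooth_wave)
    then have "pder js (F k) y = (\<Sum>a\<in>range (s k). c k a * (mon js a * wave a y))"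
      by (simp only: pder_cmult[OF smooth_wave] pder_wave)
    then show ?thesis
      unfolding c_def by (simp only: integral_simple_compose(2)[OF sf iw, of "\<lambda>a. mon js a * wave a y"])
  qed
  have uF: "u (\<lambda>x. \<kappa> x * F k x) = (LINT \<zeta>|lborel. w \<zeta> * ?T (s k \<zeta>))" for k
    unfolding F_def distributions_wave_sum[OF u \<kappa> fin] integral_simple_compose(2)[OF sf iw]
    by (simp only: c_def wave_transform_def)
  have diff: "norm (u (\<lambda>x. \<kappa> x * fourier w x) - (LINT \<zeta>|lborel. w \<zeta> * ?T (s k \<zeta>))) \<le> C * \<delta> k" for k
  proof -
    have "u (\<lambda>x. \<kappa> x * fourier w x) - (LINT \<zeta>|lborel. w \<zeta> * ?T (s k \<zeta>)) = u (\<lambda>x. \<kappa> x * (fourier w x - F k x))"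
      unfolding uF[symmetric] right_diff_distrib
      by (rule distributions_diff[OF u, symmetric]) (intro test_functions_mult \<kappa> smooth_fourier[OF w] smF)+
    also have "norm \<dots> \<le> C * \<delta> k"
    proof (rule CR(3)[OF _ \<delta>0])
      show "smooth (\<lambda>x. fourier w x - F k x)" by (intro smooth_diff smooth_fourier[OF w] smF)
      fix js :: "'n list" and y :: "real ^ 'n" assume js: "length js \<le> N" and y: "norm y \<le> R"
      have i1: "integrable lborel (\<lambda>\<zeta>. w \<zeta> * (mon js \<zeta> * wave \<zeta> y))"
      proof -
        have "integrable lborel (\<lambda>\<zeta>. wave y \<zeta> * (mon js \<zeta> * w \<zeta>))"
          by (intro wave_integrable_mult rapidly_decreasing_integrable rapidly_decreasing_mult
              polynomially_bounded_mon w)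
        then show ?thesis by (simp only: wave_commute[of y] mult_ac)
      qed
      have i2: "integrable lborel (\<lambda>\<zeta>. w \<zeta> * (mon js (s k \<zeta>) * wave (s k \<zeta>) y))"
        by (rule integral_simple_compose(1)[OF sf iw])
      have "pder js (fourier w) y = (LINT \<zeta>|lborel. w \<zeta> * (mon js \<zeta> * wave \<zeta> y))"
        unfolding pder_fourier[OF w] fourier_eq by (simp only: wave_commute[of y] mult_ac)
      then have "pder js (\<lambda>x. fourier w x - F k x) y
          = (LINT \<zeta>|lborel. w \<zeta> * (mon js \<zeta> * wave \<zeta> y) - w \<zeta> * (mon js (s k \<zeta>) * wave (s k \<zeta>) y))"
        by (simp only: pder_diff[OF smooth_fourier[OF w] smF] pF Bochner_Integration.integral_diff[OF i1 i2])
      also have "norm \<dots> \<le> \<delta> k"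
        unfolding \<delta>_def
      proof (rule Bochner_Integration.integral_norm_bound_integral[OF Bochner_Integration.integrable_diff[OF i1 i2] iwD])
        fix \<zeta>
        have "norm (w \<zeta> * (mon js \<zeta> * wave \<zeta> y) - w \<zeta> * (mon js (s k \<zeta>) * wave (s k \<zeta>) y))
            = norm (w \<zeta>) * norm (mon js \<zeta> * wave \<zeta> y - mon js (s k \<zeta>) * wave (s k \<zeta>) y)"
          by (simp only: norm_mult[symmetric] right_diff_distrib)
        also have "\<dots> \<le> norm (w \<zeta>) * ?D k \<zeta>"
          by (intro mult_left_mono norm_mon_wave_diff_le js y CR(2) norm_ge_zero)
        finally show "norm (w \<zeta> * (mon js \<zeta> * wave \<zeta> y) - w \<zeta> * (mon js (s k \<zeta>) * wave (s k \<zeta>) y))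
            \<le> norm (w \<zeta>) * ?D k \<zeta>" .
      qed
      finally show "norm (pder js (\<lambda>x. fourier w x - F k x) y) \<le> \<delta> k" .
    qed
    finally show ?thesis .
  qed
  have "(\<lambda>k. u (\<lambda>x. \<kappa> x * fourier w x) - (LINT \<zeta>|lborel. w \<zeta> * ?T (s k \<zeta>))) \<longlonglongrightarrow> 0"
    by (rule Lim_null_comparison[OF _ \<delta>lim]) (use diff in simp)
  then have 1: "(\<lambda>k. LINT \<zeta>|lborel. w \<zeta> * ?T (s k \<zeta>)) \<longlonglongrightarrow> u (\<lambda>x. \<kappa> x * fourier w x)"
    using tendsto_diff[OF tendsto_const[of "u (\<lambda>x. \<kappa> x * fourier w x)"]] by fastforce
  obtain B m where B: "\<And>\<zeta>. norm (?T \<zeta>) \<le> B * (1 + norm \<zeta>) ^ m"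
    using wave_transform_polynomially_bounded[OF u \<kappa>] unfolding polynomially_bounded_def by (elim conjE exE) blast
  \<comment> \<open>The same integrals also converge directly, because the transform is continuous
    and grows polynomially; comparing the two limits gives the theorem.\<close>
  have 2: "(\<lambda>k. LINT \<zeta>|lborel. w \<zeta> * ?T (s k \<zeta>)) \<longlonglongrightarrow> (LINT \<zeta>|lborel. w \<zeta> * ?T \<zeta>)"
  proof (rule integral_dominated_convergence)
    let ?p = "\<lambda>\<zeta> :: real ^ 'n. complex_of_real (\<bar>B\<bar> * (2 * (1 + norm \<zeta>)) ^ m)"
    have "polynomially_bounded ?p"
      unfolding polynomially_bounded_def
    proof (intro conjI exI allI)
      show "?p \<in> borel_measurable borel" by measurable
      show "norm (?p \<zeta>) \<le> (\<bar>B\<bar> * 2 ^ m) * (1 + norm \<zeta>) ^ m" for \<zeta>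
        unfolding norm_of_real abs_mult power_mult_distrib by simp
    qed
    then show "integrable lborel (\<lambda>\<zeta>. norm (?p \<zeta> * w \<zeta>))"
      by (intro integrable_norm rapidly_decreasing_integrable rapidly_decreasing_mult w)
    show "AE \<zeta> in lborel. (\<lambda>k. w \<zeta> * ?T (s k \<zeta>)) \<longlonglongrightarrow> w \<zeta> * ?T \<zeta>"
      by (intro AE_I2 tendsto_mult tendsto_const
          continuous_on_tendsto_compose[OF continuous_wave_transform[OF u \<kappa>] lim]) auto
    show "AE \<zeta> in lborel. norm (w \<zeta> * ?T (s k \<zeta>)) \<le> norm (?p \<zeta> * w \<zeta>)" for k
    proof (rule AE_I2)
      fix \<zeta>
      have "norm (?T (s k \<zeta>)) \<le> \<bar>B\<bar> * (1 + norm (s k \<zeta>)) ^ m"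
        using B[of "s k \<zeta>"] by (rule order_trans) (intro mult_right_mono, auto)
      also have "\<dots> \<le> \<bar>B\<bar> * (2 * (1 + norm \<zeta>)) ^ m"
        using sb[of k \<zeta>] by (intro mult_left_mono power_mono) auto
      also have "\<dots> = norm (?p \<zeta>)"
        unfolding norm_of_real by (rule abs_of_nonneg[symmetric]) (intro mult_nonneg_nonneg zero_le_power, auto)
      finally show "norm (w \<zeta> * ?T (s k \<zeta>)) \<le> norm (?p \<zeta> * w \<zeta>)"
        unfolding norm_mult mult.commute[of "norm (w \<zeta>)"] by (rule mult_right_mono) simp
    qed
  qed measurable
  from 1 2 show ?thesis by (rule LIMSEQ_unique)
qed

section \<open>Convolutions and products on the Fourier side\<close>

lemma fourier_reflect:
  fixes w :: "real ^ 'n::finite \<Rightarrow> complex"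
  assumes "w \<in> borel_measurable borel"
  shows "fourier w (- x) = fourier (\<lambda>\<zeta>. w (- \<zeta>)) x"
proof -
  have "(LINT \<zeta>|lborel. wave (- x) \<zeta> * w \<zeta>) = of_real (\<bar>-1\<bar> ^ CARD('n)) *
      (LINT \<zeta>|lborel. wave (- x) (0 + (-1) *\<^sub>R \<zeta>) * w (0 + (-1) *\<^sub>R \<zeta>))"
    by (rule integral_affine) (use assms in measurable)
  then show ?thesis by (simp add: fourier_eq wave_uminus)
qed

lemma integral_reflect:
  fixes g :: "real ^ 'n::finite \<Rightarrow> complex"
  assumes "g \<in> borel_measurable borel"
  shows "(LINT \<zeta>|lborel. g (- \<zeta>)) = (LINT \<zeta>|lborel. g \<zeta>)"
  using fourier_reflect[OF assms, of 0] by (simp add: fourier_eq)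

lemma rapidly_decreasing_reflect:
  "rapidly_decreasing w \<Longrightarrow> rapidly_decreasing (\<lambda>\<zeta>. w (- \<zeta>))"
  unfolding rapidly_decreasing_def
  by (auto intro: measurable_compose[of uminus]) (metis norm_minus_cancel)

text \<open>The factor (2 pi)^(-d) of the inversion formula.\<close>

abbreviation inv_const :: "'n::finite itself \<Rightarrow> complex" where
  "inv_const x \<equiv> inverse ((fourier_const x)\<^sup>2)"

lemma decreasing_eq_fourier:
  fixes \<psi> :: "real ^ 'n::finite \<Rightarrow> complex"
  assumes "decreasing \<psi>"
  shows "\<psi> y = inv_const TYPE('n) * fourier (fourier \<psi>) (- y)"
  unfolding decreasing_fourier_inversion[OF assms]
  by (simp add: fourier_const_nonzero)

lemma distributions_fourier_cmult:
  assumes "u \<in> distributions \<omega>" "\<kappa> \<in> test_functions \<omega>" "rapidly_decreasing w"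
  shows "u (\<lambda>x. \<kappa> x * (c * fourier w x)) = c * (LINT \<zeta>|lborel. w \<zeta> * wave_transform u \<kappa> \<zeta>)"
proof -
  have "(\<lambda>x. \<kappa> x * fourier w x) \<in> test_functions \<omega>"
    by (intro test_functions_mult assms smooth_fourier)
  from distributions_cmult[OF assms(1) this, of c]
  show ?thesis by (simp only: distribution_fourier_interchange[OF assms] mult.left_commute)
qed

text \<open>By inversion \<theta> (x - y) is a Fourier integral in y whose density contains x in a
  wave only. Moving u inside leaves the transform of \<theta> times that of \<kappa> u; a final
  reflection turns the argument -x into x.\<close>

lemma convolution_eq_fourier:
  fixes u :: "(real ^ 'n::finite \<Rightarrow> complex) \<Rightarrow> complex"
  assumes u: "u \<in> distributions \<omega>" and \<kappa>: "\<kappa> \<in> test_functions \<omega>" and \<theta>: "decreasing \<theta>"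
  shows "u (\<lambda>y. \<kappa> y * \<theta> (x - y))
    = inv_const TYPE('n) * fourier (\<lambda>\<zeta>. fourier \<theta> (- \<zeta>) * wave_transform u \<kappa> (- \<zeta>)) x"
proof -
  let ?c = "inv_const TYPE('n)"
  let ?w = "\<lambda>\<zeta>. wave (- x) \<zeta> * fourier \<theta> \<zeta>"
  have r: "rapidly_decreasing (fourier \<theta>)" using \<theta> by (rule rapidly_decreasing_fourier)
  have rw: "rapidly_decreasing ?w"
    by (intro rapidly_decreasing_mult r polynomially_bounded_bounded[of _ 1]) auto
  have m: "(\<lambda>\<zeta>. fourier \<theta> \<zeta> * wave_transform u \<kappa> \<zeta>) \<in> borel_measurable borel"
    using rapidly_decreasing_measurable[OF r] wave_transform_polynomially_bounded[OF u \<kappa>]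
    by (auto simp: polynomially_bounded_def)
  have "\<theta> (x - y) = ?c * fourier ?w y" for y
  proof -
    have "wave (- (x - y)) \<zeta> = wave y \<zeta> * wave (- x) \<zeta>" for \<zeta>
      using wave_add[of \<zeta> y "- x"] by (simp add: wave_commute[of _ \<zeta>])
    then have "fourier (fourier \<theta>) (- (x - y)) = fourier ?w y"
      by (simp only: fourier_eq[of "fourier \<theta>"] fourier_eq[of ?w] mult.assoc)
    then show ?thesis using decreasing_eq_fourier[OF \<theta>, of "x - y"] by (simp only:)
  qed
  then have "u (\<lambda>y. \<kappa> y * \<theta> (x - y)) = ?c * (LINT \<zeta>|lborel. ?w \<zeta> * wave_transform u \<kappa> \<zeta>)"
    by (simp only: distributions_fourier_cmult[OF u \<kappa> rw])
  also have "(LINT \<zeta>|lborel. ?w \<zeta> * wave_transform u \<kappa> \<zeta>)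
      = fourier (\<lambda>\<zeta>. fourier \<theta> \<zeta> * wave_transform u \<kappa> \<zeta>) (- x)"
    by (simp only: fourier_eq[of "\<lambda>\<zeta>. fourier \<theta> \<zeta> * wave_transform u \<kappa> \<zeta>"] mult.assoc)
  finally show ?thesis unfolding fourier_reflect[OF m] .
qed

lemma rapidly_decreasing_convolution:
  fixes u :: "(real ^ 'n::finite \<Rightarrow> complex) \<Rightarrow> complex"
  assumes "u \<in> distributions \<omega>" "\<kappa> \<in> test_functions \<omega>" "rapidly_decreasing w"
  shows "rapidly_decreasing (\<lambda>\<zeta>. w (- \<zeta>) * wave_transform u \<kappa> (- \<zeta>))"
proof -
  have "rapidly_decreasing (\<lambda>\<zeta>. wave_transform u \<kappa> \<zeta> * w \<zeta>)"
    by (intro rapidly_decreasing_mult wave_transform_polynomially_bounded[OF assms(1,2)] assms(3))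
  from rapidly_decreasing_reflect[OF this] show ?thesis by (simp only: mult.commute)
qed

lemma fourier_mult_wave: "fourier (\<lambda>x. \<kappa> x * wave \<xi> x) \<zeta> = fourier \<kappa> (\<xi> + \<zeta>)"
proof -
  have "wave \<zeta> x * wave \<xi> x = wave (\<xi> + \<zeta>) x" for x
    using wave_add[of x \<xi> \<zeta>] by (simp add: wave_commute[of x] mult.commute)
  then have "wave \<zeta> x * (\<kappa> x * wave \<xi> x) = wave (\<xi> + \<zeta>) x * \<kappa> x" for x
    by (metis mult.assoc mult.commute)
  then show ?thesis by (simp only: fourier_eq)
qed

text \<open>The transform of a product as a convolution: \<kappa> times a wave is written as a
  Fourier integral, and u, localised by \<rho>, is moved inside.\<close>

lemma wave_transform_mult:
  fixes u :: "(real ^ 'n::finite \<Rightarrow> complex) \<Rightarrow> complex"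
  assumes u: "u \<in> distributions \<omega>" and \<rho>: "\<rho> \<in> test_functions \<omega>" and \<kappa>: "\<kappa> \<in> test_functions \<omega>"
  shows "u (\<lambda>y. \<rho> y * (\<kappa> y * wave \<xi> y))
    = inv_const TYPE('n) * (LINT \<zeta>|lborel. wave_transform u \<rho> (- \<zeta>) * fourier \<kappa> (\<xi> + \<zeta>))"
proof -
  let ?c = "inv_const TYPE('n)"
  let ?\<psi> = "\<lambda>y. \<kappa> y * wave \<xi> y"
  let ?w = "\<lambda>\<zeta>. fourier ?\<psi> (- \<zeta>)"
  have d: "decreasing ?\<psi>"
    by (rule test_function_decreasing) (rule test_functions_mult[OF \<kappa> smooth_wave])
  have r: "rapidly_decreasing (fourier ?\<psi>)" using d by (rule rapidly_decreasing_fourier)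
  have eq: "?\<psi> y = ?c * fourier ?w y" for y
    using decreasing_eq_fourier[OF d, of y]
    unfolding fourier_reflect[OF rapidly_decreasing_measurable[OF r]] .
  have "(\<lambda>y. \<rho> y * ?\<psi> y) = (\<lambda>y. \<rho> y * (?c * fourier ?w y))"
    by (rule ext) (rule arg_cong[OF eq])
  then have "u (\<lambda>y. \<rho> y * ?\<psi> y) = u (\<lambda>y. \<rho> y * (?c * fourier ?w y))" by (rule arg_cong)
  also have "\<dots> = ?c * (LINT \<zeta>|lborel. ?w \<zeta> * wave_transform u \<rho> \<zeta>)"
    by (rule distributions_fourier_cmult[OF u \<rho> rapidly_decreasing_reflect[OF r]])
  also have "(LINT \<zeta>|lborel. ?w \<zeta> * wave_transform u \<rho> \<zeta>)
      = (LINT \<zeta>|lborel. (\<lambda>\<zeta>. fourier ?\<psi> \<zeta> * wave_transform u \<rho> (- \<zeta>)) (- \<zeta>))" by simp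
  also have "\<dots> = (LINT \<zeta>|lborel. fourier ?\<psi> \<zeta> * wave_transform u \<rho> (- \<zeta>))"
  proof (rule integral_reflect)
    have "wave_transform u \<rho> \<in> borel_measurable borel"
      using wave_transform_polynomially_bounded[OF u \<rho>] by (simp add: polynomially_bounded_def)
    then have "(\<lambda>\<zeta>. wave_transform u \<rho> (- \<zeta>)) \<in> borel_measurable borel"
      by (rule measurable_compose[rotated]) simp
    then show "(\<lambda>\<zeta>. fourier ?\<psi> \<zeta> * wave_transform u \<rho> (- \<zeta>)) \<in> borel_measurable borel"
      using rapidly_decreasing_measurable[OF r] by simp
  qed
  finally show ?thesis unfolding fourier_mult_wave by (simp only: mult.commute)
qed

text \<open>Monomials in a single coordinate control the weight (1 + norm x)^k by
  \<open>one_plus_norm_power_le\<close>, so the seminorms with pure monomials and pure derivatives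
  give the claim.\<close>

lemma schwartz_decreasing:
  fixes \<phi> :: "real ^ 'n::finite \<Rightarrow> complex"
  assumes "\<phi> \<in> schwartz"
  shows "decreasing \<phi>"
  unfolding decreasing_def
proof (intro conjI allI)
  show "smooth \<phi>" using assms by (simp add: schwartz_def)
  fix i m k
  let ?D = "pder (replicate m i) \<phi>" and ?d = "real CARD('n)"
  have "\<exists>C. \<forall>x. \<bar>x $ j\<bar> ^ l * norm (?D x) \<le> C" for j l
  proof -
    have "bdd_above (range (\<lambda>x. norm (of_real (mi_power x (mi_single j l)) * mi_deriv (mi_single i m) \<phi> x)))"
      by (rule assms[unfolded schwartz_def mem_Collect_eq, THEN conjunct2, rule_format])
    then show ?thesis
      unfolding mi_power_single mi_deriv_single bdd_above_def by (auto simp: norm_mult norm_power)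
  qed
  then have "\<forall>l j. \<exists>C. \<forall>x. \<bar>x $ j\<bar> ^ l * norm (?D x) \<le> C" by (intro allI)
  then obtain E where E: "\<And>l j x. \<bar>x $ j\<bar> ^ l * norm (?D x) \<le> E l j" by metis
  let ?C = "E k" and ?C' = "E 0"
  note C = E[where l = k] and C' = E[where l = 0]
  let ?M = "\<bar>?C' i\<bar> + (\<Sum>j\<in>UNIV. \<bar>?C j\<bar>)"
  have "norm (?D x) * (1 + norm x) ^ k \<le> (2 * ?d) ^ k * ?M" for x
  proof -
    obtain j where j: "(1 + norm x) ^ k \<le> (2 * ?d * max 1 \<bar>x $ j\<bar>) ^ k"
      using one_plus_norm_power_le[of x k] ..
    have "\<bar>?C j\<bar> \<le> (\<Sum>j\<in>UNIV. \<bar>?C j\<bar>)" by (rule member_le_sum) auto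
    moreover have "0 \<le> (\<Sum>j\<in>UNIV. \<bar>?C j\<bar>)" by (rule sum_nonneg) simp
    ultimately have "max 1 \<bar>x $ j\<bar> ^ k * norm (?D x) \<le> ?M"
      using C[of x j] C'[of x i] by (cases "\<bar>x $ j\<bar> \<le> 1") (auto simp: max_def)
    then have le: "(2 * ?d) ^ k * (max 1 \<bar>x $ j\<bar> ^ k * norm (?D x)) \<le> (2 * ?d) ^ k * ?M"
      by (rule mult_left_mono) simp
    have "norm (?D x) * (1 + norm x) ^ k \<le> norm (?D x) * (2 * ?d * max 1 \<bar>x $ j\<bar>) ^ k"
      using j by (rule mult_left_mono) simp
    also have "\<dots> = (2 * ?d) ^ k * (max 1 \<bar>x $ j\<bar> ^ k * norm (?D x))"
      by (simp only: power_mult_distrib mult_ac)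
    also note le
    finally show ?thesis .
  qed
  then show "\<exists>C. \<forall>x. norm (?D x) * (1 + norm x) ^ k \<le> C" by blast
qed

section \<open>Nets of convolutions\<close>

lemma norm_pder_fourier_le:
  fixes w :: "real ^ 'n::finite \<Rightarrow> complex"
  assumes w: "rapidly_decreasing w"
    and B: "\<And>\<zeta>. norm (w \<zeta>) * (1 + norm \<zeta>) ^ (length js + 2 * CARD('n)) \<le> B"
  shows "norm (pder js (fourier w) x) \<le> B * (LINT x|lborel. wt (x :: real ^ 'n))"
  unfolding pder_fourier[OF w]
proof (rule norm_fourier_le, rule wt_bound_of_power_bound)
  fix \<zeta> :: "real ^ 'n"
  have "norm (mon js \<zeta> * w \<zeta>) * (1 + norm \<zeta>) ^ (2 * CARD('n))
      \<le> ((1 + norm \<zeta>) ^ length js * norm (w \<zeta>)) * (1 + norm \<zeta>) ^ (2 * CARD('n))"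
    unfolding norm_mult by (intro mult_right_mono norm_mon_le) auto
  also have "\<dots> \<le> B" using B[of \<zeta>] by (simp add: power_add mult_ac)
  finally show "norm (mon js \<zeta> * w \<zeta>) * (1 + norm \<zeta>) ^ (2 * CARD('n)) \<le> B" .
qed

lemma sup_mi_deriv_fourier_le:
  fixes w :: "real ^ 'n::finite \<Rightarrow> complex"
  assumes w: "rapidly_decreasing w" and "open \<omega>" and eq: "\<And>x. x \<in> \<omega> \<Longrightarrow> f x = fourier w x"
    and K: "K \<subseteq> \<omega>" "K \<noteq> {}"
    and B: "\<And>\<zeta>. norm (w \<zeta>) * (1 + norm \<zeta>) ^ (mi_abs \<alpha> + 2 * CARD('n)) \<le> B"
  shows "norm (SUP x\<in>K. norm (mi_deriv \<alpha> f x)) \<le> B * (LINT x|lborel. wt (x :: real ^ 'n))"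
proof -
  from mi_deriv_eq_pder[of \<alpha>] obtain js where
    js: "(\<forall>f :: real ^ 'n \<Rightarrow> complex. mi_deriv \<alpha> f = pder js f) \<and> (\<forall>i. count_list js i = \<alpha> $ i) \<and> length js = mi_abs \<alpha>" ..
  let ?B = "B * (LINT x|lborel. wt (x :: real ^ 'n))"
  have le: "norm (mi_deriv \<alpha> f x) \<le> ?B" if "x \<in> K" for x
  proof -
    have "mi_deriv \<alpha> f x = pder js (fourier w) x"
      using js pder_cong_open[OF assms(2), of x f "fourier w" js] that K eq by auto
    also have "norm \<dots> \<le> ?B" by (rule norm_pder_fourier_le[OF w]) (use B js in simp)
    finally show ?thesis .
  qed
  obtain x where x: "x \<in> K" using K by blast
  have "norm (mi_deriv \<alpha> f x) \<le> (SUP x\<in>K. norm (mi_deriv \<alpha> f x))"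
    using le by (intro cSUP_upper x bdd_aboveI[of _ ?B]) auto
  then have "0 \<le> (SUP x\<in>K. norm (mi_deriv \<alpha> f x))" using norm_ge_zero by (rule order_trans[rotated])
  moreover have "(SUP x\<in>K. norm (mi_deriv \<alpha> f x)) \<le> ?B" using K le by (intro cSUP_least) auto
  ultimately show ?thesis by simp
qed

lemma fourier_net_smooth_on:
  assumes "rapidly_decreasing w" "open \<omega>" "\<And>x. x \<in> \<omega> \<Longrightarrow> f x = fourier w x"
  shows "smooth_on \<omega> f"
  by (rule smooth_on_cong_open[OF assms(2) _ smooth_on_subset[OF smooth_fourier[OF assms(1)]]])
    (use assms(3) in auto)

lemma eventually_unit_interval: "\<forall>\<^sub>F \<epsilon> :: real in at_right 0. \<epsilon> \<in> {0<..<1}"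
  by (rule eventually_at_right_real) simp

text \<open>A derivative costs one power of 1 + norm \<zeta> in the density. Weighted bounds of all
  orders on w therefore control all derivatives, uniformly in x.\<close>

lemma fourier_net_moderate:
  fixes w :: "real \<Rightarrow> real ^ 'n::finite \<Rightarrow> complex"
  assumes w: "\<And>\<epsilon>. \<epsilon> \<in> {0<..<1} \<Longrightarrow> rapidly_decreasing (w \<epsilon>)" and \<omega>: "open \<omega>"
    and eq: "\<And>\<epsilon> x. \<epsilon> \<in> {0<..<1} \<Longrightarrow> x \<in> \<omega> \<Longrightarrow> f \<epsilon> x = fourier (w \<epsilon>) x"
    and B: "\<And>k. \<exists>C a. \<forall>\<epsilon>\<in>{0<..<1}. \<forall>\<zeta>. norm (w \<epsilon> \<zeta>) * (1 + norm \<zeta>) ^ k \<le> C * (1 / \<epsilon>) ^ a"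
  shows "f \<in> moderate_nets \<omega>"
  unfolding moderate_nets_def mem_Collect_eq
proof (intro conjI ballI allI impI)
  show "smooth_on \<omega> (f \<epsilon>)" if "\<epsilon> \<in> {0<..<1}" for \<epsilon>
    by (rule fourier_net_smooth_on[OF w \<omega> eq]) (use that in auto)
  fix K and \<alpha> :: "'n multi_index" assume K: "compact K \<and> K \<subseteq> \<omega> \<and> K \<noteq> {}"
  obtain C a where C: "\<forall>\<epsilon>\<in>{0<..<1}. \<forall>\<zeta>. norm (w \<epsilon> \<zeta>) * (1 + norm \<zeta>) ^ (mi_abs \<alpha> + 2 * CARD('n)) \<le> C * (1 / \<epsilon>) ^ a"
    using B by blast
  let ?I = "LINT x|lborel. wt (x :: real ^ 'n)"
  have "(\<lambda>\<epsilon>. SUP x\<in>K. norm (mi_deriv \<alpha> (f \<epsilon>) x)) \<in> O[at_right 0](\<lambda>\<epsilon>. \<epsilon> powr - real a)"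
  proof (rule bigoI[of _ "C * ?I"], rule eventually_mono[OF eventually_unit_interval])
    fix \<epsilon> :: real assume \<epsilon>: "\<epsilon> \<in> {0<..<1}"
    have "norm (SUP x\<in>K. norm (mi_deriv \<alpha> (f \<epsilon>) x)) \<le> (C * (1 / \<epsilon>) ^ a) * ?I"
      by (rule sup_mi_deriv_fourier_le[OF w[OF \<epsilon>] \<omega> eq[OF \<epsilon>]]) (use K C \<epsilon> in auto)
    also have "(1 / \<epsilon>) ^ a = norm (\<epsilon> powr - real a)"
      using \<epsilon> by (simp add: powr_minus powr_realpow power_one_over inverse_eq_divide)
    finally show "norm (SUP x\<in>K. norm (mi_deriv \<alpha> (f \<epsilon>) x)) \<le> C * ?I * norm (\<epsilon> powr - real a)"
      by (simp add: mult_ac)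
  qed
  then show "\<exists>a. (\<lambda>\<epsilon>. SUP x\<in>K. norm (mi_deriv \<alpha> (f \<epsilon>) x)) \<in> O[at_right 0](\<lambda>\<epsilon>. \<epsilon> powr a)" ..
qed

lemma fourier_net_null:
  fixes w :: "real \<Rightarrow> real ^ 'n::finite \<Rightarrow> complex"
  assumes w: "\<And>\<epsilon>. \<epsilon> \<in> {0<..<1} \<Longrightarrow> rapidly_decreasing (w \<epsilon>)" and \<omega>: "open \<omega>"
    and eq: "\<And>\<epsilon> x. \<epsilon> \<in> {0<..<1} \<Longrightarrow> x \<in> \<omega> \<Longrightarrow> f \<epsilon> x = fourier (w \<epsilon>) x"
    and B: "\<And>k N. \<exists>C\<ge>0. \<forall>\<epsilon>\<in>{0<..<1}. \<forall>\<zeta>. norm (w \<epsilon> \<zeta>) * (1 + norm \<zeta>) ^ k \<le> C * \<epsilon> ^ N"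
  shows "f \<in> null_nets \<omega>"
  unfolding null_nets_def mem_Collect_eq
proof (intro conjI ballI allI impI)
  show "smooth_on \<omega> (f \<epsilon>)" if "\<epsilon> \<in> {0<..<1}" for \<epsilon>
    by (rule fourier_net_smooth_on[OF w \<omega> eq]) (use that in auto)
  fix K and \<alpha> :: "'n multi_index" and a :: real assume K: "compact K \<and> K \<subseteq> \<omega> \<and> K \<noteq> {}"
  define N where "N = nat \<lceil>a\<rceil>"
  have N: "a \<le> real N" unfolding N_def by linarith
  obtain C where C0: "0 \<le> C" and C: "\<forall>\<epsilon>\<in>{0<..<1}. \<forall>\<zeta>. norm (w \<epsilon> \<zeta>) * (1 + norm \<zeta>) ^ (mi_abs \<alpha> + 2 * CARD('n)) \<le> C * \<epsilon> ^ N"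
    using B by blast
  let ?I = "LINT x|lborel. wt (x :: real ^ 'n)"
  have I: "0 \<le> ?I" by (rule Bochner_Integration.integral_nonneg) simp
  show "(\<lambda>\<epsilon>. SUP x\<in>K. norm (mi_deriv \<alpha> (f \<epsilon>) x)) \<in> O[at_right 0](\<lambda>\<epsilon>. \<epsilon> powr a)"
  proof (rule bigoI[of _ "C * ?I"], rule eventually_mono[OF eventually_unit_interval])
    fix \<epsilon> :: real assume \<epsilon>: "\<epsilon> \<in> {0<..<1}"
    have "norm (SUP x\<in>K. norm (mi_deriv \<alpha> (f \<epsilon>) x)) \<le> (C * \<epsilon> ^ N) * ?I"
      by (rule sup_mi_deriv_fourier_le[OF w[OF \<epsilon>] \<omega> eq[OF \<epsilon>]]) (use K C \<epsilon> in auto)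
    also have "\<dots> = (C * ?I) * \<epsilon> ^ N" by (simp add: mult_ac)
    also have "\<dots> \<le> (C * ?I) * norm (\<epsilon> powr a)"
    proof (rule mult_left_mono)
      have "\<epsilon> ^ N = \<epsilon> powr real N" using \<epsilon> by (simp add: powr_realpow)
      also have "\<dots> \<le> \<epsilon> powr a" using \<epsilon> N by (intro powr_mono') auto
      finally show "\<epsilon> ^ N \<le> norm (\<epsilon> powr a)" by simp
    qed (use C0 I in simp)
    finally show "norm (SUP x\<in>K. norm (mi_deriv \<alpha> (f \<epsilon>) x)) \<le> C * ?I * norm (\<epsilon> powr a)" .
  qed
qed

text \<open>The polynomial growth of the transform of \<kappa> u costs m powers. B and m precede
  \<Theta>, so they stay fixed when \<Theta> runs through a net.\<close>

lemma convolution_symbol_bound: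
  fixes u :: "(real ^ 'n::finite \<Rightarrow> complex) \<Rightarrow> complex"
  assumes "u \<in> distributions \<omega>" "\<kappa> \<in> test_functions \<omega>"
  shows "\<exists>B m. 0 \<le> B \<and> (\<forall>\<Theta> \<zeta> k. norm (c * (\<Theta> (- \<zeta>) * wave_transform u \<kappa> (- \<zeta>))) * (1 + norm \<zeta>) ^ k
    \<le> B * (norm (\<Theta> (- \<zeta>) :: complex) * (1 + norm (- \<zeta>)) ^ (m + k)))"
proof -
  obtain B m where B: "\<And>\<zeta>. norm (wave_transform u \<kappa> \<zeta>) \<le> B * (1 + norm \<zeta>) ^ m"
    using wave_transform_polynomially_bounded[OF assms] unfolding polynomially_bounded_def by blast
  have "norm (c * (\<Theta> (- \<zeta>) * wave_transform u \<kappa> (- \<zeta>))) * (1 + norm \<zeta>) ^ k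
    \<le> (norm c * \<bar>B\<bar>) * (norm (\<Theta> (- \<zeta>) :: complex) * (1 + norm (- \<zeta>)) ^ (m + k))" for \<Theta> \<zeta> k
  proof -
    have "norm (wave_transform u \<kappa> (- \<zeta>)) \<le> \<bar>B\<bar> * (1 + norm \<zeta>) ^ m"
      using B[of "- \<zeta>"] by (simp, elim order_trans) (intro mult_right_mono, auto)
    then have "norm c * (norm (\<Theta> (- \<zeta>)) * norm (wave_transform u \<kappa> (- \<zeta>))) * (1 + norm \<zeta>) ^ k
        \<le> norm c * (norm (\<Theta> (- \<zeta>)) * (\<bar>B\<bar> * (1 + norm \<zeta>) ^ m)) * (1 + norm \<zeta>) ^ k"
      by (intro mult_right_mono mult_left_mono) auto
    then show ?thesis by (simp add: norm_mult power_add mult_ac)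
  qed
  then show ?thesis by (intro exI[of _ "norm c * \<bar>B\<bar>"] exI[of _ m]) auto
qed

lemma fourier_cmult: "fourier (\<lambda>\<zeta>. c * w \<zeta>) x = c * fourier w x"
  unfolding fourier_eq by (simp only: mult.left_commute integral_mult_right_zero)

lemma convolution_eq_fourier':
  fixes u :: "(real ^ 'n::finite \<Rightarrow> complex) \<Rightarrow> complex"
  assumes "u \<in> distributions \<omega>" "\<kappa> \<in> test_functions \<omega>" "decreasing \<theta>"
  shows "u (\<lambda>y. \<kappa> y * \<theta> (x - y))
    = fourier (\<lambda>\<zeta>. inv_const TYPE('n) * (fourier \<theta> (- \<zeta>) * wave_transform u \<kappa> (- \<zeta>))) x"
  unfolding fourier_cmult by (rule convolution_eq_fourier[OF assms])

lemma rapidly_decreasing_convolution':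
  fixes u :: "(real ^ 'n::finite \<Rightarrow> complex) \<Rightarrow> complex"
  assumes "u \<in> distributions \<omega>" "\<kappa> \<in> test_functions \<omega>" "decreasing \<theta>"
  shows "rapidly_decreasing (\<lambda>\<zeta>. c * (fourier \<theta> (- \<zeta>) * wave_transform u \<kappa> (- \<zeta>)))"
  by (intro rapidly_decreasing_mult polynomially_bounded_bounded[of _ "norm c"]
      rapidly_decreasing_convolution[OF assms(1,2)] rapidly_decreasing_fourier assms(3)) auto

lemma convolution_net_moderate:
  fixes u :: "(real ^ 'n::finite \<Rightarrow> complex) \<Rightarrow> complex"
  assumes u: "u \<in> distributions \<omega>" and \<kappa>: "\<kappa> \<in> test_functions \<omega>" and \<omega>: "open \<omega>"
    and \<theta>: "\<And>\<epsilon>. \<epsilon> \<in> {0<..<1} \<Longrightarrow> decreasing (\<theta> \<epsilon>)"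
    and B: "\<And>k. \<exists>C a. \<forall>\<epsilon>\<in>{0<..<1}. \<forall>\<zeta>. norm (fourier (\<theta> \<epsilon>) \<zeta>) * (1 + norm \<zeta>) ^ k \<le> C * (1 / \<epsilon>) ^ a"
    and eq: "\<And>\<epsilon> x. \<epsilon> \<in> {0<..<1} \<Longrightarrow> x \<in> \<omega> \<Longrightarrow> f \<epsilon> x = u (\<lambda>y. \<kappa> y * \<theta> \<epsilon> (x - y))"
  shows "f \<in> moderate_nets \<omega>"
proof (rule fourier_net_moderate[OF _ \<omega>])
  let ?w = "\<lambda>\<epsilon> \<zeta>. inv_const TYPE('n) * (fourier (\<theta> \<epsilon>) (- \<zeta>) * wave_transform u \<kappa> (- \<zeta>))"
  show "rapidly_decreasing (?w \<epsilon>)" if "\<epsilon> \<in> {0<..<1}" for \<epsilon>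
    by (rule rapidly_decreasing_convolution'[OF u \<kappa> \<theta>[OF that]])
  show "f \<epsilon> x = fourier (?w \<epsilon>) x" if "\<epsilon> \<in> {0<..<1}" "x \<in> \<omega>" for \<epsilon> x
    unfolding eq[OF that] by (rule convolution_eq_fourier'[OF u \<kappa> \<theta>[OF that(1)]])
  fix k
  obtain M m where M: "0 \<le> M" "\<And>\<Theta> \<zeta> k. norm (inv_const TYPE('n) * (\<Theta> (- \<zeta>) * wave_transform u \<kappa> (- \<zeta>))) * (1 + norm \<zeta>) ^ k
    \<le> M * (norm (\<Theta> (- \<zeta>) :: complex) * (1 + norm (- \<zeta>)) ^ (m + k))"
    using convolution_symbol_bound[OF u \<kappa>, of "inv_const TYPE('n)"] by (elim exE conjE) blast
  obtain C a where C: "\<forall>\<epsilon>\<in>{0<..<1}. \<forall>\<zeta>. norm (fourier (\<theta> \<epsilon>) \<zeta>) * (1 + norm \<zeta>) ^ (m + k) \<le> C * (1 / \<epsilon>) ^ a"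
    using B by blast
  have "norm (?w \<epsilon> \<zeta>) * (1 + norm \<zeta>) ^ k \<le> (M * C) * (1 / \<epsilon>) ^ a" if "\<epsilon> \<in> {0<..<1}" for \<epsilon> \<zeta>
    unfolding mult.assoc[of M] by (rule order_trans[OF M(2) mult_left_mono[OF _ M(1)]]) (use C that in blast)
  then show "\<exists>C a. \<forall>\<epsilon>\<in>{0<..<1}. \<forall>\<zeta>. norm (?w \<epsilon> \<zeta>) * (1 + norm \<zeta>) ^ k \<le> C * (1 / \<epsilon>) ^ a"
    by (intro exI ballI allI)
qed

lemma convolution_net_null:
  fixes u :: "(real ^ 'n::finite \<Rightarrow> complex) \<Rightarrow> complex"
  assumes u: "u \<in> distributions \<omega>" and \<kappa>: "\<kappa> \<in> test_functions \<omega>" and \<omega>: "open \<omega>"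
    and \<theta>: "\<And>\<epsilon>. \<epsilon> \<in> {0<..<1} \<Longrightarrow> decreasing (\<theta> \<epsilon>)"
    and B: "\<And>k N. \<exists>C\<ge>0. \<forall>\<epsilon>\<in>{0<..<1}. \<forall>\<zeta>. norm (fourier (\<theta> \<epsilon>) \<zeta>) * (1 + norm \<zeta>) ^ k \<le> C * \<epsilon> ^ N"
    and eq: "\<And>\<epsilon> x. \<epsilon> \<in> {0<..<1} \<Longrightarrow> x \<in> \<omega> \<Longrightarrow> f \<epsilon> x = u (\<lambda>y. \<kappa> y * \<theta> \<epsilon> (x - y))"
  shows "f \<in> null_nets \<omega>"
proof (rule fourier_net_null[OF _ \<omega>])
  let ?w = "\<lambda>\<epsilon> \<zeta>. inv_const TYPE('n) * (fourier (\<theta> \<epsilon>) (- \<zeta>) * wave_transform u \<kappa> (- \<zeta>))"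
  show "rapidly_decreasing (?w \<epsilon>)" if "\<epsilon> \<in> {0<..<1}" for \<epsilon>
    by (rule rapidly_decreasing_convolution'[OF u \<kappa> \<theta>[OF that]])
  show "f \<epsilon> x = fourier (?w \<epsilon>) x" if "\<epsilon> \<in> {0<..<1}" "x \<in> \<omega>" for \<epsilon> x
    unfolding eq[OF that] by (rule convolution_eq_fourier'[OF u \<kappa> \<theta>[OF that(1)]])
  fix k N
  obtain M m where M: "0 \<le> M" "\<And>\<Theta> \<zeta> k. norm (inv_const TYPE('n) * (\<Theta> (- \<zeta>) * wave_transform u \<kappa> (- \<zeta>))) * (1 + norm \<zeta>) ^ k
    \<le> M * (norm (\<Theta> (- \<zeta>) :: complex) * (1 + norm (- \<zeta>)) ^ (m + k))"
    using convolution_symbol_bound[OF u \<kappa>, of "inv_const TYPE('n)"] by (elim exE conjE) blast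
  obtain C where C0: "0 \<le> C" and C: "\<forall>\<epsilon>\<in>{0<..<1}. \<forall>\<zeta>. norm (fourier (\<theta> \<epsilon>) \<zeta>) * (1 + norm \<zeta>) ^ (m + k) \<le> C * \<epsilon> ^ N"
    using B by blast
  have "norm (?w \<epsilon> \<zeta>) * (1 + norm \<zeta>) ^ k \<le> (M * C) * \<epsilon> ^ N" if "\<epsilon> \<in> {0<..<1}" for \<epsilon> \<zeta>
    unfolding mult.assoc[of M] by (rule order_trans[OF M(2) mult_left_mono[OF _ M(1)]]) (use C that in blast)
  then show "\<exists>C\<ge>0. \<forall>\<epsilon>\<in>{0<..<1}. \<forall>\<zeta>. norm (?w \<epsilon> \<zeta>) * (1 + norm \<zeta>) ^ k \<le> C * \<epsilon> ^ N"
    using mult_nonneg_nonneg[OF M(1) C0] by (intro exI[of _ "M * C"] conjI ballI allI)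
qed

section \<open>Mollifiers and their tails\<close>

lemma smooth_mollifier: "smooth \<phi> \<Longrightarrow> smooth (mollifier \<phi> \<epsilon>)"
  unfolding mollifier_def[abs_def]
  using smooth_mult[OF smooth_const smooth_affine[of \<phi> "inverse \<epsilon>" 0]] by simp

lemma pder_mollifier:
  fixes \<phi> :: "real ^ 'n::finite \<Rightarrow> complex"
  assumes "smooth \<phi>"
  shows "pder js (mollifier \<phi> \<epsilon>) x = of_real ((1 / \<epsilon>) ^ (CARD('n) + length js)) * pder js \<phi> (x /\<^sub>R \<epsilon>)"
proof -
  have "pder js (\<lambda>x. of_real ((1 / \<epsilon>) ^ CARD('n)) * \<phi> (inverse \<epsilon> *\<^sub>R x + 0))
      = (\<lambda>x. of_real ((1 / \<epsilon>) ^ CARD('n)) * (of_real (inverse \<epsilon>) ^ length js * pder js \<phi> (inverse \<epsilon> *\<^sub>R x + 0)))"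
    unfolding pder_cmult[OF smooth_affine[OF assms]] pder_affine[OF assms] ..
  from fun_cong[OF this, of x] show ?thesis
    unfolding mollifier_def[abs_def] by (simp add: power_add inverse_eq_divide mult.assoc)
qed

lemma decreasing_mollifier:
  fixes \<phi> :: "real ^ 'n::finite \<Rightarrow> complex"
  assumes \<phi>: "decreasing \<phi>" and \<epsilon>: "\<epsilon> \<in> {0<..<1}"
  shows "decreasing (mollifier \<phi> \<epsilon>)"
  unfolding decreasing_def
proof (intro conjI allI)
  show "smooth (mollifier \<phi> \<epsilon>)" by (intro smooth_mollifier decreasing_smooth \<phi>)
  fix i m k
  obtain C where C: "\<And>x. norm (pder (replicate m i) \<phi> x) * (1 + norm x) ^ k \<le> C"
    using \<phi> unfolding decreasing_def by blast
  let ?e = "(1 / \<epsilon>) ^ (CARD('n) + m)"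
  have "norm (pder (replicate m i) (mollifier \<phi> \<epsilon>) x) * (1 + norm x) ^ k \<le> ?e * C" for x
  proof -
    have "norm x \<le> norm (x /\<^sub>R \<epsilon>)"
      using \<epsilon> mult_right_mono[of \<epsilon> 1 "norm x"] by (simp add: divide_simps mult.commute)
    then have "(1 + norm x) ^ k \<le> (1 + norm (x /\<^sub>R \<epsilon>)) ^ k" by (intro power_mono) auto
    then have "norm (pder (replicate m i) \<phi> (x /\<^sub>R \<epsilon>)) * (1 + norm x) ^ k \<le> C"
      by (rule order_trans[OF mult_left_mono C]) simp
    then have "?e * (norm (pder (replicate m i) \<phi> (x /\<^sub>R \<epsilon>)) * (1 + norm x) ^ k) \<le> ?e * C"
      using \<epsilon> by (intro mult_left_mono) auto
    moreover have "norm (pder (replicate m i) (mollifier \<phi> \<epsilon>) x) = ?e * norm (pder (replicate m i) \<phi> (x /\<^sub>R \<epsilon>))"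
      unfolding pder_mollifier[OF decreasing_smooth[OF \<phi>]] norm_mult norm_of_real length_replicate
      using \<epsilon> by simp
    ultimately show ?thesis by (simp only: mult.assoc)
  qed
  then show "\<exists>C. \<forall>x. norm (pder (replicate m i) (mollifier \<phi> \<epsilon>) x) * (1 + norm x) ^ k \<le> C"
    by (intro exI allI)
qed

lemma fourier_mollifier:
  fixes \<phi> :: "real ^ 'n::finite \<Rightarrow> complex"
  assumes "\<phi> \<in> borel_measurable borel" and \<epsilon>: "0 < \<epsilon>"
  shows "fourier (mollifier \<phi> \<epsilon>) \<zeta> = fourier \<phi> (\<epsilon> *\<^sub>R \<zeta>)"
proof -
  have w: "wave \<zeta> (0 + \<epsilon> *\<^sub>R x) = wave (\<epsilon> *\<^sub>R \<zeta>) x" for x by (simp add: wave_def)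
  have "(LINT x|lborel. wave \<zeta> x * \<phi> (x /\<^sub>R \<epsilon>)) = of_real (\<bar>\<epsilon>\<bar> ^ CARD('n)) *
      (LINT x|lborel. wave \<zeta> (0 + \<epsilon> *\<^sub>R x) * \<phi> ((0 + \<epsilon> *\<^sub>R x) /\<^sub>R \<epsilon>))"
  proof (rule integral_affine)
    show "(\<lambda>x. wave \<zeta> x * \<phi> (x /\<^sub>R \<epsilon>)) \<in> borel_measurable borel"
      using assms(1) by measurable
  qed (use \<epsilon> in simp)
  then have *: "(LINT x|lborel. wave \<zeta> x * \<phi> (x /\<^sub>R \<epsilon>)) = of_real (\<epsilon> ^ CARD('n)) * fourier \<phi> (\<epsilon> *\<^sub>R \<zeta>)"
    unfolding w fourier_eq[of \<phi>] using \<epsilon> by simp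
  have "fourier (mollifier \<phi> \<epsilon>) \<zeta> = of_real ((1 / \<epsilon>) ^ CARD('n)) * (LINT x|lborel. wave \<zeta> x * \<phi> (x /\<^sub>R \<epsilon>))"
    unfolding fourier_eq mollifier_def mult.left_commute[where a = "complex_of_real ((1 / \<epsilon>) ^ CARD('n))"]
    by (rule integral_mult_right_zero)
  then show ?thesis using \<epsilon> by (simp add: * power_divide)
qed

lemma fourier_mollifier_bound:
  fixes \<phi> :: "real ^ 'n::finite \<Rightarrow> complex"
  assumes \<phi>: "decreasing \<phi>"
  shows "\<exists>C\<ge>0. \<forall>\<epsilon>\<in>{0<..<1}. \<forall>\<zeta>. norm (fourier (mollifier \<phi> \<epsilon>) \<zeta>) * (1 + norm \<zeta>) ^ k \<le> C * (1 / \<epsilon>) ^ k"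
proof -
  obtain C where C: "\<And>\<zeta>. norm (fourier \<phi> \<zeta>) * (1 + norm \<zeta>) ^ k \<le> C"
    using rapidly_decreasing_fourier[OF \<phi>] unfolding rapidly_decreasing_def by blast
  have "norm (fourier \<phi> 0) \<le> C" using C[of 0] by simp
  then have C0: "0 \<le> C" by (rule order_trans[OF norm_ge_zero])
  have "norm (fourier (mollifier \<phi> \<epsilon>) \<zeta>) * (1 + norm \<zeta>) ^ k \<le> C * (1 / \<epsilon>) ^ k" if \<epsilon>: "\<epsilon> \<in> {0<..<1}" for \<epsilon> \<zeta>
  proof -
    have "1 + norm \<zeta> \<le> (1 / \<epsilon>) * (1 + norm (\<epsilon> *\<^sub>R \<zeta>))" using \<epsilon> by (simp add: field_simps)
    then have "(1 + norm \<zeta>) ^ k \<le> ((1 / \<epsilon>) * (1 + norm (\<epsilon> *\<^sub>R \<zeta>))) ^ k" by (intro power_mono) auto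
    then have "norm (fourier \<phi> (\<epsilon> *\<^sub>R \<zeta>)) * (1 + norm \<zeta>) ^ k
        \<le> norm (fourier \<phi> (\<epsilon> *\<^sub>R \<zeta>)) * ((1 / \<epsilon>) * (1 + norm (\<epsilon> *\<^sub>R \<zeta>))) ^ k"
      by (rule mult_left_mono) simp
    also have "\<dots> = (norm (fourier \<phi> (\<epsilon> *\<^sub>R \<zeta>)) * (1 + norm (\<epsilon> *\<^sub>R \<zeta>)) ^ k) * (1 / \<epsilon>) ^ k"
      by (simp only: power_mult_distrib mult_ac)
    also have "\<dots> \<le> C * (1 / \<epsilon>) ^ k" using \<epsilon> by (intro mult_right_mono C) auto
    finally show ?thesis
      using \<epsilon> fourier_mollifier[OF smooth_measurable[OF decreasing_smooth[OF \<phi>]], of \<epsilon> \<zeta>] by simp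
  qed
  then show ?thesis using C0 by (intro exI[of _ C] conjI ballI allI)
qed

text \<open>1 - \<beta> vanishes on the ball of radius r, and outside it the argument of \<phi> has
  norm at least r / \<epsilon>. Rapid decay of \<phi> then yields any power of \<epsilon>.\<close>

lemma mollifier_tail_pder_bound:
  fixes \<phi> \<beta> :: "real ^ 'n::finite \<Rightarrow> complex"
  assumes \<phi>: "decreasing \<phi>" and \<beta>: "\<beta> \<in> test_functions S" and r: "0 < r"
    and one: "\<And>x. x \<in> ball 0 r \<Longrightarrow> \<beta> x = 1"
  shows "\<exists>C\<ge>0. \<forall>\<epsilon>\<in>{0<..<1}. \<forall>x.
    norm (pder (replicate m i) (\<lambda>x. (1 - \<beta> x) * mollifier \<phi> \<epsilon> x) x) * (1 + norm x) ^ k \<le> C * \<epsilon> ^ N"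
proof -
  let ?g = "\<lambda>x. 1 - \<beta> x" and ?d = "CARD('n)"
  \<comment> \<open>The decay order to be spent: ?d + m powers of \<epsilon> compensate scaling and
    differentiation, N powers remain, and the summand k makes (1 + norm x)^q dominate the
    weight.\<close>
  define q where "q = N + ?d + m + k"
  have sg: "smooth ?g" by (intro smooth_diff smooth_const test_functionsD(1)[OF \<beta>])
  obtain A where A: "0 \<le> A" "\<And>js x. length js \<le> m \<Longrightarrow> norm (pder js \<beta> x) \<le> A"
    using test_function_bounded[OF \<beta>, of m] by (elim exE conjE) blast
  have gA: "norm (pder js ?g x) \<le> 1 + A" if "length js \<le> m" for js x
    unfolding pder_diff[OF smooth_const test_functionsD(1)[OF \<beta>]] pder_const
    by (rule order_trans[OF norm_triangle_ineq4 add_mono[OF _ A(2)[OF that]]]) simp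
  have "\<forall>l. \<exists>C. \<forall>x. norm (pder (replicate l i) \<phi> x) * (1 + norm x) ^ q \<le> C"
    using \<phi> unfolding decreasing_def by blast
  then obtain D where D: "\<And>l x. norm (pder (replicate l i) \<phi> x) * (1 + norm x) ^ q \<le> D l" by metis
  have D0: "0 \<le> D l" for l
    by (rule order_trans[OF _ D[of l 0]]) simp
  define M where "M = (\<Sum>l\<le>m. D l)"
  have M0: "0 \<le> M" unfolding M_def by (intro sum_nonneg D0)
  have DM: "D l \<le> M" if "l \<le> m" for l unfolding M_def using that D0 by (intro member_le_sum) auto
  \<comment> \<open>Chosen so that 1 + norm x is at most s * norm x once norm x is at least
    r.\<close>
  define s where "s = (1 + r) / r"
  have s: "1 \<le> s" "0 < s" using r by (auto simp: s_def)
  have far: "norm (pder (replicate l i) (mollifier \<phi> \<epsilon>) x) * (1 + norm x) ^ k \<le> (M * s ^ q) * \<epsilon> ^ N"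
    if \<epsilon>: "\<epsilon> \<in> {0<..<1}" and x: "r \<le> norm x" and l: "l \<le> m" for \<epsilon> x l
  proof -
    have "1 + norm x \<le> s * norm x" using r x by (simp add: s_def field_simps)
    also have "\<dots> = s * \<epsilon> * (norm (x /\<^sub>R \<epsilon>))" using \<epsilon> by simp
    also have "\<dots> \<le> s * \<epsilon> * (1 + norm (x /\<^sub>R \<epsilon>))" using \<epsilon> s by (intro mult_left_mono) auto
    finally have "(1 + norm x) ^ q \<le> (s * \<epsilon> * (1 + norm (x /\<^sub>R \<epsilon>))) ^ q" by (intro power_mono) auto
    then have "norm (pder (replicate l i) \<phi> (x /\<^sub>R \<epsilon>)) * (1 + norm x) ^ q
        \<le> norm (pder (replicate l i) \<phi> (x /\<^sub>R \<epsilon>)) * (s * \<epsilon> * (1 + norm (x /\<^sub>R \<epsilon>))) ^ q"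
      by (rule mult_left_mono) simp
    also have "\<dots> = (norm (pder (replicate l i) \<phi> (x /\<^sub>R \<epsilon>)) * (1 + norm (x /\<^sub>R \<epsilon>)) ^ q) * (s ^ q * \<epsilon> ^ q)"
      by (simp only: power_mult_distrib mult_ac)
    also have "\<dots> \<le> M * (s ^ q * \<epsilon> ^ q)"
      using \<epsilon> s by (intro mult_right_mono order_trans[OF D DM[OF l]]) auto
    finally have 1: "norm (pder (replicate l i) \<phi> (x /\<^sub>R \<epsilon>)) * (1 + norm x) ^ q \<le> M * (s ^ q * \<epsilon> ^ q)" .
    have kq: "(1 + norm x) ^ k \<le> (1 + norm x) ^ q" unfolding q_def by (rule power_increasing) auto
    have "norm (pder (replicate l i) \<phi> (x /\<^sub>R \<epsilon>)) * (1 + norm x) ^ k \<le> M * (s ^ q * \<epsilon> ^ q)"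
      by (rule order_trans[OF mult_left_mono[OF kq norm_ge_zero] 1])
    then have "(1 / \<epsilon>) ^ (?d + l) * (norm (pder (replicate l i) \<phi> (x /\<^sub>R \<epsilon>)) * (1 + norm x) ^ k)
        \<le> (1 / \<epsilon>) ^ (?d + l) * (M * (s ^ q * \<epsilon> ^ q))"
      using \<epsilon> by (intro mult_left_mono) auto
    also have "\<dots> = (M * s ^ q) * ((1 / \<epsilon>) ^ (?d + l) * \<epsilon> ^ q)" by (simp only: mult_ac)
    also have "\<dots> \<le> (M * s ^ q) * \<epsilon> ^ N"
    proof (rule mult_left_mono)
      have "q = (?d + l) + (N + (m - l) + k)" using l by (simp add: q_def)
      then have "(1 / \<epsilon>) ^ (?d + l) * \<epsilon> ^ q = \<epsilon> ^ (N + (m - l) + k)"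
        using \<epsilon> by (simp add: power_add power_divide)
      also have "\<dots> \<le> \<epsilon> ^ N" using \<epsilon> by (intro power_decreasing) auto
      finally show "(1 / \<epsilon>) ^ (?d + l) * \<epsilon> ^ q \<le> \<epsilon> ^ N" .
    qed (use M0 s in auto)
    finally have 2: "(1 / \<epsilon>) ^ (?d + l) * (norm (pder (replicate l i) \<phi> (x /\<^sub>R \<epsilon>)) * (1 + norm x) ^ k) \<le> (M * s ^ q) * \<epsilon> ^ N" .
    have "norm (pder (replicate l i) (mollifier \<phi> \<epsilon>) x) = (1 / \<epsilon>) ^ (?d + l) * norm (pder (replicate l i) \<phi> (x /\<^sub>R \<epsilon>))"
      unfolding pder_mollifier[OF decreasing_smooth[OF \<phi>]] norm_mult norm_of_real length_replicate
      using \<epsilon> by simp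
    with 2 show ?thesis by (simp only: mult.assoc)
  qed
  let ?C = "2 ^ m * (1 + A) * (M * s ^ q)"
  have C0: "0 \<le> ?C" using A(1) M0 s by (intro mult_nonneg_nonneg) auto
  have "norm (pder (replicate m i) (\<lambda>x. ?g x * mollifier \<phi> \<epsilon> x) x) * (1 + norm x) ^ k \<le> ?C * \<epsilon> ^ N"
    if \<epsilon>: "\<epsilon> \<in> {0<..<1}" for \<epsilon> x
  proof (cases "norm x < r")
    case True
    have "pder (replicate m i) (\<lambda>x. ?g x * mollifier \<phi> \<epsilon> x) x = pder (replicate m i) (\<lambda>x. 0) x"
      by (rule pder_cong_open[of "ball 0 r"]) (use True one in auto)
    then have "pder (replicate m i) (\<lambda>x. ?g x * mollifier \<phi> \<epsilon> x) x = 0" unfolding pder_const by simp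
    moreover have "0 \<le> ?C * \<epsilon> ^ N" using C0 \<epsilon> by (intro mult_nonneg_nonneg[OF C0]) auto
    ultimately show ?thesis by (simp only: norm_zero mult_zero_left)
  next
    case False
    let ?p = "(1 + norm x) ^ k"
    have p: "0 < ?p" by (intro zero_less_power add_pos_nonneg) auto
    have "norm (pder (replicate m i) (\<lambda>x. ?g x * mollifier \<phi> \<epsilon> x) x)
        \<le> 2 ^ length (replicate m i) * (1 + A) * ((M * s ^ q) * \<epsilon> ^ N / ?p)"
    proof (rule norm_pder_mult_le[OF sg smooth_mollifier[OF decreasing_smooth[OF \<phi>]], of _ "{i}" m])
      show "0 \<le> (M * s ^ q) * \<epsilon> ^ N / ?p"
        using \<epsilon> M0 s p by (intro divide_nonneg_pos mult_nonneg_nonneg) auto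
      show "norm (pder ks (mollifier \<phi> \<epsilon>) x) \<le> (M * s ^ q) * \<epsilon> ^ N / ?p"
        if ks: "set ks \<subseteq> {i}" "length ks \<le> m" for ks
      proof -
        have "ks = replicate (length ks) i" using ks(1) by (rule eq_replicate)
        then have "norm (pder ks (mollifier \<phi> \<epsilon>) x) * ?p \<le> (M * s ^ q) * \<epsilon> ^ N"
          using far[OF \<epsilon> _ ks(2), of x] False by (metis not_less)
        then show ?thesis using p by (simp only: pos_le_divide_eq)
      qed
    qed (use A(1) gA in auto)
    then have "norm (pder (replicate m i) (\<lambda>x. ?g x * mollifier \<phi> \<epsilon> x) x) * ?p
        \<le> 2 ^ length (replicate m i) * (1 + A) * ((M * s ^ q) * \<epsilon> ^ N / ?p) * ?p"
      using p by (intro mult_right_mono) auto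
    also have "\<dots> = 2 ^ m * (1 + A) * ((M * s ^ q) * \<epsilon> ^ N / ?p * ?p)"
      by (simp only: length_replicate mult.assoc)
    also have "(M * s ^ q) * \<epsilon> ^ N / ?p * ?p = (M * s ^ q) * \<epsilon> ^ N"
      by (rule nonzero_eq_divide_eq[THEN iffD1, OF _ refl]) (rule less_imp_neq[OF p, symmetric])
    also have "2 ^ m * (1 + A) * ((M * s ^ q) * \<epsilon> ^ N) = ?C * \<epsilon> ^ N" by (simp only: mult.assoc)
    finally show ?thesis .
  qed
  then show ?thesis using C0 by (intro exI[of _ ?C] conjI ballI allI)
qed

lemma decreasing_mollifier_tail:
  fixes \<phi> \<beta> :: "real ^ 'n::finite \<Rightarrow> complex"
  assumes "decreasing \<phi>" "\<beta> \<in> test_functions S" "0 < r" "\<And>x. x \<in> ball 0 r \<Longrightarrow> \<beta> x = 1" "\<epsilon> \<in> {0<..<1}"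
  shows "decreasing (\<lambda>x. (1 - \<beta> x) * mollifier \<phi> \<epsilon> x)"
  unfolding decreasing_def
proof (intro conjI allI)
  show "smooth (\<lambda>x. (1 - \<beta> x) * mollifier \<phi> \<epsilon> x)"
    by (intro smooth_mult smooth_diff smooth_const test_functionsD(1)[OF assms(2)] smooth_mollifier
        decreasing_smooth assms)
  show "\<exists>C. \<forall>x. norm (pder (replicate m i) (\<lambda>x. (1 - \<beta> x) * mollifier \<phi> \<epsilon> x) x) * (1 + norm x) ^ k \<le> C" for i m k
  proof -
    have "\<exists>C\<ge>0. \<forall>\<epsilon>\<in>{0<..<1}. \<forall>x. norm (pder (replicate m i) (\<lambda>x. (1 - \<beta> x) * mollifier \<phi> \<epsilon> x) x)
        * (1 + norm x) ^ k \<le> C * \<epsilon> ^ 0"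
      by (rule mollifier_tail_pder_bound[OF assms(1-3)]) (rule assms(4))
    then obtain C where "\<forall>\<epsilon>\<in>{0<..<1}. \<forall>x. norm (pder (replicate m i) (\<lambda>x. (1 - \<beta> x) * mollifier \<phi> \<epsilon> x) x)
        * (1 + norm x) ^ k \<le> C * \<epsilon> ^ 0" by (elim exE conjE)
    from bspec[OF this assms(5)] show ?thesis by (rule exI)
  qed
qed

text \<open>Negligible to every order in \<epsilon> with every weight: removing the tail of the
  mollifier changes a convolution net by a null net only.\<close>

lemma fourier_mollifier_tail_bound:
  fixes \<phi> \<beta> :: "real ^ 'n::finite \<Rightarrow> complex"
  assumes "decreasing \<phi>" "\<beta> \<in> test_functions S" "0 < r" "\<And>x. x \<in> ball 0 r \<Longrightarrow> \<beta> x = 1"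
  shows "\<exists>C\<ge>0. \<forall>\<epsilon>\<in>{0<..<1}. \<forall>\<zeta>.
    norm (fourier (\<lambda>x. (1 - \<beta> x) * mollifier \<phi> \<epsilon> x) \<zeta>) * (1 + norm \<zeta>) ^ k \<le> C * \<epsilon> ^ N"
proof -
  let ?r = "\<lambda>\<epsilon> x. (1 - \<beta> x) * mollifier \<phi> \<epsilon> x"
  let ?I = "LINT x|lborel. wt (x :: real ^ 'n)"
  have I: "0 \<le> ?I" by (rule Bochner_Integration.integral_nonneg) simp
  have "\<forall>m i. \<exists>C. 0 \<le> C \<and> (\<forall>\<epsilon>\<in>{0<..<1}. \<forall>x. norm (pder (replicate m i) (?r \<epsilon>) x) * (1 + norm x) ^ (2 * CARD('n)) \<le> C * \<epsilon> ^ N)"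
    using mollifier_tail_pder_bound[OF assms] by blast
  then obtain C where C: "\<And>m i. 0 \<le> C m i"
    "\<And>m i \<epsilon> x. \<epsilon> \<in> {0<..<1} \<Longrightarrow> norm (pder (replicate m i) (?r \<epsilon>) x) * (1 + norm x) ^ (2 * CARD('n)) \<le> C m i * \<epsilon> ^ N"
    by metis
  define M where "M = (\<Sum>i\<in>UNIV. C 0 i + C k i)"
  have M: "C 0 i \<le> M" "C k i \<le> M" for i
  proof -
    have "C 0 i + C k i \<le> M"
      unfolding M_def by (rule member_le_sum) (auto intro: add_nonneg_nonneg C(1))
    then show "C 0 i \<le> M" "C k i \<le> M" using C(1)[of 0 i] C(1)[of k i] by linarith+
  qed
  have M0: "0 \<le> M" using C(1)[of 0] M(1) order_trans by blast
  have b: "norm (pder (replicate m i) (?r \<epsilon>) x) \<le> (M * \<epsilon> ^ N) * wt x" if "\<epsilon> \<in> {0<..<1}" "m = 0 \<or> m = k" for \<epsilon> m i x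
  proof (rule wt_bound_of_power_bound, rule order_trans[OF C(2)[OF that(1)]])
    show "C m i * \<epsilon> ^ N \<le> M * \<epsilon> ^ N" using that M by (intro mult_right_mono) auto
  qed
  have "norm (fourier (?r \<epsilon>) \<zeta>) * (1 + norm \<zeta>) ^ k \<le> ((2 * real CARD('n)) ^ k * (M * ?I)) * \<epsilon> ^ N"
    if \<epsilon>: "\<epsilon> \<in> {0<..<1}" for \<epsilon> \<zeta>
  proof -
    have "norm (fourier (?r \<epsilon>) \<zeta>) * (1 + norm \<zeta>) ^ k \<le> (2 * real CARD('n)) ^ k * ((M * \<epsilon> ^ N) * ?I)"
      by (rule fourier_decay[OF decreasing_mollifier_tail[OF assms \<epsilon>]])
        (use b[OF \<epsilon>, of 0] b[OF \<epsilon>, of k] in \<open>auto simp del: foldr_replicate\<close>)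
    then show ?thesis by (simp only: mult_ac)
  qed
  then show ?thesis using M0 I by (intro exI[of _ "(2 * real CARD('n)) ^ k * (M * ?I)"] conjI ballI allI) auto
qed

section \<open>Cut-off sequences\<close>

lemma smooth_bump_cutoff:
  assumes "admissible_cutoff \<omega> x\<^sub>0 W U \<kappa>"
  shows "smooth_bump (\<kappa> 1) x\<^sub>0 W"
proof
  have "\<kappa> 1 \<in> test_functions U" using assms by (simp add: admissible_cutoff_def)
  then show "\<kappa> 1 \<in> test_functions UNIV" by (rule test_functions_mono) simp
qed (use assms in \<open>auto simp: admissible_cutoff_def\<close>)

lemma admissible_cutoffD:
  assumes "admissible_cutoff \<omega> x\<^sub>0 W U \<kappa>"
  shows "compact (closure U)" "closure U \<subseteq> \<omega>" "x\<^sub>0 \<in> U" "open U"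
    and "1 \<le> n \<Longrightarrow> \<kappa> n \<in> test_functions U" "1 \<le> n \<Longrightarrow> \<kappa> n \<in> test_functions \<omega>"
    and "1 \<le> n \<Longrightarrow> closure {x. \<kappa> n x \<noteq> 0} \<subseteq> closure U"
proof -
  note a = assms[unfolded admissible_cutoff_def compactly_inside_def]
  show U: "compact (closure U)" "closure U \<subseteq> \<omega>" "open U" using a by blast+
  show "x\<^sub>0 \<in> U" using a closure_subset by blast
  show *: "\<kappa> n \<in> test_functions U" if "1 \<le> n" using a that by blast
  show "\<kappa> n \<in> test_functions \<omega>" if "1 \<le> n"
    by (rule test_functions_mono[OF *[OF that] order_trans[OF closure_subset U(2)]])
  show "closure {x. \<kappa> n x \<noteq> 0} \<subseteq> closure U" if "1 \<le> n"
    by (rule order_trans[OF test_functionsD(3)[OF *[OF that]] closure_subset])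
qed

text \<open>On a compact set a constant bound is a weight bound. This feeds functions supported in a
  common compact set into \<open>fourier_decay\<close> with a common constant.\<close>

lemma compact_wt_lower_bound:
  fixes K :: "(real ^ 'n::finite) set"
  assumes "compact K"
  shows "\<exists>V\<ge>1. \<forall>x\<in>K. 1 \<le> V * wt x"
proof -
  obtain R where R: "0 < R" "\<forall>y\<in>K. norm y \<le> R"
    using compact_imp_bounded[OF assms] unfolding bounded_pos by (elim exE conjE)
  let ?V = "(1 + R) ^ (2 * CARD('n))"
  have "1 \<le> ?V" using R(1) by (intro one_le_power) auto
  moreover have "1 \<le> ?V * wt x" if "x \<in> K" for x
  proof (rule wt_bound_of_power_bound)
    show "1 * (1 + norm x) ^ (2 * CARD('n)) \<le> ?V"
      using R(2) that by (simp add: power_mono)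
  qed
  ultimately show ?thesis by (intro exI[of _ ?V] conjI ballI)
qed

text \<open>Both multi-indices of the hypothesis are taken along one coordinate. The k fixed
  derivatives cost a constant, the other j cost a factor M n each.\<close>

lemma cutoff_pure_derivative_bound:
  fixes \<kappa> :: "nat \<Rightarrow> real ^ 'n::finite \<Rightarrow> complex"
  assumes "admissible_cutoff \<omega> x\<^sub>0 W U \<kappa>"
  shows "\<exists>M\<ge>1. \<forall>n\<ge>1. \<forall>j\<le>n. \<forall>i x. norm (pder (replicate (j + k) i) (\<kappa> n) x) \<le> M * (M * real n) ^ j"
proof -
  have "\<forall>i. \<exists>C>0. \<forall>n\<ge>1. \<forall>\<beta>. mi_abs \<beta> \<le> n \<longrightarrow>
        (\<forall>x. norm (mi_deriv (mi_single i k + \<beta>) (\<kappa> n) x) \<le> C * (C * real n) ^ mi_abs \<beta>)"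
    using assms unfolding admissible_cutoff_def by blast
  then obtain C where C: "\<And>i. 0 < C i" and CB: "\<And>i n \<beta> x. 1 \<le> n \<Longrightarrow> mi_abs \<beta> \<le> n \<Longrightarrow>
        norm (mi_deriv (mi_single i k + \<beta>) (\<kappa> n) x) \<le> C i * (C i * real n) ^ mi_abs \<beta>"
    by metis
  define M where "M = 1 + (\<Sum>i\<in>UNIV. C i)"
  have CM: "C i \<le> M" for i
  proof -
    have "C i \<le> (\<Sum>i\<in>UNIV. C i)" using C by (intro member_le_sum) (auto intro: less_imp_le)
    then show ?thesis unfolding M_def by linarith
  qed
  have M1: "1 \<le> M" unfolding M_def using sum_nonneg[of UNIV C] C by (simp add: less_imp_le)
  have "norm (pder (replicate (j + k) i) (\<kappa> n) x) \<le> M * (M * real n) ^ j" if "1 \<le> n" "j \<le> n" for n j i x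
  proof -
    have "norm (mi_deriv (mi_single i k + mi_single i j) (\<kappa> n) x) \<le> C i * (C i * real n) ^ j"
      using CB[of n "mi_single i j" i x] that by simp
    also have "\<dots> \<le> M * (M * real n) ^ j"
      using CM[of i] C[of i] M1 by (intro mult_mono power_mono mult_right_mono) auto
    finally show ?thesis
      unfolding mi_single_add mi_deriv_single by (simp only: add.commute)
  qed
  then show ?thesis using M1 by (intro exI[of _ M] conjI allI impI)
qed

text \<open>The two exponents have different tasks: j, up to n, carries the analytic decay, while
  the fixed k pays for integrability and for polynomial growth of other factors. C depends on
  neither n nor j.\<close>

lemma cutoff_fourier_bound:
  fixes \<kappa> :: "nat \<Rightarrow> real ^ 'n::finite \<Rightarrow> complex"
  assumes adm: "admissible_cutoff \<omega> x\<^sub>0 W U \<kappa>"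
  shows "\<exists>C\<ge>1. \<forall>n\<ge>1. \<forall>j\<le>n. \<forall>\<eta>. norm (fourier (\<kappa> n) \<eta>) * (1 + norm \<eta>) ^ (j + k) \<le> C * (C * real n) ^ j"
proof -
  obtain M0 where M0: "1 \<le> M0" "\<forall>n\<ge>1. \<forall>j\<le>n. \<forall>i x. norm (pder (replicate (j + 0) i) (\<kappa> n) x) \<le> M0 * (M0 * real n) ^ j"
    using cutoff_pure_derivative_bound[OF adm, of 0] by (elim exE conjE)
  obtain Mk where Mk: "1 \<le> Mk" "\<forall>n\<ge>1. \<forall>j\<le>n. \<forall>i x. norm (pder (replicate (j + k) i) (\<kappa> n) x) \<le> Mk * (Mk * real n) ^ j"
    using cutoff_pure_derivative_bound[OF adm, of k] by (elim exE conjE)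
  obtain V where V: "1 \<le> V" "\<forall>x\<in>closure U. 1 \<le> V * wt x"
    using compact_wt_lower_bound[OF admissible_cutoffD(1)[OF adm]] by (elim exE conjE)
  define M where "M = M0 + Mk"
  have M: "1 \<le> M" "M0 \<le> M" "Mk \<le> M" using M0(1) Mk(1) by (auto simp: M_def)
  let ?I = "LINT x|lborel. wt (x :: real ^ 'n)" and ?d = "2 * real CARD('n)"
  have I: "0 \<le> ?I" by (rule Bochner_Integration.integral_nonneg) simp
  have "1 \<le> real CARD('n)" by (simp add: Suc_le_eq)
  then have d: "1 \<le> ?d" by linarith
  \<comment> \<open>The first summand collects the factors that do not involve j, the second is the
    base of the j-th power.\<close>
  define C where "C = ?d ^ k * (V * M) * (?I + 1) + ?d * M"
  have dM: "1 * 1 \<le> ?d * M" using d M by (intro mult_mono) auto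
  have C: "1 \<le> C" "?d ^ k * (V * M) * ?I \<le> C" "?d * M \<le> C"
  proof -
    have nn: "0 \<le> ?d ^ k * (V * M)" using d V M by (intro mult_nonneg_nonneg) auto
    then have "0 \<le> ?d ^ k * (V * M) * (?I + 1)" using I by (intro mult_nonneg_nonneg[OF nn]) auto
    then show "1 \<le> C" "?d * M \<le> C" using dM unfolding C_def by linarith+
    have "?d ^ k * (V * M) * ?I \<le> ?d ^ k * (V * M) * (?I + 1)" using nn by (intro mult_left_mono) auto
    then show "?d ^ k * (V * M) * ?I \<le> C" using dM unfolding C_def by linarith
  qed
  have "norm (fourier (\<kappa> n) \<eta>) * (1 + norm \<eta>) ^ (j + k) \<le> C * (C * real n) ^ j"
    if n: "1 \<le> n" and j: "j \<le> n" for n j \<eta>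
  proof -
    let ?b = "M * (M * real n) ^ j"
    have n1: "1 \<le> real n" using n by simp
    have Mn: "1 * 1 \<le> M * real n" using M n1 by (intro mult_mono) auto
    then have p: "1 \<le> (M * real n) ^ j" by (intro one_le_power) simp
    have ext: "norm (pder js (\<kappa> n) x) \<le> (?b * V) * wt x"
      if "norm (pder js (\<kappa> n) x) \<le> ?b" for js x
    proof (cases "x \<in> closure U")
      case True
      have "?b * 1 \<le> ?b * (V * wt x)" using V(2) True M p by (intro mult_left_mono) auto
      then show ?thesis using that by (simp only: mult.assoc mult_1_right)
    next
      case False
      then have "pder js (\<kappa> n) x = 0"
        using admissible_cutoffD(7)[OF adm n] by (intro pder_zero_outside_support) blast
      moreover have "0 \<le> (?b * V) * wt x" using M p V(1) by (intro mult_nonneg_nonneg) auto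
      ultimately show ?thesis by (simp only: norm_zero)
    qed
    have 0: "norm (pder [] (\<kappa> n) x) \<le> ?b" for x
    proof -
      \<comment> \<open>With zero derivatives the direction is immaterial, so any value of the index
        type will do.\<close>
      have "norm (pder (replicate (0 + 0) undefined) (\<kappa> n) x) \<le> M0 * (M0 * real n) ^ 0"
        by (rule M0(2)[rule_format, OF n le0])
      then have "norm (pder [] (\<kappa> n) x) \<le> M0" by simp
      also have "\<dots> \<le> M * 1" using M by simp
      also have "\<dots> \<le> ?b" using p M by (intro mult_left_mono) auto
      finally show ?thesis .
    qed
    have 1: "norm (pder (replicate (j + k) i) (\<kappa> n) x) \<le> ?b" for i x
    proof -
      have "norm (pder (replicate (j + k) i) (\<kappa> n) x) \<le> Mk * (Mk * real n) ^ j"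
        by (rule Mk(2)[rule_format, OF n j])
      also have "\<dots> \<le> ?b" using M Mk(1) by (intro mult_mono power_mono mult_right_mono) auto
      finally show ?thesis .
    qed
    have "norm (fourier (\<kappa> n) \<eta>) * (1 + norm \<eta>) ^ (j + k) \<le> ?d ^ (j + k) * ((?b * V) * ?I)"
    proof (rule fourier_decay)
      show "decreasing (\<kappa> n)" by (rule test_function_decreasing[OF admissible_cutoffD(5)[OF adm n]])
      show "norm (\<kappa> n x) \<le> (?b * V) * wt x" for x using ext[of "[]", OF 0] by simp
      show "norm (pder (replicate (j + k) i) (\<kappa> n) x) \<le> (?b * V) * wt x" for i x by (rule ext[OF 1])
    qed
    also have "\<dots> = (?d ^ k * (V * M) * ?I) * (?d * M * real n) ^ j"
      by (simp only: power_add power_mult_distrib mult_ac)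
    also have "\<dots> \<le> C * (C * real n) ^ j"
      using C d M by (intro mult_mono power_mono mult_right_mono) auto
    finally show ?thesis .
  qed
  then show ?thesis using C(1) by (intro exI[of _ C] conjI allI impI)
qed

text \<open>The hypothesis on mixed derivatives is stated for one ordering of the differentiations only;
  Fourier inversion recovers all orderings from the pure derivatives.\<close>

lemma cutoff_uniform_bound:
  fixes \<kappa> :: "nat \<Rightarrow> real ^ 'n::finite \<Rightarrow> complex"
  assumes adm: "admissible_cutoff \<omega> x\<^sub>0 W U \<kappa>"
  shows "\<exists>A\<ge>0. \<forall>n\<ge>1. \<forall>js x. length js \<le> N \<longrightarrow> norm (pder js (\<kappa> n) x) \<le> A"
proof -
  obtain C where C: "1 \<le> C" "\<forall>n\<ge>1. \<forall>j\<le>n. \<forall>\<eta>.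
      norm (fourier (\<kappa> n) \<eta>) * (1 + norm \<eta>) ^ (j + (N + 2 * CARD('n))) \<le> C * (C * real n) ^ j"
    using cutoff_fourier_bound[OF adm, where k = "N + 2 * CARD('n)"] by (elim exE conjE)
  let ?c = "inv_const TYPE('n)" and ?I = "LINT x|lborel. wt (x :: real ^ 'n)"
  have I: "0 \<le> ?I" by (rule Bochner_Integration.integral_nonneg) simp
  have "norm (pder js (\<kappa> n) x) \<le> norm ?c * (C * ?I)" if n: "1 \<le> n" and js: "length js \<le> N" for n js x
  proof -
    have d: "decreasing (\<kappa> n)" by (rule test_function_decreasing[OF admissible_cutoffD(5)[OF adm n]])
    have r: "rapidly_decreasing (fourier (\<kappa> n))" using d by (rule rapidly_decreasing_fourier)
    have rr: "rapidly_decreasing (\<lambda>\<zeta>. fourier (\<kappa> n) (- \<zeta>))" using r by (rule rapidly_decreasing_reflect)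
    have "\<kappa> n = (\<lambda>y. ?c * fourier (\<lambda>\<zeta>. fourier (\<kappa> n) (- \<zeta>)) y)"
      unfolding fourier_reflect[OF rapidly_decreasing_measurable[OF r], symmetric]
      by (rule ext) (rule decreasing_eq_fourier[OF d])
    then have "pder js (\<kappa> n) x = pder js (\<lambda>y. ?c * fourier (\<lambda>\<zeta>. fourier (\<kappa> n) (- \<zeta>)) y) x"
      by (rule arg_cong[where f = "\<lambda>g. pder js g x"])
    also have "\<dots> = ?c * pder js (fourier (\<lambda>\<zeta>. fourier (\<kappa> n) (- \<zeta>))) x"
      unfolding pder_cmult[OF smooth_fourier[OF rr]] ..
    finally have "norm (pder js (\<kappa> n) x) = norm ?c * norm (pder js (fourier (\<lambda>\<zeta>. fourier (\<kappa> n) (- \<zeta>))) x)"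
      by (simp only: norm_mult)
    also have "\<dots> \<le> norm ?c * (C * ?I)"
    proof (rule mult_left_mono[OF norm_pder_fourier_le[OF rr] norm_ge_zero])
      fix \<zeta> :: "real ^ 'n"
      have "(1 + norm \<zeta>) ^ (length js + 2 * CARD('n)) \<le> (1 + norm (- \<zeta>)) ^ (0 + (N + 2 * CARD('n)))"
        using js by (simp add: power_increasing)
      then have "norm (fourier (\<kappa> n) (- \<zeta>)) * (1 + norm \<zeta>) ^ (length js + 2 * CARD('n))
          \<le> norm (fourier (\<kappa> n) (- \<zeta>)) * (1 + norm (- \<zeta>)) ^ (0 + (N + 2 * CARD('n)))"
        by (rule mult_left_mono) simp
      also have "\<dots> \<le> C * (C * real n) ^ 0" by (rule C(2)[rule_format, OF n le0])
      finally show "norm (fourier (\<kappa> n) (- \<zeta>)) * (1 + norm \<zeta>) ^ (length js + 2 * CARD('n)) \<le> C" by simp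
    qed
    finally show ?thesis .
  qed
  moreover have "0 \<le> norm ?c * (C * ?I)" using C(1) I by (intro mult_nonneg_nonneg) auto
  ultimately show ?thesis by (intro exI[of _ "norm ?c * (C * ?I)"] conjI allI impI)
qed

text \<open>C and N do not depend on n: the supports stay in closure U, which fixes the order N of
  f, and N derivatives of the cut-offs are bounded uniformly in n.\<close>

lemma cutoff_wave_transform_bound:
  fixes \<kappa> :: "nat \<Rightarrow> real ^ 'n::finite \<Rightarrow> complex"
  assumes adm: "admissible_cutoff \<omega> x\<^sub>0 W U \<kappa>" and u: "u \<in> distributions \<omega>"
  shows "\<exists>C\<ge>0. \<exists>N. \<forall>n\<ge>1. \<forall>\<zeta>. norm (wave_transform u (\<kappa> n) \<zeta>) \<le> C * (1 + norm \<zeta>) ^ N"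
proof -
  obtain C N where C: "0 \<le> C" and CN: "\<And>\<kappa>' A \<zeta>. \<kappa>' \<in> test_functions \<omega> \<Longrightarrow> closure {x. \<kappa>' x \<noteq> 0} \<subseteq> closure U \<Longrightarrow> 0 \<le> A \<Longrightarrow>
      (\<And>js x. length js \<le> N \<Longrightarrow> norm (pder js \<kappa>' x) \<le> A) \<Longrightarrow>
      norm (wave_transform u \<kappa>' \<zeta>) \<le> C * A * (1 + norm \<zeta>) ^ N"
    by (rule wave_transform_bound[OF u admissible_cutoffD(1,2)[OF adm]]) (erule that[rotated])
  obtain A where A: "0 \<le> A" "\<forall>n\<ge>1. \<forall>js x. length js \<le> N \<longrightarrow> norm (pder js (\<kappa> n) x) \<le> A"
    using cutoff_uniform_bound[OF adm, where N = N] by (elim exE conjE)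
  have "norm (wave_transform u (\<kappa> n) \<zeta>) \<le> C * A * (1 + norm \<zeta>) ^ N" if "1 \<le> n" for n \<zeta>
    by (rule CN[OF admissible_cutoffD(6)[OF adm that] admissible_cutoffD(7)[OF adm that] A(1)]) (use A(2) that in blast)
  then show ?thesis using mult_nonneg_nonneg[OF C A(1)] by (intro exI[of _ "C * A"] exI[of _ N] conjI allI impI)
qed

section \<open>The mollification error on the Fourier side\<close>

lemma (in smooth_bump) support_cutoff_compact_distribution:
  fixes \<omega> :: "(real ^ 'n) set"
  assumes "open \<omega>" "f \<in> compact_distributions \<omega>"
  shows "support_cutoff \<omega> f \<in> test_functions \<omega>"
    and "\<exists>V. open V \<and> dist_support \<omega> f \<subseteq> V \<and> (\<forall>x\<in>V. support_cutoff \<omega> f x = 1)"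
proof -
  have "compact (dist_support \<omega> f)" using assms(2) by (simp add: compact_distributions_def)
  moreover have "dist_support \<omega> f \<subseteq> \<omega>" by (auto simp: dist_support_def)
  ultimately show "support_cutoff \<omega> f \<in> test_functions \<omega>"
    "\<exists>V. open V \<and> dist_support \<omega> f \<subseteq> V \<and> (\<forall>x\<in>V. support_cutoff \<omega> f x = 1)"
    using support_cutoff[OF assms(1) _ order_refl] by blast+
qed

text \<open>Inserting the support cut-off does not change f. Afterwards the transform of \<kappa> f
  has the same integral form as that of \<kappa> times a convolution, so the two can be subtracted
  under one integral.\<close>

lemma (in smooth_bump) wave_transform_eq_integral:
  fixes \<omega> :: "(real ^ 'n) set"
  assumes \<omega>: "open \<omega>" and f: "f \<in> compact_distributions \<omega>" and \<kappa>: "\<kappa> \<in> test_functions \<omega>"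
  shows "wave_transform f \<kappa> \<xi> = inv_const TYPE('n) *
    (LINT \<zeta>|lborel. wave_transform f (support_cutoff \<omega> f) (- \<zeta>) * fourier \<kappa> (\<xi> + \<zeta>))"
proof -
  have d: "f \<in> distributions \<omega>" using f by (simp add: compact_distributions_def)
  note \<rho> = support_cutoff_compact_distribution[OF \<omega> f]
  obtain V where V: "open V" "dist_support \<omega> f \<subseteq> V" "\<And>x. x \<in> V \<Longrightarrow> support_cutoff \<omega> f x = 1"
    using \<rho>(2) by blast
  have t: "(\<lambda>y. \<kappa> y * wave \<xi> y) \<in> test_functions \<omega>" by (intro test_functions_mult \<kappa> smooth_wave)
  have "f (\<lambda>y. \<kappa> y * wave \<xi> y) = f (\<lambda>y. support_cutoff \<omega> f y * (\<kappa> y * wave \<xi> y))"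
    by (rule distribution_eq_near_support[OF d t test_functions_mult_left[OF t test_functionsD(1)[OF \<rho>(1)]] V(1,2)])
      (simp add: V(3))
  then show ?thesis
    unfolding wave_transform_mult[OF d \<rho>(1) \<kappa>] by (simp only: wave_transform_def)
qed

lemma dist_convol_eq: "dist_convol \<omega> u \<theta> x = u (\<lambda>y. support_cutoff \<omega> u y * \<theta> (x - y))"
  by (simp only: dist_convol_def pairing_eq)

text \<open>The integrands contain the transform of a cut-off at \<xi> + \<zeta>, so they are
  concentrated near \<zeta> = - \<xi>, and the weight is centred there.\<close>

lemma norm_integral_shifted_wt_bound:
  fixes w :: "real ^ 'n::finite \<Rightarrow> complex"
  assumes "w \<in> borel_measurable borel" "\<And>\<zeta>. norm (w \<zeta>) \<le> C * wt (\<xi> + \<zeta>)"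
  shows "norm (LINT \<zeta>|lborel. w \<zeta>) \<le> C * (LINT x|lborel. wt (x :: real ^ 'n))"
proof -
  have "norm (LINT \<zeta>|lborel. w (\<zeta> + (- \<xi>))) \<le> C * (LINT x|lborel. wt (x :: real ^ 'n))"
    by (rule norm_integral_wt_bound) (use assms(2)[of "_ + (- \<xi>)"] in simp)
  then show ?thesis by (simp only: integral_shift[OF assms(1)])
qed

text \<open>The source of the rate \<epsilon>: the transform of the mollifier at \<zeta> is that of
  \<phi> at \<epsilon> \<zeta>, hence within L \<epsilon> |\<zeta>| of its value at 0.\<close>

lemma fourier_lipschitz_at_0:
  fixes \<phi> :: "real ^ 'n::finite \<Rightarrow> complex"
  assumes "decreasing \<phi>"
  shows "\<exists>L\<ge>0. \<forall>\<xi>. norm (fourier \<phi> \<xi> - fourier \<phi> 0) \<le> L * norm \<xi>"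
proof -
  obtain C where C: "\<And>x. norm (\<phi> x) * (1 + norm x) ^ (1 + 2 * CARD('n)) \<le> C"
    using assms unfolding decreasing_def by (metis foldr.simps(1) id_apply replicate_0)
  have C0: "0 \<le> C" by (rule order_trans[OF _ C[of 0]]) simp
  let ?I = "LINT x|lborel. wt (x :: real ^ 'n)"
  have I: "0 \<le> ?I" by (rule Bochner_Integration.integral_nonneg) simp
  have i: "integrable lborel (\<lambda>x. wave \<xi> x * \<phi> x)" for \<xi>
    by (intro wave_integrable_mult decreasing_integrable assms)
  have "norm (fourier \<phi> \<xi> - fourier \<phi> 0) \<le> (C * norm \<xi>) * ?I" for \<xi>
  proof -
    have "fourier \<phi> \<xi> - fourier \<phi> 0 = (LINT x|lborel. wave \<xi> x * \<phi> x - wave 0 x * \<phi> x)"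
      unfolding fourier_eq by (rule Bochner_Integration.integral_diff[OF i i, symmetric])
    also have "norm \<dots> \<le> (C * norm \<xi>) * ?I"
    proof (rule norm_integral_wt_bound, rule wt_bound_of_power_bound)
      fix x :: "real ^ 'n"
      have "norm (wave \<xi> x * \<phi> x - wave 0 x * \<phi> x) = norm (wave \<xi> x - wave 0 x) * norm (\<phi> x)"
        by (simp only: norm_mult[symmetric] left_diff_distrib)
      also have "\<dots> \<le> (norm x * norm (\<xi> - 0)) * norm (\<phi> x)"
        by (intro mult_right_mono norm_wave_diff_le) auto
      also have "\<dots> = (norm x * norm \<xi>) * norm (\<phi> x)" by simp
      also have "\<dots> \<le> ((1 + norm x) * norm \<xi>) * norm (\<phi> x)" by (rule mult_right_mono[OF mult_right_mono]) auto
      finally have "norm (wave \<xi> x * \<phi> x - wave 0 x * \<phi> x) * (1 + norm x) ^ (2 * CARD('n))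
          \<le> (((1 + norm x) * norm \<xi>) * norm (\<phi> x)) * (1 + norm x) ^ (2 * CARD('n))"
        by (rule mult_right_mono) simp
      also have "\<dots> = norm \<xi> * (norm (\<phi> x) * (1 + norm x) ^ (1 + 2 * CARD('n)))"
        by (simp add: mult_ac)
      also have "\<dots> \<le> norm \<xi> * C" by (intro mult_left_mono C) auto
      finally show "norm (wave \<xi> x * \<phi> x - wave 0 x * \<phi> x) * (1 + norm x) ^ (2 * CARD('n)) \<le> C * norm \<xi>"
        by (simp only: mult.commute)
    qed
    finally show ?thesis .
  qed
  then show ?thesis using C0 I by (intro exI[of _ "C * ?I"]) (auto simp: mult_ac)
qed

text \<open>Peetre's inequality. It exchanges growth in \<zeta> for growth in \<xi> and in \<xi> +
  \<zeta>, where the transformed cut-off decays.\<close>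

lemma one_plus_norm_le_mult:
  fixes \<xi> \<zeta> :: "real ^ 'n::finite"
  shows "1 + norm \<zeta> \<le> (1 + norm \<xi>) * (1 + norm (\<xi> + \<zeta>))"
proof -
  have "norm \<zeta> \<le> norm (\<xi> + \<zeta>) + norm \<xi>" using norm_triangle_ineq4[of "\<xi> + \<zeta>" \<xi>] by simp
  moreover have "0 \<le> norm \<xi> * norm (\<xi> + \<zeta>)" by simp
  moreover have "(1 + norm \<xi>) * (1 + norm (\<xi> + \<zeta>)) = 1 + norm \<xi> + norm (\<xi> + \<zeta>) + norm \<xi> * norm (\<xi> + \<zeta>)"
    by (simp add: algebra_simps)
  ultimately show ?thesis by linarith
qed

text \<open>Both transforms are integrals of the same product, except that the first carries the
  additional factor \<open>fourier \<phi>\<close> at - \<epsilon> \<zeta>. Its distance from 1 gives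
  \<epsilon> and one more power of |\<zeta>|, which Peetre's inequality moves to \<xi>.\<close>

lemma (in smooth_bump) mollified_fourier_diff_bound:
  fixes \<omega> :: "(real ^ 'n) set"
  assumes \<omega>: "open \<omega>" and f: "f \<in> compact_distributions \<omega>" and adm: "admissible_cutoff \<omega> x\<^sub>0 W U \<kappa>"
    and \<phi>: "decreasing \<phi>" "fourier \<phi> 0 = 1"
  shows "\<exists>C\<ge>0. \<exists>M. \<forall>n\<ge>1. \<forall>\<xi>. \<forall>\<epsilon>\<in>{0<..<1}.
    norm (fourier (\<lambda>x. \<kappa> n x * dist_convol \<omega> f (mollifier \<phi> \<epsilon>) x) \<xi> - wave_transform f (\<kappa> n) \<xi>)
      \<le> C * \<epsilon> * (1 + norm \<xi>) ^ M"
proof -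
  have d: "f \<in> distributions \<omega>" using f by (simp add: compact_distributions_def)
  define \<rho> where "\<rho> = support_cutoff \<omega> f"
  have \<rho>: "\<rho> \<in> test_functions \<omega>" unfolding \<rho>_def by (rule support_cutoff_compact_distribution(1)[OF \<omega> f])
  let ?T = "wave_transform f \<rho>" and ?c = "inv_const TYPE('n)"
  let ?I = "LINT x|lborel. wt (x :: real ^ 'n)"
  have I: "0 \<le> ?I" by (rule Bochner_Integration.integral_nonneg) simp
  have pT: "polynomially_bounded ?T" by (rule wave_transform_polynomially_bounded[OF d \<rho>])
  then obtain B m where B: "\<And>\<zeta>. norm (?T \<zeta>) \<le> B * (1 + norm \<zeta>) ^ m" and Tm: "?T \<in> borel_measurable borel"
    unfolding polynomially_bounded_def by blast
  have B0: "0 \<le> B" using order_trans[OF norm_ge_zero B[of 0]] by simp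
  have TmM: "(\<lambda>\<zeta>. ?T (- \<zeta>)) \<in> borel_measurable borel"
    by (rule measurable_compose[OF _ Tm]) simp
  obtain L where L: "0 \<le> L" "\<forall>\<xi>. norm (fourier \<phi> \<xi> - fourier \<phi> 0) \<le> L * norm \<xi>"
    using fourier_lipschitz_at_0[OF \<phi>(1)] by (elim exE conjE)
  \<comment> \<open>m powers meet the growth of ?T, one meets the Lipschitz bound, the rest form the
    integrable weight. Only j = 0 is used, so the estimate is uniform in n.\<close>
  obtain D where D: "1 \<le> D" "\<forall>n\<ge>1. \<forall>j\<le>n. \<forall>\<eta>.
      norm (fourier (\<kappa> n) \<eta>) * (1 + norm \<eta>) ^ (j + (m + 1 + 2 * CARD('n))) \<le> D * (D * real n) ^ j"
    using cutoff_fourier_bound[OF adm, where k = "m + 1 + 2 * CARD('n)"] by (elim exE conjE)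
  have "norm (fourier (\<lambda>x. \<kappa> n x * dist_convol \<omega> f (mollifier \<phi> \<epsilon>) x) \<xi> - wave_transform f (\<kappa> n) \<xi>)
      \<le> (norm ?c * (L * B * D * ?I)) * \<epsilon> * (1 + norm \<xi>) ^ (m + 1)"
    if n: "1 \<le> n" and \<epsilon>: "\<epsilon> \<in> {0<..<1}" for n \<xi> \<epsilon>
  proof -
    have \<kappa>: "\<kappa> n \<in> test_functions \<omega>" using adm n by (rule admissible_cutoffD)
    have d\<kappa>: "decreasing (\<kappa> n)" using \<kappa> by (rule test_function_decreasing)
    have d\<epsilon>: "decreasing (mollifier \<phi> \<epsilon>)" by (rule decreasing_mollifier[OF \<phi>(1) \<epsilon>])
    have fm: "(\<lambda>\<zeta>. fourier (\<kappa> n) (\<xi> + \<zeta>)) \<in> borel_measurable borel"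
      by (rule measurable_compose[OF _ fourier_measurable[OF smooth_measurable[OF decreasing_smooth[OF d\<kappa>]]]]) simp
    have bm: "rapidly_decreasing (\<lambda>\<zeta>. ?T (- \<zeta>) * fourier (\<kappa> n) (\<xi> + \<zeta>))"
    proof -
      have e: "fourier (\<kappa> n) (\<xi> + \<zeta>) = fourier (\<lambda>x. \<kappa> n x * wave \<xi> x) \<zeta>" for \<zeta>
        by (rule fourier_mult_wave[symmetric])
      have "polynomially_bounded (\<lambda>\<zeta>. ?T (- \<zeta>))"
        unfolding polynomially_bounded_def
        by (intro conjI TmM exI[of _ B] exI[of _ m] allI) (use B[of "- _"] in simp)
      then show ?thesis
        unfolding e
        by (intro rapidly_decreasing_mult rapidly_decreasing_fourier
            test_function_decreasing[OF test_functions_mult[OF \<kappa> smooth_wave]])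
    qed
    let ?w1 = "\<lambda>\<zeta>. (fourier (mollifier \<phi> \<epsilon>) (- \<zeta>) * ?T (- \<zeta>)) * fourier (\<kappa> n) (\<xi> + \<zeta>)"
    let ?w2 = "\<lambda>\<zeta>. ?T (- \<zeta>) * fourier (\<kappa> n) (\<xi> + \<zeta>)"
    have rT: "rapidly_decreasing (\<lambda>\<zeta>. fourier (mollifier \<phi> \<epsilon>) (- \<zeta>) * ?T (- \<zeta>))"
      by (rule rapidly_decreasing_convolution[OF d \<rho> rapidly_decreasing_fourier[OF d\<epsilon>]])
    have "(\<lambda>x. \<kappa> n x * dist_convol \<omega> f (mollifier \<phi> \<epsilon>) x)
        = (\<lambda>x. ?c * (\<kappa> n x * fourier (\<lambda>\<zeta>. fourier (mollifier \<phi> \<epsilon>) (- \<zeta>) * ?T (- \<zeta>)) x))"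
      unfolding dist_convol_eq \<rho>_def[symmetric] convolution_eq_fourier[OF d \<rho> d\<epsilon>] by (simp only: mult.left_commute)
    then have 1: "fourier (\<lambda>x. \<kappa> n x * dist_convol \<omega> f (mollifier \<phi> \<epsilon>) x) \<xi> = ?c * (LINT \<zeta>|lborel. ?w1 \<zeta>)"
      by (simp only: fourier_cmult fourier_mult_fourier[OF decreasing_integrable[OF d\<kappa>] rapidly_decreasing_integrable[OF rT]])
    have 2: "wave_transform f (\<kappa> n) \<xi> = ?c * (LINT \<zeta>|lborel. ?w2 \<zeta>)"
      unfolding \<rho>_def by (rule wave_transform_eq_integral[OF \<omega> f \<kappa>])
    have r: "rapidly_decreasing ?w1"
    proof -
      have "polynomially_bounded (\<lambda>\<zeta>. fourier (mollifier \<phi> \<epsilon>) (- \<zeta>))"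
        using rapidly_decreasing_reflect[OF rapidly_decreasing_fourier[OF d\<epsilon>]]
        unfolding rapidly_decreasing_def polynomially_bounded_def
        by (metis (no_types, lifting) mult.right_neutral power_0)
      from rapidly_decreasing_mult[OF this bm] show ?thesis by (simp only: mult.assoc)
    qed
    let ?K = "L * B * D * \<epsilon> * (1 + norm \<xi>) ^ (m + 1)"
    have main: "norm (LINT \<zeta>|lborel. ?w1 \<zeta> - ?w2 \<zeta>) \<le> ?K * ?I"
    proof (rule norm_integral_shifted_wt_bound[where w = "\<lambda>\<zeta>. ?w1 \<zeta> - ?w2 \<zeta>" and C = ?K and \<xi> = \<xi>])
      show "(\<lambda>\<zeta>. ?w1 \<zeta> - ?w2 \<zeta>) \<in> borel_measurable borel"
        using rapidly_decreasing_measurable[OF r] rapidly_decreasing_measurable[OF bm] by (rule borel_measurable_diff)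
      fix \<zeta> :: "real ^ 'n"
      have e: "fourier (mollifier \<phi> \<epsilon>) (- \<zeta>) = fourier \<phi> (\<epsilon> *\<^sub>R (- \<zeta>))"
        by (rule fourier_mollifier[OF smooth_measurable[OF decreasing_smooth[OF \<phi>(1)]]]) (use \<epsilon> in simp)
      have "norm (fourier (mollifier \<phi> \<epsilon>) (- \<zeta>) - 1) \<le> L * norm (\<epsilon> *\<^sub>R (- \<zeta>))"
        using L(2)[rule_format, of "\<epsilon> *\<^sub>R (- \<zeta>)"] unfolding e \<phi>(2) .
      also have "\<dots> = L * \<epsilon> * norm \<zeta>" using \<epsilon> by simp
      also have "\<dots> \<le> L * \<epsilon> * (1 + norm \<zeta>)" using \<epsilon> L(1) by (intro mult_left_mono) auto
      finally have a: "norm (fourier (mollifier \<phi> \<epsilon>) (- \<zeta>) - 1) \<le> L * \<epsilon> * (1 + norm \<zeta>)" .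
      have b: "norm (?T (- \<zeta>)) \<le> B * (1 + norm \<zeta>) ^ m" using B[of "- \<zeta>"] by simp
      let ?F = "norm (fourier (\<kappa> n) (\<xi> + \<zeta>))"
      have "norm (?w1 \<zeta> - ?w2 \<zeta>) = (norm (fourier (mollifier \<phi> \<epsilon>) (- \<zeta>) - 1) * norm (?T (- \<zeta>))) * ?F"
        by (simp only: norm_mult[symmetric] left_diff_distrib mult_1_left)
      also have "\<dots> \<le> ((L * \<epsilon> * (1 + norm \<zeta>)) * (B * (1 + norm \<zeta>) ^ m)) * ?F"
        using a b \<epsilon> L(1) by (intro mult_right_mono mult_mono mult_nonneg_nonneg) auto
      also have "\<dots> = (L * \<epsilon> * B) * ((1 + norm \<zeta>) ^ (m + 1) * ?F)" by (simp add: mult_ac)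
      also have "\<dots> \<le> (L * \<epsilon> * B) * (((1 + norm \<xi>) * (1 + norm (\<xi> + \<zeta>))) ^ (m + 1) * ?F)"
        using L(1) B0 \<epsilon> by (intro mult_left_mono mult_right_mono power_mono one_plus_norm_le_mult) auto
      also have "\<dots> = (L * \<epsilon> * B * (1 + norm \<xi>) ^ (m + 1)) * (?F * (1 + norm (\<xi> + \<zeta>)) ^ (m + 1))"
        by (simp only: power_mult_distrib mult_ac)
      also have "\<dots> \<le> (L * \<epsilon> * B * (1 + norm \<xi>) ^ (m + 1)) * (D * wt (\<xi> + \<zeta>))"
      proof (rule mult_left_mono[OF wt_bound_of_power_bound])
        have "?F * (1 + norm (\<xi> + \<zeta>)) ^ (0 + (m + 1 + 2 * CARD('n))) \<le> D * (D * real n) ^ 0"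
          by (rule D(2)[rule_format, OF n le0])
        then show "?F * (1 + norm (\<xi> + \<zeta>)) ^ (m + 1) * (1 + norm (\<xi> + \<zeta>)) ^ (2 * CARD('n)) \<le> D"
          by (simp add: power_add mult_ac)
      qed (use L(1) B0 \<epsilon> in auto)
      finally show "norm (?w1 \<zeta> - ?w2 \<zeta>) \<le> (L * B * D * \<epsilon> * (1 + norm \<xi>) ^ (m + 1)) * wt (\<xi> + \<zeta>)"
        by (simp only: mult_ac)
    qed
    have "fourier (\<lambda>x. \<kappa> n x * dist_convol \<omega> f (mollifier \<phi> \<epsilon>) x) \<xi> - wave_transform f (\<kappa> n) \<xi>
        = ?c * (LINT \<zeta>|lborel. ?w1 \<zeta> - ?w2 \<zeta>)"
      unfolding 1 2 Bochner_Integration.integral_diff[OF rapidly_decreasing_integrable[OF r] rapidly_decreasing_integrable[OF bm]]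
      by (simp only: right_diff_distrib)
    then have "norm (fourier (\<lambda>x. \<kappa> n x * dist_convol \<omega> f (mollifier \<phi> \<epsilon>) x) \<xi> - wave_transform f (\<kappa> n) \<xi>)
        = norm ?c * norm (LINT \<zeta>|lborel. ?w1 \<zeta> - ?w2 \<zeta>)" by (simp only: norm_mult)
    also have "\<dots> \<le> norm ?c * (?K * ?I)" by (rule mult_left_mono[OF main norm_ge_zero])
    also have "\<dots> = (norm ?c * (L * B * D * ?I)) * \<epsilon> * (1 + norm \<xi>) ^ (m + 1)" by (simp only: mult_ac)
    finally show ?thesis .
  qed
  moreover have "0 \<le> norm ?c * (L * B * D * ?I)" using L(1) B0 D(1) I by (intro mult_nonneg_nonneg) auto
  ultimately show ?thesis
    by (intro exI[of _ "norm ?c * (L * B * D * ?I)"] exI[of _ "m + 1"] conjI allI impI ballI)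
qed

section \<open>Microanalyticity\<close>

lemma null_net_bound:
  assumes "N \<in> null_nets \<omega>" "compact K" "K \<subseteq> \<omega>" "K \<noteq> {}"
  shows "\<exists>c\<ge>0. \<exists>b>0. \<forall>\<epsilon>\<in>{0<..<min b 1}. \<forall>x\<in>K. norm (N \<epsilon> x) \<le> c * \<epsilon>"
proof -
  have sm: "\<epsilon> \<in> {0<..<1} \<Longrightarrow> smooth_on \<omega> (N \<epsilon>)" for \<epsilon>
    using assms(1) by (simp add: null_nets_def)
  \<comment> \<open>Exponent 1 matches the mollification error, to which this one will be added;
    \<alpha> = 0 because only values enter a Fourier transform.\<close>
  have "(\<lambda>\<epsilon>. SUP x\<in>K. norm (mi_deriv 0 (N \<epsilon>) x)) \<in> O[at_right 0](\<lambda>\<epsilon>. \<epsilon> powr 1)"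
    using assms unfolding null_nets_def by blast
  then obtain c where c: "0 < c" "\<forall>\<^sub>F \<epsilon> in at_right 0. norm (SUP x\<in>K. norm (N \<epsilon> x)) \<le> c * norm (\<epsilon> powr 1)"
    unfolding mi_deriv_0 by (elim landau_o.bigE)
  then obtain b where b: "0 < b" "\<And>\<epsilon>. 0 < \<epsilon> \<Longrightarrow> \<epsilon> < b \<Longrightarrow> norm (SUP x\<in>K. norm (N \<epsilon> x)) \<le> c * norm (\<epsilon> powr 1)"
    unfolding eventually_at_right_field by blast
  have "norm (N \<epsilon> x) \<le> c * \<epsilon>" if \<epsilon>: "\<epsilon> \<in> {0<..<min b 1}" and x: "x \<in> K" for \<epsilon> x
  proof -
    \<comment> \<open>A real supremum bounds the members of a set only if the set is bounded above;
      here this comes from compactness.\<close>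
    have "continuous_on K (N \<epsilon>)"
      using smooth_on_imp_continuous_on[OF sm] assms(3) \<epsilon> by (auto intro: continuous_on_subset)
    then have "compact ((\<lambda>x. norm (N \<epsilon> x)) ` K)"
      by (intro compact_continuous_image continuous_intros assms(2))
    then have "bdd_above ((\<lambda>x. norm (N \<epsilon> x)) ` K)" by (intro bounded_imp_bdd_above compact_imp_bounded)
    then have "norm (N \<epsilon> x) \<le> (SUP x\<in>K. norm (N \<epsilon> x))" using x by (intro cSUP_upper)
    also have "\<dots> \<le> norm (SUP x\<in>K. norm (N \<epsilon> x))" by simp
    also have "\<dots> \<le> c * norm (\<epsilon> powr 1)" using \<epsilon> by (intro b(2)) auto
    finally show ?thesis using \<epsilon> by simp
  qed
  then show ?thesis using c(1) b(1) by (intro exI[of _ c] exI[of _ b] conjI ballI) auto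
qed

lemma integrable_test_function_mult:
  assumes "\<kappa> \<in> test_functions \<omega>" "continuous_on \<omega> F"
  shows "integrable lborel (\<lambda>x. \<kappa> x * F x)"
proof -
  let ?K = "closure {x. \<kappa> x \<noteq> 0}"
  have "continuous_on ?K (\<lambda>x. \<kappa> x * F x)"
    by (intro continuous_intros continuous_on_subset[OF assms(2) test_functionsD(3)[OF assms(1)]]
        continuous_on_subset[OF smooth_on_imp_continuous_on[OF test_functionsD(1)[OF assms(1)]] subset_UNIV])
  from borel_integrable_compact[OF test_functionsD(2)[OF assms(1)] this]
  have "integrable lborel (\<lambda>x. indicat_real ?K x *\<^sub>R (\<kappa> x * F x))" .
  moreover have "indicat_real ?K x *\<^sub>R (\<kappa> x * F x) = \<kappa> x * F x" for x
    using zero_outside_closure_support[of x \<kappa>] by (cases "x \<in> ?K") auto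
  ultimately show ?thesis by (simp only:)
qed

text \<open>The two terms balance at \<open>\<epsilon> = B ^ l\<close>; for larger \<open>B\<close> the a priori bound is already good enough.\<close>

lemma interpolation_estimate:
  fixes T D X B \<epsilon>\<^sub>1 :: real
  assumes D: "0 \<le> D" and X: "1 \<le> X" and B: "0 < B" and \<epsilon>\<^sub>1: "0 < \<epsilon>\<^sub>1" "\<epsilon>\<^sub>1 \<le> 1"
    and T: "T \<le> D * X ^ M"
    and T\<epsilon>: "\<And>\<epsilon>. 0 < \<epsilon> \<Longrightarrow> \<epsilon> < \<epsilon>\<^sub>1 \<Longrightarrow> T \<le> D * ((1 / \<epsilon>) ^ q * B ^ ((q + 1) * l) + \<epsilon> * X ^ M)"
  shows "T \<le> (2 * D / \<epsilon>\<^sub>1) * (B ^ l * X ^ M)"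
proof (cases "B ^ l < \<epsilon>\<^sub>1")
  case True
  let ?e = "B ^ l"
  have e: "0 < ?e" using B by simp
  have XM: "1 \<le> X ^ M" using X by (rule one_le_power)
  \<comment> \<open>q of the q + 1 blocks cancel the negative power of \<epsilon> = ?e, and one
    block remains.\<close>
  have "B ^ ((q + 1) * l) = ?e ^ q * ?e" by (simp add: power_mult[symmetric] power_add[symmetric] mult.commute)
  then have "(1 / ?e) ^ q * B ^ ((q + 1) * l) = ?e"
    using e by (simp add: power_divide del: power_mult)
  also have "?e = ?e * 1" by simp
  also have "\<dots> \<le> ?e * X ^ M" using e XM by (intro mult_left_mono) auto
  finally have 1: "(1 / ?e) ^ q * B ^ ((q + 1) * l) \<le> ?e * X ^ M" .
  have "T \<le> D * ((1 / ?e) ^ q * B ^ ((q + 1) * l) + ?e * X ^ M)" using T\<epsilon>[OF e True] .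
  also have "\<dots> \<le> D * (?e * X ^ M + ?e * X ^ M)" using D 1 by (intro mult_left_mono) auto
  also have "\<dots> = (2 * D) * (?e * X ^ M)" by simp
  also have "\<dots> \<le> (2 * D / \<epsilon>\<^sub>1) * (?e * X ^ M)"
  proof (rule mult_right_mono)
    have "2 * D * \<epsilon>\<^sub>1 \<le> 2 * D * 1" using D \<epsilon>\<^sub>1 by (intro mult_left_mono) auto
    then show "2 * D \<le> 2 * D / \<epsilon>\<^sub>1" using \<epsilon>\<^sub>1 by (simp add: pos_le_divide_eq)
  qed (use e XM in auto)
  finally show ?thesis .
next
  case False
  have XM: "0 \<le> X ^ M" using X by simp
  have "1 \<le> B ^ l / \<epsilon>\<^sub>1" using False \<epsilon>\<^sub>1 by (simp add: pos_le_divide_eq)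
  then have "D * X ^ M * 1 \<le> D * X ^ M * (B ^ l / \<epsilon>\<^sub>1)" using D XM by (intro mult_left_mono) auto
  also have "\<dots> = (D / \<epsilon>\<^sub>1) * (B ^ l * X ^ M)" by simp
  also have "\<dots> \<le> (2 * D / \<epsilon>\<^sub>1) * (B ^ l * X ^ M)"
    using D \<epsilon>\<^sub>1 B XM by (intro mult_right_mono divide_right_mono) auto
  finally show ?thesis using T by simp
qed

text \<open>The new index is at most (q + 1) (1 + M) m, a constant multiple of m. The surplus factor
  m^M is absorbed into an m-th power because m is at most 2^m.\<close>

lemma reindexed_power_bound:
  fixes C :: real and q m M :: nat
  assumes C: "0 < C" and m: "1 \<le> m"
  defines "E \<equiv> C * real ((q + 1) * (1 + M)) + 1"
  shows "(C * real ((q + 1) * (m + M))) ^ (m + M) \<le> E ^ M * (E * 2 ^ M * real m) ^ m"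
proof -
  have E: "1 \<le> E" "C * real ((q + 1) * (1 + M)) \<le> E" using C by (auto simp: E_def)
  have "(q + 1) * (m + M) \<le> (q + 1) * ((1 + M) * m)"
    using m by (intro mult_le_mono2) (simp add: algebra_simps)
  then have "real ((q + 1) * (m + M)) \<le> real ((q + 1) * (1 + M)) * real m"
    by (simp only: of_nat_mult[symmetric] of_nat_le_iff mult.assoc)
  then have "C * real ((q + 1) * (m + M)) \<le> (C * real ((q + 1) * (1 + M))) * real m"
    using C by (simp only: mult.assoc mult_le_cancel_left_pos)
  also have "\<dots> \<le> E * real m" using E by (intro mult_right_mono) auto
  finally have "(C * real ((q + 1) * (m + M))) ^ (m + M) \<le> (E * real m) ^ (m + M)"
    using C by (intro power_mono) auto
  also have "\<dots> = (E * real m) ^ m * E ^ M * real m ^ M" by (simp add: power_add power_mult_distrib)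
  also have "\<dots> \<le> (E * real m) ^ m * E ^ M * (2 ^ m) ^ M"
  proof (intro mult_left_mono power_mono)
    show "real m \<le> 2 ^ m" using less_exp[of m] by (metis less_imp_le of_nat_le_iff of_nat_numeral of_nat_power)
  qed (use E in auto)
  also have "\<dots> = E ^ M * (E * 2 ^ M * real m) ^ m"
    by (simp add: power_mult_distrib power_mult[symmetric] mult_ac)
  finally show ?thesis .
qed

text \<open>The new index is at least m, which admits every \<beta> of order up to m, and at most a
  constant multiple of m, which only enlarges C.\<close>

lemma admissible_cutoff_reindex:
  assumes adm: "admissible_cutoff \<omega> x\<^sub>0 W U \<kappa>"
  shows "admissible_cutoff \<omega> x\<^sub>0 W U (\<lambda>m. \<kappa> ((q + 1) * (m + M)))"
proof -
  have le: "m \<le> (q + 1) * (m + M)" for m by (simp add: trans_le_add1)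
  have "\<exists>C>0. \<forall>m\<ge>1. \<forall>\<beta>. mi_abs \<beta> \<le> m \<longrightarrow>
      (\<forall>x. norm (mi_deriv (\<alpha> + \<beta>) (\<kappa> ((q + 1) * (m + M))) x) \<le> C * (C * real m) ^ mi_abs \<beta>)" for \<alpha>
  proof -
    obtain C where C: "0 < C" "\<forall>n\<ge>1. \<forall>\<beta>. mi_abs \<beta> \<le> n \<longrightarrow>
        (\<forall>x. norm (mi_deriv (\<alpha> + \<beta>) (\<kappa> n) x) \<le> C * (C * real n) ^ mi_abs \<beta>)"
      using adm unfolding admissible_cutoff_def by blast
    let ?p = "real ((q + 1) * (1 + M))"
    have p: "1 \<le> ?p" by (simp only: real_of_nat_ge_one_iff) simp
    have "norm (mi_deriv (\<alpha> + \<beta>) (\<kappa> ((q + 1) * (m + M))) x) \<le> (C * ?p) * (C * ?p * real m) ^ mi_abs \<beta>"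
      if m: "1 \<le> m" and \<beta>: "mi_abs \<beta> \<le> m" for m \<beta> x
    proof -
      have "norm (mi_deriv (\<alpha> + \<beta>) (\<kappa> ((q + 1) * (m + M))) x)
          \<le> C * (C * real ((q + 1) * (m + M))) ^ mi_abs \<beta>"
        by (rule C(2)[rule_format, OF order_trans[OF m le] order_trans[OF \<beta> le]])
      also have "\<dots> \<le> (C * ?p) * (C * ?p * real m) ^ mi_abs \<beta>"
      proof (rule mult_mono[OF _ power_mono])
        show "C \<le> C * ?p" using mult_left_mono[OF p, of C] C(1) by simp
        have "(q + 1) * (m + M) \<le> (q + 1) * ((1 + M) * m)"
          using m by (intro mult_le_mono2) (simp add: algebra_simps)
        then have "real ((q + 1) * (m + M)) \<le> ?p * real m"
          by (simp only: of_nat_mult[symmetric] of_nat_le_iff mult.assoc)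
        then show "C * real ((q + 1) * (m + M)) \<le> C * ?p * real m"
          using C(1) by (simp only: mult.assoc mult_le_cancel_left_pos)
        show "0 \<le> C * ?p" by (rule mult_nonneg_nonneg[OF less_imp_le[OF C(1)] of_nat_0_le_iff])
        show "0 \<le> C * real ((q + 1) * (m + M))" by (rule mult_nonneg_nonneg[OF less_imp_le[OF C(1)] of_nat_0_le_iff])
        then show "0 \<le> (C * real ((q + 1) * (m + M))) ^ mi_abs \<beta>" by (rule zero_le_power)
      qed
      finally show ?thesis .
    qed
    moreover have "0 < C * ?p" by (rule mult_pos_pos[OF C(1) less_le_trans[OF zero_less_one p]])
    ultimately show ?thesis by (intro exI[of _ "C * ?p"] conjI allI impI)
  qed
  moreover have "\<kappa> ((q + 1) * (m + M)) \<in> test_functions U \<and> (\<forall>x\<in>W. \<kappa> ((q + 1) * (m + M)) x = 1)"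
    if "1 \<le> m" for m
  proof -
    have "1 \<le> (q + 1) * (m + M)" using that le[of m] by (rule order_trans)
    then show ?thesis using adm unfolding admissible_cutoff_def by blast
  qed
  ultimately show ?thesis using adm unfolding admissible_cutoff_def by (intro conjI allI impI) simp_all
qed

lemma powr_minus_le_power:
  fixes \<epsilon> a :: real
  assumes "0 < \<epsilon>" "\<epsilon> < 1"
  shows "\<epsilon> powr (- a) \<le> (1 / \<epsilon>) ^ nat \<lceil>a\<rceil>"
proof -
  have "a \<le> real (nat \<lceil>a\<rceil>)" by linarith
  then have "\<epsilon> powr (- a) \<le> \<epsilon> powr (- real (nat \<lceil>a\<rceil>))" using assms by (intro powr_mono') auto
  also have "\<dots> = (1 / \<epsilon>) ^ nat \<lceil>a\<rceil>"
    using assms by (simp add: powr_minus powr_realpow power_one_over inverse_eq_divide)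
  finally show ?thesis .
qed

text \<open>Two errors separate \<open>\<kappa>\<^sub>n g\<close> from
  \<open>\<kappa>\<^sub>n f\<close>: the null net F - g and the mollification. Both are of order
  \<epsilon> with polynomial growth in \<xi>, uniformly in n, and this uniformity allows \<epsilon>
  to be chosen in terms of n and \<xi>.\<close>

theorem g_microanalytic_imp_microanalytic:
  fixes \<omega> :: "(real ^ 'n::finite) set"
  assumes \<omega>: "open \<omega>" and f: "f \<in> compact_distributions \<omega>" and \<phi>: "decreasing \<phi>" "fourier \<phi> 0 = 1"
    and mic: "g_microanalytic_at \<omega>
      (colombeau_class \<omega> (\<lambda>\<epsilon>. restrict (dist_convol \<omega> f (mollifier \<phi> \<epsilon>)) \<omega>)) x\<^sub>0 \<xi>\<^sub>0"
  shows "microanalytic_at \<omega> f x\<^sub>0 \<xi>\<^sub>0"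
proof -
  define F where "F \<epsilon> = restrict (dist_convol \<omega> f (mollifier \<phi> \<epsilon>)) \<omega>" for \<epsilon>
  obtain W U \<kappa> \<Gamma> C a \<epsilon>\<^sub>0 g where g: "g \<in> colombeau_class \<omega> F" and adm: "admissible_cutoff \<omega> x\<^sub>0 W U \<kappa>"
    and \<Gamma>: "open_cone_around \<xi>\<^sub>0 \<Gamma>" and C: "0 < C" and \<epsilon>\<^sub>0: "\<epsilon>\<^sub>0 \<in> {0<..<1}"
    and est: "\<forall>n\<ge>1. \<forall>\<xi>\<in>\<Gamma>. \<forall>\<epsilon>\<in>{0<..<\<epsilon>\<^sub>0}. norm (fourier (\<lambda>x. \<kappa> n x * g \<epsilon> x) \<xi>)
             \<le> C * \<epsilon> powr (- a) * (C * real n / (1 + norm \<xi>)) ^ n"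
    using mic unfolding g_microanalytic_at_def F_def by (elim exE bexE conjE)
  interpret smooth_bump "\<kappa> 1" x\<^sub>0 W by (rule smooth_bump_cutoff[OF adm])
  have d: "f \<in> distributions \<omega>" using f by (simp add: compact_distributions_def)
  have Fg: "F \<in> moderate_nets \<omega>" "g \<in> moderate_nets \<omega>" "(\<lambda>\<epsilon> x. F \<epsilon> x - g \<epsilon> x) \<in> null_nets \<omega>"
    using g by (auto simp: colombeau_class_def colombeau_rel_def)
  have Une: "closure U \<noteq> {}" using admissible_cutoffD(3)[OF adm] closure_subset by blast
  obtain c b where c: "0 \<le> c" and b: "0 < b" "\<forall>\<epsilon>\<in>{0<..<min b 1}. \<forall>x\<in>closure U. norm (F \<epsilon> x - g \<epsilon> x) \<le> c * \<epsilon>"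
    using null_net_bound[OF Fg(3) admissible_cutoffD(1,2)[OF adm] Une] by (elim exE conjE)
  obtain A where A: "0 \<le> A" "\<forall>n\<ge>1. \<forall>js x. length js \<le> 0 \<longrightarrow> norm (pder js (\<kappa> n) x) \<le> A"
    using cutoff_uniform_bound[OF adm, of 0] by (elim exE conjE)
  obtain V where V: "1 \<le> V" "\<forall>x\<in>closure U. 1 \<le> V * wt x"
    using compact_wt_lower_bound[OF admissible_cutoffD(1)[OF adm]] by (elim exE conjE)
  obtain C2 M2 where C2: "0 \<le> C2" "\<forall>n\<ge>1. \<forall>\<xi>. \<forall>\<epsilon>\<in>{0<..<1}.
      norm (fourier (\<lambda>x. \<kappa> n x * dist_convol \<omega> f (mollifier \<phi> \<epsilon>) x) \<xi> - wave_transform f (\<kappa> n) \<xi>)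
      \<le> C2 * \<epsilon> * (1 + norm \<xi>) ^ M2"
    using mollified_fourier_diff_bound[OF \<omega> f adm \<phi>] by (elim exE conjE)
  obtain C5 N where C5: "0 \<le> C5" "\<forall>n\<ge>1. \<forall>\<zeta>. norm (wave_transform f (\<kappa> n) \<zeta>) \<le> C5 * (1 + norm \<zeta>) ^ N"
    using cutoff_wave_transform_bound[OF adm d] by (elim exE conjE)
  let ?I = "LINT x|lborel. wt (x :: real ^ 'n)"
  have I: "0 \<le> ?I" by (rule Bochner_Integration.integral_nonneg) simp
  define C3 where "C3 = A * c * V * ?I"
  have C3: "0 \<le> C3" unfolding C3_def using A(1) c V(1) I by (intro mult_nonneg_nonneg) auto
  define \<epsilon>\<^sub>1 where "\<epsilon>\<^sub>1 = min b \<epsilon>\<^sub>0"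
  have \<epsilon>\<^sub>1: "0 < \<epsilon>\<^sub>1" "\<epsilon>\<^sub>1 \<le> 1" "\<epsilon>\<^sub>1 \<le> b" "\<epsilon>\<^sub>1 \<le> \<epsilon>\<^sub>0" "\<epsilon>\<^sub>1 < 1" using b(1) \<epsilon>\<^sub>0 by (auto simp: \<epsilon>\<^sub>1_def)
  have near: "norm (fourier (\<lambda>x. \<kappa> n x * dist_convol \<omega> f (mollifier \<phi> \<epsilon>) x) \<xi> - fourier (\<lambda>x. \<kappa> n x * g \<epsilon> x) \<xi>) \<le> C3 * \<epsilon>"
    if n: "1 \<le> n" and \<epsilon>: "0 < \<epsilon>" "\<epsilon> < \<epsilon>\<^sub>1" for n \<epsilon> \<xi>
  proof -
    have \<epsilon>': "\<epsilon> \<in> {0<..<1}" "\<epsilon> \<in> {0<..<min b 1}" using \<epsilon> \<epsilon>\<^sub>1 by auto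
    have \<kappa>: "\<kappa> n \<in> test_functions \<omega>" using adm n by (rule admissible_cutoffD)
    have out: "\<kappa> n x = 0" if "x \<notin> closure U" for x
      using that admissible_cutoffD(7)[OF adm n] zero_outside_closure_support[of x "\<kappa> n"] by blast
    \<comment> \<open>\<open>restrict\<close> makes F \<epsilon> undefined outside \<omega>, where
      the cut-off is 0.\<close>
    have eq: "\<kappa> n x * dist_convol \<omega> f (mollifier \<phi> \<epsilon>) x = \<kappa> n x * F \<epsilon> x" for x
      using out[of x] admissible_cutoffD(2)[OF adm] by (cases "x \<in> closure U") (auto simp: F_def)
    have i: "integrable lborel (\<lambda>x. \<kappa> n x * G \<epsilon> x)" if "G \<in> moderate_nets \<omega>" for G
      using that \<epsilon>'(1) by (intro integrable_test_function_mult[OF \<kappa>] smooth_on_imp_continuous_on)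
        (simp add: moderate_nets_def)
    have "fourier (\<lambda>x. \<kappa> n x * dist_convol \<omega> f (mollifier \<phi> \<epsilon>) x) \<xi> - fourier (\<lambda>x. \<kappa> n x * g \<epsilon> x) \<xi>
        = fourier (\<lambda>x. \<kappa> n x * (F \<epsilon> x - g \<epsilon> x)) \<xi>"
      unfolding eq fourier_eq right_diff_distrib
      by (rule Bochner_Integration.integral_diff[symmetric]) (intro wave_integrable_mult i Fg)+
    also have "norm \<dots> \<le> (A * c * V * \<epsilon>) * ?I"
    proof (rule norm_fourier_le)
      fix x :: "real ^ 'n"
      show "norm (\<kappa> n x * (F \<epsilon> x - g \<epsilon> x)) \<le> (A * c * V * \<epsilon>) * wt x"
      proof (cases "x \<in> closure U")
        case True
        have "norm (pder [] (\<kappa> n) x) \<le> A" by (rule A(2)[rule_format, OF n]) simp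
        then have "norm (\<kappa> n x * (F \<epsilon> x - g \<epsilon> x)) \<le> A * (c * \<epsilon>)"
          unfolding norm_mult using b(2) \<epsilon>'(2) True A(1) by (intro mult_mono) auto
        also have "\<dots> = A * (c * \<epsilon>) * 1" by simp
        also have "\<dots> \<le> A * (c * \<epsilon>) * (V * wt x)"
          using V(2) True A(1) c \<epsilon>(1) by (intro mult_left_mono) auto
        finally show ?thesis by (simp only: mult_ac)
      next
        case False
        have "0 \<le> (A * c * V * \<epsilon>) * wt x" using A(1) c V(1) \<epsilon>(1) by (intro mult_nonneg_nonneg) auto
        then show ?thesis using out[OF False] by (simp only: mult_zero_left norm_zero)
      qed
    qed
    finally show ?thesis unfolding C3_def by (simp only: mult_ac)
  qed
  define q where "q = nat \<lceil>a\<rceil>"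
  \<comment> \<open>One exponent for both the mollification error and the a priori bound. It does
    not depend on n, so the choice of n may involve it.\<close>
  define M where "M = M2 + N"
  define D where "D = C + C2 + C3 + C5"
  have D: "0 \<le> D" "C \<le> D" "C2 + C3 \<le> D" "C5 \<le> D" using C C2(1) C3 C5(1) by (auto simp: D_def)
  define E where "E = C * real ((q + 1) * (1 + M)) + 1"
  have E: "1 \<le> E" using C by (simp add: E_def)
  \<comment> \<open>The first summand dominates the prefactor of the final estimate, the second the
    base of the m-th power.\<close>
  define C' where "C' = (2 * D / \<epsilon>\<^sub>1) * E ^ M + E * 2 ^ M"
  have "0 < E * 2 ^ M" using E by simp
  moreover have "0 \<le> (2 * D / \<epsilon>\<^sub>1) * E ^ M" using D(1) \<epsilon>\<^sub>1 E by (intro mult_nonneg_nonneg) auto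
  ultimately have C': "0 < C'" "(2 * D / \<epsilon>\<^sub>1) * E ^ M \<le> C'" "E * 2 ^ M \<le> C'" by (auto simp: C'_def)
  have "norm (wave_transform f (\<kappa> ((q + 1) * (m + M))) \<xi>) \<le> C' * (C' * real m / (1 + norm \<xi>)) ^ m"
    if m: "1 \<le> m" and \<xi>: "\<xi> \<in> \<Gamma>" for m \<xi>
  proof -
    let ?n = "(q + 1) * (m + M)" and ?X = "1 + norm \<xi>"
    let ?B = "C * real ?n / ?X" and ?T = "norm (wave_transform f (\<kappa> ?n) \<xi>)"
    have n: "1 \<le> ?n" using m by simp
    have X: "1 \<le> ?X" by simp
    have XM: "?X ^ M2 \<le> ?X ^ M" "?X ^ N \<le> ?X ^ M" "1 \<le> ?X ^ M"
      unfolding M_def by (intro power_increasing one_le_power X; simp)+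
    have "0 < real ?n" "0 < ?X" using n X by linarith+
    then have B: "0 < ?B" using C by (intro divide_pos_pos mult_pos_pos)
    have "?T \<le> (2 * D / \<epsilon>\<^sub>1) * (?B ^ (m + M) * ?X ^ M)"
    proof (rule interpolation_estimate[OF D(1) X B \<epsilon>\<^sub>1(1,2), where q = q])
      have "?T \<le> C5 * ?X ^ N" by (rule C5(2)[rule_format, OF n])
      also have "\<dots> \<le> D * ?X ^ M" using C5(1) D XM by (intro mult_mono) auto
      finally show "?T \<le> D * ?X ^ M" .
      fix \<epsilon> assume \<epsilon>: "0 < \<epsilon>" "\<epsilon> < \<epsilon>\<^sub>1"
      let ?h = "fourier (\<lambda>x. \<kappa> ?n x * dist_convol \<omega> f (mollifier \<phi> \<epsilon>) x) \<xi>"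
      let ?g = "fourier (\<lambda>x. \<kappa> ?n x * g \<epsilon> x) \<xi>"
      have 1: "norm (?h - wave_transform f (\<kappa> ?n) \<xi>) \<le> C2 * \<epsilon> * ?X ^ M2"
        by (rule C2(2)[rule_format, OF n]) (use \<epsilon> \<epsilon>\<^sub>1 in auto)
      also have "\<dots> \<le> C2 * \<epsilon> * ?X ^ M" using C2(1) \<epsilon> XM by (intro mult_left_mono) auto
      finally have 1: "norm (?h - wave_transform f (\<kappa> ?n) \<xi>) \<le> C2 * (\<epsilon> * ?X ^ M)" by (simp only: mult.assoc)
      have "norm (?h - ?g) \<le> C3 * \<epsilon>" by (rule near[OF n \<epsilon>])
      also have "\<dots> = C3 * \<epsilon> * 1" by simp
      also have "\<dots> \<le> C3 * \<epsilon> * ?X ^ M" using C3 \<epsilon> XM by (intro mult_left_mono) auto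
      finally have 2: "norm (?h - ?g) \<le> C3 * (\<epsilon> * ?X ^ M)" by (simp only: mult.assoc)
      have "norm ?g \<le> C * \<epsilon> powr (- a) * ?B ^ ?n"
        by (rule est[rule_format, OF n \<xi>]) (use \<epsilon> \<epsilon>\<^sub>1 in auto)
      also have "\<dots> \<le> D * (1 / \<epsilon>) ^ q * ?B ^ ?n"
        using D(1,2) C B \<epsilon> \<epsilon>\<^sub>1 powr_minus_le_power[of \<epsilon> a] unfolding q_def[symmetric]
        by (intro mult_right_mono mult_mono) auto
      finally have 3: "norm ?g \<le> D * ((1 / \<epsilon>) ^ q * ?B ^ ?n)" by (simp only: mult.assoc)
      have "(C2 + C3) * (\<epsilon> * ?X ^ M) \<le> D * (\<epsilon> * ?X ^ M)"
        using D \<epsilon> XM by (intro mult_right_mono mult_nonneg_nonneg) auto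
      then have 4: "C2 * (\<epsilon> * ?X ^ M) + C3 * (\<epsilon> * ?X ^ M) \<le> D * (\<epsilon> * ?X ^ M)" by (simp only: distrib_right)
      have "norm z \<le> norm g + norm (h - g) + norm (h - z)" for z g h :: complex
        using norm_triangle_ineq4[of "g + (h - g)" "h - z"] norm_triangle_ineq[of g "h - g"] by simp
      then have "?T \<le> norm ?g + norm (?h - ?g) + norm (?h - wave_transform f (\<kappa> ?n) \<xi>)" .
      then have "?T \<le> D * ((1 / \<epsilon>) ^ q * ?B ^ ?n) + D * (\<epsilon> * ?X ^ M)" using 1 2 3 4 by linarith
      then show "?T \<le> D * ((1 / \<epsilon>) ^ q * ?B ^ ?n + \<epsilon> * ?X ^ M)" by (simp only: distrib_left)
    qed
    \<comment> \<open>Of the m + M factors 1 / ?X exactly M are used up by the polynomial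
      growth.\<close>
    also have "?B ^ (m + M) * ?X ^ M = (C * real ?n) ^ (m + M) / ?X ^ m"
    proof -
      have "?X ^ M \<noteq> 0" using XM(3) by linarith
      then show ?thesis unfolding power_divide power_add[of ?X] by simp
    qed
    also have "(2 * D / \<epsilon>\<^sub>1) * ((C * real ?n) ^ (m + M) / ?X ^ m)
        \<le> (2 * D / \<epsilon>\<^sub>1) * ((E ^ M * (E * 2 ^ M * real m) ^ m) / ?X ^ m)"
      using reindexed_power_bound[OF C m, of q M] D(1) \<epsilon>\<^sub>1 unfolding E_def[symmetric]
      by (intro mult_left_mono divide_right_mono) auto
    also have "\<dots> = ((2 * D / \<epsilon>\<^sub>1) * E ^ M) * (E * 2 ^ M * real m / ?X) ^ m"
      by (simp only: power_divide times_divide_eq_right mult.assoc)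
    also have "\<dots> \<le> C' * (C' * real m / ?X) ^ m"
      using C' E X by (intro mult_mono power_mono divide_right_mono mult_right_mono) auto
    finally show ?thesis .
  qed
  then have "norm (dist_fourier \<omega> (dist_mult (\<kappa> ((q + 1) * (m + M))) f) \<xi>) \<le> C' * (C' * real m / (1 + norm \<xi>)) ^ m"
    if "1 \<le> m" "\<xi> \<in> \<Gamma>" for m \<xi>
    using that dist_fourier_dist_mult[OF \<omega> d admissible_cutoffD(6)[OF admissible_cutoff_reindex[OF adm, of q M] that(1)]]
    by (simp only: wave_transform_def)
  then show ?thesis
    unfolding microanalytic_at_def
    using admissible_cutoff_reindex[OF adm, of q M] \<Gamma> C'(1)
    by (intro exI[of _ W] exI[of _ U] exI[of _ "\<lambda>m. \<kappa> ((q + 1) * (m + M))"] exI[of _ \<Gamma>] exI[of _ C'] conjI allI impI ballI)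
qed

section \<open>From the distribution to the generalized function\<close>

lemma open_cone_shrink:
  fixes \<Gamma> :: "(real ^ 'n::finite) set"
  assumes "open_cone_around \<xi>\<^sub>0 \<Gamma>"
  shows "\<exists>\<Gamma>' c. open_cone_around \<xi>\<^sub>0 \<Gamma>' \<and> 0 < c \<and> c \<le> 1 / 2 \<and>
    (\<forall>\<xi>\<in>\<Gamma>'. \<forall>\<eta>. norm \<eta> \<le> c * norm \<xi> \<longrightarrow> \<xi> - \<eta> \<in> \<Gamma>)"
proof -
  have \<Gamma>: "open \<Gamma>" "\<xi>\<^sub>0 \<in> \<Gamma>" "\<And>\<xi> t. \<xi> \<in> \<Gamma> \<Longrightarrow> 0 < t \<Longrightarrow> t *\<^sub>R \<xi> \<in> \<Gamma>"
    using assms by (auto simp: open_cone_around_def)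
  obtain e where e: "0 < e" "ball \<xi>\<^sub>0 e \<subseteq> \<Gamma>" using \<Gamma>(1,2) openE by blast
  define s where "s = e / 2"
  have s: "0 < s" using e by (simp add: s_def)
  \<comment> \<open>Once \<xi> is scaled to within s of \<open>\<xi>\<^sub>0\<close>, its norm is at
    most norm \<open>\<xi>\<^sub>0\<close> + s, so the scaled \<eta> has norm at most s and the
    difference stays within e = 2 s. The bound 1 / 2 keeps |\<xi> - \<eta>| at least |\<xi>| /
    2.\<close>
  define c where "c = min (1 / 2) (s / (norm \<xi>\<^sub>0 + s))"
  have pos: "0 < norm \<xi>\<^sub>0 + s" using s by (simp add: add_nonneg_pos)
  have c: "0 < c" "c \<le> 1 / 2" "c * (norm \<xi>\<^sub>0 + s) \<le> s"
  proof -
    show "0 < c" using s pos by (simp add: c_def)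
    show "c \<le> 1 / 2" unfolding c_def by (rule min.cobounded1)
    have "c * (norm \<xi>\<^sub>0 + s) \<le> (s / (norm \<xi>\<^sub>0 + s)) * (norm \<xi>\<^sub>0 + s)"
      using pos by (intro mult_right_mono) (auto simp: c_def)
    then show "c * (norm \<xi>\<^sub>0 + s) \<le> s" using pos by simp
  qed
  \<comment> \<open>The cone generated by the ball of half the radius; every statement about it
    reduces to that ball by scaling.\<close>
  define \<Gamma>' where "\<Gamma>' = (\<Union>t\<in>{0<..}. (\<lambda>\<xi>. t *\<^sub>R \<xi>) -` ball \<xi>\<^sub>0 s)"
  have "open \<Gamma>'" unfolding \<Gamma>'_def by (intro open_UN ballI open_vimage open_ball continuous_intros)
  moreover have "\<xi>\<^sub>0 \<in> \<Gamma>'" unfolding \<Gamma>'_def using s by (auto intro!: bexI[of _ 1])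
  moreover have "t *\<^sub>R \<xi> \<in> \<Gamma>'" if \<xi>: "\<xi> \<in> \<Gamma>'" and t: "0 < t" for \<xi> t
  proof -
    obtain t' where t': "0 < t'" "t' *\<^sub>R \<xi> \<in> ball \<xi>\<^sub>0 s" using \<xi> unfolding \<Gamma>'_def by auto
    have eq: "(t' / t) *\<^sub>R (t *\<^sub>R \<xi>) = t' *\<^sub>R \<xi>" using t by simp
    have "t *\<^sub>R \<xi> \<in> (\<lambda>\<xi>. (t' / t) *\<^sub>R \<xi>) -` ball \<xi>\<^sub>0 s"
      unfolding vimage_eq eq by (rule t'(2))
    moreover have "t' / t \<in> {0<..}" using t t' by simp
    ultimately show ?thesis unfolding \<Gamma>'_def by (rule UN_I[rotated])
  qed
  ultimately have cone: "open_cone_around \<xi>\<^sub>0 \<Gamma>'" by (simp add: open_cone_around_def)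
  have "\<xi> - \<eta> \<in> \<Gamma>" if \<xi>: "\<xi> \<in> \<Gamma>'" and \<eta>: "norm \<eta> \<le> c * norm \<xi>" for \<xi> \<eta>
  proof -
    obtain t where t: "0 < t" "dist \<xi>\<^sub>0 (t *\<^sub>R \<xi>) < s" using \<xi> unfolding \<Gamma>'_def by auto
    have d: "norm (t *\<^sub>R \<xi> - \<xi>\<^sub>0) < s" using t(2) by (simp add: dist_norm norm_minus_commute)
    have "norm (t *\<^sub>R \<xi>) \<le> norm (t *\<^sub>R \<xi> - \<xi>\<^sub>0) + norm \<xi>\<^sub>0"
      using norm_triangle_ineq[of "t *\<^sub>R \<xi> - \<xi>\<^sub>0" \<xi>\<^sub>0] by simp
    then have n: "t * norm \<xi> \<le> norm \<xi>\<^sub>0 + s" using d t(1) by simp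
    have "norm (t *\<^sub>R \<eta>) = t * norm \<eta>" using t(1) by simp
    also have "\<dots> \<le> t * (c * norm \<xi>)" using \<eta> t(1) by (intro mult_left_mono) auto
    also have "\<dots> = c * (t * norm \<xi>)" by (simp only: mult_ac)
    also have "\<dots> \<le> c * (norm \<xi>\<^sub>0 + s)" using c n by (intro mult_left_mono) auto
    also have "\<dots> \<le> s" by (rule c(3))
    finally have h: "norm (t *\<^sub>R \<eta>) \<le> s" .
    have "norm (t *\<^sub>R (\<xi> - \<eta>) - \<xi>\<^sub>0) \<le> norm (t *\<^sub>R \<xi> - \<xi>\<^sub>0) + norm (t *\<^sub>R \<eta>)"
      using norm_triangle_ineq4[of "t *\<^sub>R \<xi> - \<xi>\<^sub>0" "t *\<^sub>R \<eta>"] by (simp add: scaleR_diff_right algebra_simps)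
    also have "\<dots> < e" using d h by (simp add: s_def)
    finally have "t *\<^sub>R (\<xi> - \<eta>) \<in> ball \<xi>\<^sub>0 e" by (simp add: dist_norm norm_minus_commute)
    then have "t *\<^sub>R (\<xi> - \<eta>) \<in> \<Gamma>" using e(2) by blast
    from \<Gamma>(3)[OF this, of "1 / t"] have "(1 / t) *\<^sub>R (t *\<^sub>R (\<xi> - \<eta>)) \<in> \<Gamma>" using t(1) by simp
    then show ?thesis using t(1) by simp
  qed
  then show ?thesis using cone c by (intro exI[of _ \<Gamma>'] exI[of _ c] conjI ballI allI impI)
qed

lemma bounded_affine_vimage:
  fixes b :: "real ^ 'n::finite"
  assumes "bounded S" "0 < l"
  shows "bounded ((\<lambda>x. l *\<^sub>R x + b) -` S)"
proof -
  obtain R where R: "\<forall>u\<in>S. norm u \<le> R" using assms(1) unfolding bounded_iff ..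
  have "norm x \<le> (R + norm b) / l" if "l *\<^sub>R x + b \<in> S" for x
  proof -
    have "norm (l *\<^sub>R x) \<le> norm (l *\<^sub>R x + b) + norm b"
      using norm_triangle_ineq4[of "l *\<^sub>R x + b" b] by simp
    then have "l * norm x \<le> R + norm b" using R that assms(2) by fastforce
    then show ?thesis using assms(2) by (simp add: pos_le_divide_eq mult.commute)
  qed
  then show ?thesis unfolding bounded_iff by (intro exI[of _ "(R + norm b) / l"]) auto
qed

lemma mi_deriv_affine:
  fixes f :: "real ^ 'n::finite \<Rightarrow> complex"
  assumes "smooth f"
  shows "mi_deriv \<alpha> (\<lambda>x. f (a *\<^sub>R x + b)) x = of_real a ^ mi_abs \<alpha> * mi_deriv \<alpha> f (a *\<^sub>R x + b)"
proof -
  from mi_deriv_eq_pder[of \<alpha>] obtain js where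
    js: "(\<forall>f :: real ^ 'n \<Rightarrow> complex. mi_deriv \<alpha> f = pder js f) \<and> (\<forall>i. count_list js i = \<alpha> $ i) \<and> length js = mi_abs \<alpha>" ..
  then have "\<And>f :: real ^ 'n \<Rightarrow> complex. mi_deriv \<alpha> f = pder js f" "length js = mi_abs \<alpha>" by blast+
  then show ?thesis by (simp only: pder_affine[OF assms])
qed

lemma mi_abs_add: "mi_abs (\<alpha> + \<beta>) = mi_abs \<alpha> + mi_abs \<beta>"
  by (simp add: mi_abs_def sum.distrib)

text \<open>L fixes \<open>x\<^sub>0\<close> and expands by l, so composition with L contracts the
  cut-offs towards \<open>x\<^sub>0\<close>. Each derivative costs a factor l, whatever n
  is.\<close>

lemma admissible_cutoff_scale:
  fixes \<omega> :: "(real ^ 'n::finite) set" and x\<^sub>0 :: "real ^ 'n" and l :: real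
  defines "L \<equiv> (\<lambda>x. l *\<^sub>R x + (1 - l) *\<^sub>R x\<^sub>0)"
  assumes adm: "admissible_cutoff \<omega> x\<^sub>0 W U \<kappa>" and l: "1 \<le> l" and sub: "closure (L -` U) \<subseteq> \<omega>"
  shows "admissible_cutoff \<omega> x\<^sub>0 (L -` W) (L -` U) (\<lambda>n x. \<kappa> n (L x))"
proof -
  have lp: "0 < l" using l by simp
  have cont: "continuous_on UNIV L" unfolding L_def by (intro continuous_intros)
  have ov: "open (L -` S)" if "open S" for S using that cont by (rule open_vimage)
  have cv: "closed (L -` S)" if "closed S" for S using that cont by (rule closed_vimage)
  have bv: "bounded (L -` S)" if "bounded S" for S
    unfolding L_def using that lp by (rule bounded_affine_vimage)
  have clv: "closure (L -` S) \<subseteq> L -` closure S" for S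
    by (rule closure_minimal[OF vimage_mono[OF closure_subset] cv[OF closed_closure]])
  have adm': "open W" "open U" "x\<^sub>0 \<in> W" "compact (closure W)" "closure W \<subseteq> U" "compact (closure U)"
    using adm by (auto simp: admissible_cutoff_def compactly_inside_def)
  have bW: "bounded W" and bU: "bounded U" using adm'(4,6) by simp_all
  have L0: "L x\<^sub>0 = x\<^sub>0" by (simp add: L_def scaleR_left_diff_distrib)
  have t: "(\<lambda>x. \<kappa> n (L x)) \<in> test_functions (L -` U)" if n: "1 \<le> n" for n
  proof (rule test_functionsI)
    have \<kappa>: "\<kappa> n \<in> test_functions U" using adm n by (rule admissible_cutoffD)
    show "smooth (\<lambda>x. \<kappa> n (L x))" unfolding L_def by (rule smooth_affine[OF test_functionsD(1)[OF \<kappa>]])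
    show "compact (L -` closure {x. \<kappa> n x \<noteq> 0})"
      using cv[OF closed_closure] bv[OF compact_imp_bounded[OF test_functionsD(2)[OF \<kappa>]]]
      by (simp add: compact_eq_bounded_closed)
    show "L -` closure {x. \<kappa> n x \<noteq> 0} \<subseteq> L -` U" by (rule vimage_mono[OF test_functionsD(3)[OF \<kappa>]])
    show "\<kappa> n (L x) = 0" if "x \<notin> L -` closure {x. \<kappa> n x \<noteq> 0}" for x
      using that by (intro zero_outside_closure_support[of "L x" "\<kappa> n"]) simp
  qed
  have "\<exists>C>0. \<forall>n\<ge>1. \<forall>\<beta>. mi_abs \<beta> \<le> n \<longrightarrow>
      (\<forall>x. norm (mi_deriv (\<alpha> + \<beta>) (\<lambda>x. \<kappa> n (L x)) x) \<le> C * (C * real n) ^ mi_abs \<beta>)" for \<alpha>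
  proof -
    obtain C where C: "0 < C" "\<forall>n\<ge>1. \<forall>\<beta>. mi_abs \<beta> \<le> n \<longrightarrow>
        (\<forall>x. norm (mi_deriv (\<alpha> + \<beta>) (\<kappa> n) x) \<le> C * (C * real n) ^ mi_abs \<beta>)"
      using adm unfolding admissible_cutoff_def by blast
    let ?a = "mi_abs \<alpha>"
    \<comment> \<open>One constant for the factor l ^ ?a in front and for the factor l in the base
      of the power.\<close>
    define C' where "C' = l ^ (?a + 1) * C"
    have C': "0 < C'" "l ^ ?a * C \<le> C'" "l * C \<le> C'"
    proof -
      show "0 < C'" using C(1) lp by (simp add: C'_def)
      have "l ^ ?a \<le> l ^ (?a + 1)" "l ^ 1 \<le> l ^ (?a + 1)" using l by (intro power_increasing; simp)+
      then show "l ^ ?a * C \<le> C'" "l * C \<le> C'"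
        unfolding C'_def using C(1) by (auto intro!: mult_right_mono)
    qed
    have "norm (mi_deriv (\<alpha> + \<beta>) (\<lambda>x. \<kappa> n (L x)) x) \<le> C' * (C' * real n) ^ mi_abs \<beta>"
      if n: "1 \<le> n" and \<beta>: "mi_abs \<beta> \<le> n" for n \<beta> x
    proof -
      have "norm (mi_deriv (\<alpha> + \<beta>) (\<lambda>x. \<kappa> n (L x)) x)
          = l ^ mi_abs (\<alpha> + \<beta>) * norm (mi_deriv (\<alpha> + \<beta>) (\<kappa> n) (L x))"
        unfolding L_def mi_deriv_affine[OF test_functionsD(1)[OF admissible_cutoffD(5)[OF adm n]]]
        using lp by (simp add: norm_mult norm_power)
      also have "\<dots> \<le> l ^ mi_abs (\<alpha> + \<beta>) * (C * (C * real n) ^ mi_abs \<beta>)"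
        using lp by (intro mult_left_mono C(2)[rule_format, OF n \<beta>]) auto
      also have "\<dots> = (l ^ ?a * C) * (l * C * real n) ^ mi_abs \<beta>"
        by (simp only: mi_abs_add power_add power_mult_distrib mult_ac)
      also have "\<dots> \<le> C' * (C' * real n) ^ mi_abs \<beta>"
        using C' C(1) lp by (intro mult_mono power_mono mult_right_mono) auto
      finally show ?thesis .
    qed
    then show ?thesis using C'(1) by (intro exI[of _ C'] conjI allI impI)
  qed
  moreover have "\<kappa> n (L x) = 1" if "1 \<le> n" "x \<in> L -` W" for n x
    using that adm unfolding admissible_cutoff_def by simp
  moreover have "compactly_inside (L -` W) (L -` U)"
    unfolding compactly_inside_def
    using bv[OF bW] order_trans[OF clv vimage_mono[OF adm'(5)]] by simp
  moreover have "compactly_inside (L -` U) \<omega>"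
    unfolding compactly_inside_def using bv[OF bU] sub by simp
  ultimately show ?thesis
    unfolding admissible_cutoff_def using ov[OF adm'(1)] ov[OF adm'(2)] adm'(3) L0 t
    by (intro conjI allI impI ballI) simp_all
qed

text \<open>\<open>g_microanalytic_at\<close> asks for one representative only. The one used is the
  convolution with the shortened mollifier, for which the estimate holds without any loss in
  \<epsilon>.\<close>

theorem microanalytic_imp_g_microanalytic:
  fixes \<omega> :: "(real ^ 'n::finite) set"
  assumes \<omega>: "open \<omega>" and f: "f \<in> compact_distributions \<omega>" and \<phi>: "decreasing \<phi>"
    and mic: "microanalytic_at \<omega> f x\<^sub>0 \<xi>\<^sub>0"
  shows "g_microanalytic_at \<omega>
      (colombeau_class \<omega> (\<lambda>\<epsilon>. restrict (dist_convol \<omega> f (mollifier \<phi> \<epsilon>)) \<omega>)) x\<^sub>0 \<xi>\<^sub>0"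
proof -
  define F where "F = (\<lambda>\<epsilon>. restrict (dist_convol \<omega> f (mollifier \<phi> \<epsilon>)) \<omega>)"
  obtain W U \<kappa> \<Gamma> C where adm: "admissible_cutoff \<omega> x\<^sub>0 W U \<kappa>" and \<Gamma>: "open_cone_around \<xi>\<^sub>0 \<Gamma>"
    and C: "0 < C" and est: "\<forall>n\<ge>1. \<forall>\<xi>\<in>\<Gamma>.
           norm (dist_fourier \<omega> (dist_mult (\<kappa> n) f) \<xi>) \<le> C * (C * real n / (1 + norm \<xi>)) ^ n"
    using mic unfolding microanalytic_at_def by (elim exE conjE)
  interpret smooth_bump "\<kappa> 1" x\<^sub>0 W by (rule smooth_bump_cutoff[OF adm])
  have d: "f \<in> distributions \<omega>" using f by (simp add: compact_distributions_def)
  define \<rho> where "\<rho> = support_cutoff \<omega> f"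
  have \<rho>: "\<rho> \<in> test_functions \<omega>"
    and "\<exists>V. open V \<and> dist_support \<omega> f \<subseteq> V \<and> (\<forall>x\<in>V. \<rho> x = 1)"
    unfolding \<rho>_def by (rule support_cutoff_compact_distribution[OF \<omega> f])+
  then obtain V where V: "open V" "dist_support \<omega> f \<subseteq> V" "\<And>x. x \<in> V \<Longrightarrow> \<rho> x = 1" by blast
  have admW: "open W" "x\<^sub>0 \<in> W" "W \<subseteq> \<omega>" "\<And>n x. 1 \<le> n \<Longrightarrow> x \<in> W \<Longrightarrow> \<kappa> n x = 1"
    using adm closure_subset unfolding admissible_cutoff_def compactly_inside_def by blast+
  obtain e where e: "0 < e" "ball x\<^sub>0 e \<subseteq> W" using admW openE by blast
  \<comment> \<open>If x is within r of \<open>x\<^sub>0\<close> and y within r of x, then y lies in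
    the ball of radius e, hence in W, where each cut-off equals 1.\<close>
  define r where "r = e / 2"
  have r: "0 < r" using e by (simp add: r_def)
  \<comment> \<open>The support of \<beta> limits the range of the mollifier to r; that \<beta> is 1
    near 0 makes the removed tail negligible.\<close>
  obtain \<beta> S where \<beta>: "\<beta> \<in> test_functions (ball (0 :: real ^ 'n) r)" and S: "open S" "0 \<in> S" "\<forall>x\<in>S. \<beta> x = 1"
    using bump_in_ball[OF r, of 0] by blast
  obtain r\<^sub>1 where r1: "0 < r\<^sub>1" "ball 0 r\<^sub>1 \<subseteq> S" using S openE by blast
  have one: "\<beta> x = 1" if "x \<in> ball 0 r\<^sub>1" for x using that r1 S by blast
  define \<theta> where "\<theta> = (\<lambda>\<epsilon> x. \<beta> x * mollifier \<phi> \<epsilon> x)"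
  define tail where "tail = (\<lambda>\<epsilon> x. (1 - \<beta> x) * mollifier \<phi> \<epsilon> x)"
  have s\<phi>: "smooth (mollifier \<phi> \<epsilon>)" for \<epsilon> by (rule smooth_mollifier[OF decreasing_smooth[OF \<phi>]])
  have d\<theta>: "decreasing (\<theta> \<epsilon>)" for \<epsilon>
    unfolding \<theta>_def by (rule test_function_decreasing[OF test_functions_mult[OF \<beta> s\<phi>]])
  have d\<phi>: "decreasing (mollifier \<phi> \<epsilon>)" if "\<epsilon> \<in> {0<..<1}" for \<epsilon> by (rule decreasing_mollifier[OF \<phi> that])
  have dt: "decreasing (tail \<epsilon>)" if "\<epsilon> \<in> {0<..<1}" for \<epsilon>
    unfolding tail_def by (rule decreasing_mollifier_tail[OF \<phi> \<beta> r1(1)]) (use one that in auto)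
  have tail_bound: "\<exists>C\<ge>0. \<forall>\<epsilon>\<in>{0<..<1}. \<forall>\<zeta>. norm (fourier (tail \<epsilon>) \<zeta>) * (1 + norm \<zeta>) ^ k \<le> C * \<epsilon> ^ N" for k N
    unfolding tail_def by (rule fourier_mollifier_tail_bound[OF \<phi> \<beta> r1(1)]) (rule one)
  have \<theta>_bound: "\<exists>C\<ge>0. \<forall>\<epsilon>\<in>{0<..<1}. \<forall>\<zeta>. norm (fourier (\<theta> \<epsilon>) \<zeta>) * (1 + norm \<zeta>) ^ k \<le> C * (1 / \<epsilon>) ^ k" for k
  proof -
    obtain C1 where C1: "0 \<le> C1" "\<forall>\<epsilon>\<in>{0<..<1}. \<forall>\<zeta>. norm (fourier (mollifier \<phi> \<epsilon>) \<zeta>) * (1 + norm \<zeta>) ^ k \<le> C1 * (1 / \<epsilon>) ^ k"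
      using fourier_mollifier_bound[OF \<phi>, of k] by (elim exE conjE)
    obtain C2 where C2: "0 \<le> C2" "\<forall>\<epsilon>\<in>{0<..<1}. \<forall>\<zeta>. norm (fourier (tail \<epsilon>) \<zeta>) * (1 + norm \<zeta>) ^ k \<le> C2 * \<epsilon> ^ 0"
      using tail_bound[of k 0] by (elim exE conjE)
    have "norm (fourier (\<theta> \<epsilon>) \<zeta>) * (1 + norm \<zeta>) ^ k \<le> (C1 + C2) * (1 / \<epsilon>) ^ k" if \<epsilon>: "\<epsilon> \<in> {0<..<1}" for \<epsilon> \<zeta>
    proof -
      have eq: "\<theta> \<epsilon> x = mollifier \<phi> \<epsilon> x - tail \<epsilon> x" for x by (simp add: \<theta>_def tail_def algebra_simps)
      have "fourier (\<theta> \<epsilon>) \<zeta> = fourier (mollifier \<phi> \<epsilon>) \<zeta> - fourier (tail \<epsilon>) \<zeta>"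
        unfolding fourier_eq eq right_diff_distrib
        by (rule Bochner_Integration.integral_diff) (intro wave_integrable_mult decreasing_integrable d\<phi> dt \<epsilon>)+
      then have "norm (fourier (\<theta> \<epsilon>) \<zeta>) \<le> norm (fourier (mollifier \<phi> \<epsilon>) \<zeta>) + norm (fourier (tail \<epsilon>) \<zeta>)"
        by (simp only: norm_triangle_ineq4)
      then have "norm (fourier (\<theta> \<epsilon>) \<zeta>) * (1 + norm \<zeta>) ^ k
          \<le> (norm (fourier (mollifier \<phi> \<epsilon>) \<zeta>) + norm (fourier (tail \<epsilon>) \<zeta>)) * (1 + norm \<zeta>) ^ k"
        by (rule mult_right_mono) simp
      also have "\<dots> \<le> C1 * (1 / \<epsilon>) ^ k + C2 * \<epsilon> ^ 0"
        unfolding distrib_right by (intro add_mono C1(2)[rule_format, OF \<epsilon>] C2(2)[rule_format, OF \<epsilon>])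
      also have "\<dots> \<le> C1 * (1 / \<epsilon>) ^ k + C2 * (1 / \<epsilon>) ^ k"
      proof -
        have "1 \<le> (1 / \<epsilon>) ^ k" using \<epsilon> by (intro one_le_power) simp
        then show ?thesis using mult_left_mono[of 1 "(1 / \<epsilon>) ^ k" C2] C2(1) by simp
      qed
      finally show ?thesis by (simp only: distrib_right)
    qed
    then show ?thesis using C1(1) C2(1) by (intro exI[of _ "C1 + C2"] conjI ballI allI) auto
  qed
  define g where "g = (\<lambda>\<epsilon> x. f (\<lambda>y. \<rho> y * \<theta> \<epsilon> (x - y)))"
  have Feq: "F \<epsilon> x = f (\<lambda>y. \<rho> y * mollifier \<phi> \<epsilon> (x - y))" if "x \<in> \<omega>" for \<epsilon> x
    using that by (simp add: F_def dist_convol_eq \<rho>_def)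
  have Fm: "F \<in> moderate_nets \<omega>"
  proof (rule convolution_net_moderate[OF d \<rho> \<omega> d\<phi>])
    show "\<exists>C a. \<forall>\<epsilon>\<in>{0<..<1}. \<forall>\<zeta>. norm (fourier (mollifier \<phi> \<epsilon>) \<zeta>) * (1 + norm \<zeta>) ^ k \<le> C * (1 / \<epsilon>) ^ a" for k
      using fourier_mollifier_bound[OF \<phi>, of k] by (elim exE conjE) (intro exI)
  qed (use Feq in auto)
  have gm: "g \<in> moderate_nets \<omega>"
  proof (rule convolution_net_moderate[OF d \<rho> \<omega> d\<theta>])
    show "\<exists>C a. \<forall>\<epsilon>\<in>{0<..<1}. \<forall>\<zeta>. norm (fourier (\<theta> \<epsilon>) \<zeta>) * (1 + norm \<zeta>) ^ k \<le> C * (1 / \<epsilon>) ^ a" for k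
      using \<theta>_bound[of k] by (elim exE conjE) (intro exI)
  qed (simp add: g_def)
  have Fgn: "(\<lambda>\<epsilon> x. F \<epsilon> x - g \<epsilon> x) \<in> null_nets \<omega>"
  proof (rule convolution_net_null[OF d \<rho> \<omega> dt tail_bound])
    fix \<epsilon> x assume "\<epsilon> \<in> {0<..<1 :: real}" and x: "x \<in> \<omega>"
    have t: "(\<lambda>y. \<rho> y * h (x - y)) \<in> test_functions \<omega>" if "smooth h" for h
      using smooth_affine[OF that, of "-1" x] by (intro test_functions_mult[OF \<rho>]) simp
    have eq: "\<rho> y * tail \<epsilon> (x - y) = \<rho> y * mollifier \<phi> \<epsilon> (x - y) - \<rho> y * \<theta> \<epsilon> (x - y)" for y
      by (simp add: \<theta>_def tail_def algebra_simps)
    show "F \<epsilon> x - g \<epsilon> x = f (\<lambda>y. \<rho> y * tail \<epsilon> (x - y))"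
      unfolding Feq[OF x] g_def eq
      by (rule distributions_diff[OF d t[OF s\<phi>] t[OF decreasing_smooth[OF d\<theta>]], symmetric])
  qed
  have gF: "g \<in> colombeau_class \<omega> F"
    using Fm gm Fgn by (simp add: colombeau_class_def colombeau_rel_def)
  obtain R where R: "0 < R" "\<forall>u\<in>closure U. norm u \<le> R"
    using compact_imp_bounded[OF admissible_cutoffD(1)[OF adm]] unfolding bounded_pos by (elim exE conjE)
  \<comment> \<open>L multiplies distances to \<open>x\<^sub>0\<close> by l, and points of closure U
    are at most R + norm \<open>x\<^sub>0\<close> from it; this l forces every preimage to within r
    of \<open>x\<^sub>0\<close>.\<close>
  define l where "l = (R + norm x\<^sub>0) / r + 1"
  have l: "1 \<le> l" "R + norm x\<^sub>0 < l * r" using R(1) r by (auto simp: l_def field_simps)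
  define L where "L = (\<lambda>x. l *\<^sub>R x + (1 - l) *\<^sub>R x\<^sub>0)"
  have Lnear: "norm (x - x\<^sub>0) < r" if "L x \<in> closure U" for x
  proof -
    have "L x - x\<^sub>0 = l *\<^sub>R (x - x\<^sub>0)" by (simp add: L_def algebra_simps)
    then have "l * norm (x - x\<^sub>0) = norm (L x - x\<^sub>0)" using l(1) by simp
    also have "\<dots> \<le> R + norm x\<^sub>0" using R(2) that norm_triangle_ineq4[of "L x" x\<^sub>0] by fastforce
    also have "\<dots> < l * r" by (rule l(2))
    finally show ?thesis using l(1) by simp
  qed
  have clU: "closure (L -` U) \<subseteq> L -` closure U"
  proof (rule closure_minimal[OF vimage_mono[OF closure_subset]])
    show "closed (L -` closure U)"
      unfolding L_def by (intro closed_vimage closed_closure continuous_intros)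
  qed
  have sub: "closure (L -` U) \<subseteq> \<omega>"
  proof
    fix x assume "x \<in> closure (L -` U)"
    then have "norm (x - x\<^sub>0) < r" using clU Lnear by blast
    then have "x \<in> ball x\<^sub>0 e" using r by (simp add: dist_norm norm_minus_commute r_def)
    then show "x \<in> \<omega>" using e admW by blast
  qed
  define \<kappa>' where "\<kappa>' = (\<lambda>n x. \<kappa> n (L x))"
  have adm': "admissible_cutoff \<omega> x\<^sub>0 (L -` W) (L -` U) \<kappa>'"
    unfolding \<kappa>'_def L_def by (rule admissible_cutoff_scale[OF adm l(1) sub[unfolded L_def]])
  obtain \<Gamma>' c where \<Gamma>': "open_cone_around \<xi>\<^sub>0 \<Gamma>'" and c: "0 < c" "c \<le> 1 / 2"
    and cone: "\<forall>\<xi>\<in>\<Gamma>'. \<forall>\<eta>. norm \<eta> \<le> c * norm \<xi> \<longrightarrow> \<xi> - \<eta> \<in> \<Gamma>"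
    using open_cone_shrink[OF \<Gamma>] by (elim exE conjE)
  obtain CT M where CT: "0 \<le> CT" "\<forall>n\<ge>1. \<forall>\<zeta>. norm (wave_transform f (\<kappa> n) \<zeta>) \<le> CT * (1 + norm \<zeta>) ^ M"
    using cutoff_wave_transform_bound[OF adm d] by (elim exE conjE)
  \<comment> \<open>M of the fixed powers meet the growth of the transform of
    \<open>\<kappa>\<^sub>n\<close> f, the others form the weight. The free exponent j will be 0
    near the cone axis of integration and n away from it.\<close>
  obtain D where D: "1 \<le> D" "\<forall>n\<ge>1. \<forall>j\<le>n. \<forall>\<eta>.
      norm (fourier (\<kappa>' n) \<eta>) * (1 + norm \<eta>) ^ (j + (M + 2 * CARD('n))) \<le> D * (D * real n) ^ j"
    using cutoff_fourier_bound[OF adm', where k = "M + 2 * CARD('n)"] by (elim exE conjE)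
  \<comment> \<open>For k = 0 the powers of 1 / \<epsilon> disappear: the transform of \<theta>
    \<epsilon> is bounded uniformly in \<epsilon>.\<close>
  obtain C\<theta> where C\<theta>: "0 \<le> C\<theta>" "\<forall>\<epsilon>\<in>{0<..<1}. \<forall>\<zeta>. norm (fourier (\<theta> \<epsilon>) \<zeta>) * (1 + norm \<zeta>) ^ 0 \<le> C\<theta> * (1 / \<epsilon>) ^ 0"
    using \<theta>_bound[of 0] by (elim exE conjE)
  let ?c = "inv_const TYPE('n)" and ?I = "LINT x|lborel. wt (x :: real ^ 'n)"
  have I: "0 \<le> ?I" by (rule Bochner_Integration.integral_nonneg) simp
  \<comment> \<open>If norm \<xi> is at most norm \<eta> / c, then 1 + norm \<xi> + norm \<eta> is
    at most h (1 + norm \<eta>).\<close>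
  define h where "h = 1 + 1 / c"
  have h: "1 \<le> h" using c by (simp add: h_def)
  \<comment> \<open>2 C is the base when \<zeta> has at least half the size of \<xi>, h D the base
    when \<xi> + \<zeta> is large; the sum serves both cases.\<close>
  define G0 where "G0 = 2 * C + h * D"
  have hD: "0 \<le> h * D" using h D(1) by (intro mult_nonneg_nonneg) auto
  have G0: "0 < G0" "2 * C \<le> G0" "h * D \<le> G0" using C hD by (auto simp: G0_def)
  define Q where "Q = C\<theta> * D * (C + CT * h ^ M)"
  have ChM: "0 \<le> CT * h ^ M" using CT(1) h by (intro mult_nonneg_nonneg) auto
  have Q: "0 \<le> Q" unfolding Q_def using C\<theta>(1) D(1) C ChM by (intro mult_nonneg_nonneg) auto
  define G where "G = norm ?c * Q * ?I + G0"
  have nQI: "0 \<le> norm ?c * Q * ?I" using Q I by (intro mult_nonneg_nonneg) auto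
  have G: "0 < G" "norm ?c * Q * ?I \<le> G" "G0 \<le> G" using nQI G0(1) by (auto simp: G_def)
  have main: "norm (fourier (\<lambda>x. \<kappa>' n x * g \<epsilon> x) \<xi>) \<le> G * (G * real n / (1 + norm \<xi>)) ^ n"
    if n: "1 \<le> n" and \<xi>: "\<xi> \<in> \<Gamma>'" and \<epsilon>: "\<epsilon> \<in> {0<..<1}" for n \<xi> \<epsilon>
  proof -
    have \<kappa>: "\<kappa> n \<in> test_functions \<omega>" using adm n by (rule admissible_cutoffD)
    have \<kappa>': "\<kappa>' n \<in> test_functions \<omega>" using adm' n by (rule admissible_cutoffD)
    have d\<kappa>': "decreasing (\<kappa>' n)" using \<kappa>' by (rule test_function_decreasing)
    let ?w = "\<lambda>\<zeta>. fourier (\<theta> \<epsilon>) (- \<zeta>) * wave_transform f (\<kappa> n) (- \<zeta>)"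
    have rw: "rapidly_decreasing ?w"
      by (rule rapidly_decreasing_convolution[OF d \<kappa> rapidly_decreasing_fourier[OF d\<theta>]])
    \<comment> \<open>Where the contracted cut-off is nonzero, \<theta> \<epsilon> (x - y) reaches
      only y in W. There \<open>\<kappa>\<^sub>n\<close> is 1, as is \<rho> near the support of f,
      so f may be localised by either.\<close>
    have loc: "\<kappa>' n x * g \<epsilon> x = ?c * (\<kappa>' n x * fourier ?w x)" for x
    proof (cases "\<kappa>' n x = 0")
      case False
      then have "L x \<in> closure U"
        using zero_outside_closure_support[of "L x" "\<kappa> n"] admissible_cutoffD(7)[OF adm n] by (auto simp: \<kappa>'_def)
      then have x: "norm (x - x\<^sub>0) < r" by (rule Lnear)
      have sm: "smooth (\<lambda>y. \<theta> \<epsilon> (x - y))"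
        using smooth_affine[OF decreasing_smooth[OF d\<theta>], of \<epsilon> "-1" x] by simp
      have "f (\<lambda>y. \<rho> y * \<theta> \<epsilon> (x - y)) = f (\<lambda>y. \<kappa> n y * \<theta> \<epsilon> (x - y))"
      proof (rule distribution_eq_near_support[OF d test_functions_mult[OF \<rho> sm] test_functions_mult[OF \<kappa> sm] V(1,2)])
        fix y assume y: "y \<in> V"
        show "\<rho> y * \<theta> \<epsilon> (x - y) = \<kappa> n y * \<theta> \<epsilon> (x - y)"
        proof (cases "norm (x - y) < r")
          case True
          have "norm (y - x\<^sub>0) \<le> norm (x - x\<^sub>0) + norm (x - y)"
            using norm_triangle_ineq4[of "x - x\<^sub>0" "x - y"] by simp
          then have "y \<in> ball x\<^sub>0 e" using x True by (simp add: r_def dist_norm norm_minus_commute)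
          then have "\<kappa> n y = 1" using e admW(4)[OF n] by blast
          then show ?thesis using V(3)[OF y] by simp
        next
          case False
          then have "x - y \<notin> closure {x. \<beta> x \<noteq> 0}" using test_functionsD(3)[OF \<beta>] by auto
          then have "\<beta> (x - y) = 0" by (rule zero_outside_closure_support)
          then show ?thesis by (simp add: \<theta>_def)
        qed
      qed
      then show ?thesis
        unfolding g_def convolution_eq_fourier[OF d \<kappa> d\<theta>] by (simp only: mult.left_commute)
    qed simp
    let ?X = "1 + norm \<xi>"
    have X: "1 \<le> ?X" by simp
    let ?K = "Q * (G0 * real n / ?X) ^ n"
    have n0: "0 \<le> real n" by simp
    have "norm (LINT \<zeta>|lborel. ?w \<zeta> * fourier (\<kappa>' n) (\<xi> + \<zeta>)) \<le> ?K * ?I"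
    proof (rule norm_integral_shifted_wt_bound[where w = "\<lambda>\<zeta>. ?w \<zeta> * fourier (\<kappa>' n) (\<xi> + \<zeta>)" and C = ?K and \<xi> = \<xi>])
      have "(\<lambda>\<zeta>. fourier (\<kappa>' n) (\<xi> + \<zeta>)) \<in> borel_measurable borel"
        by (rule measurable_compose[OF _ fourier_measurable[OF smooth_measurable[OF decreasing_smooth[OF d\<kappa>']]]]) simp
      then show "(\<lambda>\<zeta>. ?w \<zeta> * fourier (\<kappa>' n) (\<xi> + \<zeta>)) \<in> borel_measurable borel"
        by (rule borel_measurable_times[OF rapidly_decreasing_measurable[OF rw]])
      fix \<zeta> :: "real ^ 'n"
      let ?\<eta> = "\<xi> + \<zeta>" and ?T = "norm (wave_transform f (\<kappa> n) (- \<zeta>))"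
      let ?F = "norm (fourier (\<kappa>' n) (\<xi> + \<zeta>))" and ?Y = "1 + norm (\<xi> + \<zeta>)"
      have Y: "1 \<le> ?Y" by simp
      have "norm (fourier (\<theta> \<epsilon>) (- \<zeta>)) * (1 + norm (- \<zeta>)) ^ 0 \<le> C\<theta> * (1 / \<epsilon>) ^ 0"
        by (rule C\<theta>(2)[rule_format, OF \<epsilon>])
      then have \<theta>le: "norm (fourier (\<theta> \<epsilon>) (- \<zeta>)) \<le> C\<theta>" by simp
      \<comment> \<open>If ?\<eta> is small, then - \<zeta> = \<xi> - ?\<eta> lies in \<Gamma>: ?T
        supplies the n-th power and ?F only integrability. Otherwise the roles are exchanged: ?T
        grows polynomially and ?F supplies the n-th power, with j = n, since ?\<eta> is comparable
        with \<xi>.\<close>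
      have "?T * ?F \<le> (D * (C + CT * h ^ M) * (G0 * real n / ?X) ^ n) * wt ?\<eta>"
      proof (cases "norm ?\<eta> \<le> c * norm \<xi>")
        case True
        then have mem: "- \<zeta> \<in> \<Gamma>" using cone \<xi> by fastforce
        have "norm ?\<eta> \<le> norm \<xi> / 2"
          using True mult_right_mono[OF c(2) norm_ge_zero[of \<xi>]] by simp
        then have "?X / 2 \<le> 1 + norm (- \<zeta>)"
          using norm_triangle_ineq4[of ?\<eta> \<zeta>] by simp
        moreover have "0 < 1 + norm (- \<zeta>)" by (rule add_pos_nonneg) auto
        moreover have "0 < ?X / 2" by (rule divide_pos_pos[OF add_pos_nonneg]) auto
        ultimately have "C * real n / (1 + norm (- \<zeta>)) \<le> C * real n / (?X / 2)"
          using C by (intro divide_left_mono mult_nonneg_nonneg mult_pos_pos) linarith+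
        also have "\<dots> = 2 * C * real n / ?X" by simp
        also have "\<dots> \<le> G0 * real n / ?X" using G0 X by (intro divide_right_mono mult_right_mono) auto
        finally have le: "C * real n / (1 + norm (- \<zeta>)) \<le> G0 * real n / ?X" .
        have "?T \<le> C * (C * real n / (1 + norm (- \<zeta>))) ^ n"
          using est[rule_format, OF n mem] unfolding dist_fourier_dist_mult[OF \<omega> d \<kappa>] wave_transform_def .
        also have "\<dots> \<le> (C + CT * h ^ M) * (G0 * real n / ?X) ^ n"
          using C ChM le by (intro mult_mono power_mono) auto
        finally have T: "?T \<le> (C + CT * h ^ M) * (G0 * real n / ?X) ^ n" .
        have "?F * ?Y ^ (0 + (M + 2 * CARD('n))) \<le> D * (D * real n) ^ 0"
          by (rule D(2)[rule_format, OF n le0])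
        moreover have "?F * ?Y ^ (2 * CARD('n)) \<le> ?F * ?Y ^ (0 + (M + 2 * CARD('n)))"
          using Y by (intro mult_left_mono power_increasing) auto
        ultimately have "?F * ?Y ^ (2 * CARD('n)) \<le> D" by simp
        then have "?F \<le> D * wt ?\<eta>" by (rule wt_bound_of_power_bound)
        with T have "?T * ?F \<le> ((C + CT * h ^ M) * (G0 * real n / ?X) ^ n) * (D * wt ?\<eta>)"
          using C ChM G0(1) by (intro mult_mono) auto
        then show ?thesis by (simp only: mult_ac)
      next
        case False
        then have far: "norm \<xi> \<le> (1 / c) * norm ?\<eta>" using c by (simp add: field_simps)
        have h\<eta>: "1 + norm \<xi> + norm ?\<eta> \<le> h * ?Y"
        proof -
          have "0 \<le> 1 / c" using c by simp
          moreover have "h * ?Y = 1 + norm ?\<eta> + 1 / c + (1 / c) * norm ?\<eta>"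
            unfolding h_def by (simp add: algebra_simps)
          ultimately show ?thesis using far by linarith
        qed
        have "norm (- \<zeta>) \<le> norm \<xi> + norm ?\<eta>" using norm_triangle_ineq4[of ?\<eta> \<xi>] by simp
        then have "(1 + norm (- \<zeta>)) ^ M \<le> (h * ?Y) ^ M" using h\<eta> by (intro power_mono) auto
        moreover have "?T \<le> CT * (1 + norm (- \<zeta>)) ^ M" by (rule CT(2)[rule_format, OF n])
        ultimately have T: "?T \<le> CT * (h * ?Y) ^ M" using mult_left_mono[OF _ CT(1)] order_trans by blast
        have "?X ^ n \<le> (h * ?Y) ^ n"
        proof (rule power_mono)
          show "?X \<le> h * ?Y" using h\<eta> norm_ge_zero[of ?\<eta>] by linarith
        qed simp
        then have "(?F * ?Y ^ M) * ?Y ^ (2 * CARD('n)) * ?X ^ n \<le> (?F * ?Y ^ M) * ?Y ^ (2 * CARD('n)) * (h * ?Y) ^ n"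
          using Y by (intro mult_left_mono mult_nonneg_nonneg) auto
        also have "\<dots> = (?F * ?Y ^ (n + (M + 2 * CARD('n)))) * h ^ n"
          by (simp only: power_add power_mult_distrib mult_ac)
        also have "\<dots> \<le> (D * (D * real n) ^ n) * h ^ n"
          using h by (intro mult_right_mono D(2)[rule_format, OF n order_refl]) auto
        also have "\<dots> = D * (h * D * real n) ^ n" by (simp only: power_mult_distrib mult_ac)
        finally have "(?F * ?Y ^ M) * ?Y ^ (2 * CARD('n)) \<le> D * (h * D * real n) ^ n / ?X ^ n"
          by (rule pos_le_divide_eq[THEN iffD2, rotated]) (rule zero_less_power, rule add_pos_nonneg, auto)
        also have "\<dots> = D * (h * D * real n / ?X) ^ n" by (simp only: power_divide times_divide_eq_right)
        finally have "?F * ?Y ^ M \<le> (D * (h * D * real n / ?X) ^ n) * wt ?\<eta>" by (rule wt_bound_of_power_bound)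
        also have "\<dots> \<le> (D * (G0 * real n / ?X) ^ n) * wt ?\<eta>"
        proof (rule mult_right_mono[OF mult_left_mono[OF power_mono]])
          show "h * D * real n / ?X \<le> G0 * real n / ?X"
            using G0(3) by (intro divide_right_mono mult_right_mono) auto
          show "0 \<le> h * D * real n / ?X"
            using hD by (intro divide_nonneg_nonneg mult_nonneg_nonneg[OF hD]) auto
        qed (use D(1) in auto)
        finally have FY: "?F * ?Y ^ M \<le> (D * (G0 * real n / ?X) ^ n) * wt ?\<eta>" .
        have "?T * ?F \<le> (CT * (h * ?Y) ^ M) * ?F" by (rule mult_right_mono[OF T norm_ge_zero])
        also have "\<dots> = (CT * h ^ M) * (?F * ?Y ^ M)" by (simp only: power_mult_distrib mult_ac)
        also have "\<dots> \<le> (C + CT * h ^ M) * ((D * (G0 * real n / ?X) ^ n) * wt ?\<eta>)"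
          by (rule mult_mono[OF _ FY]) (use C ChM in auto)
        finally show ?thesis by (simp only: mult_ac)
      qed
      from mult_mono[OF \<theta>le this C\<theta>(1)]
      have "norm (fourier (\<theta> \<epsilon>) (- \<zeta>)) * (?T * ?F)
          \<le> C\<theta> * ((D * (C + CT * h ^ M) * (G0 * real n / ?X) ^ n) * wt ?\<eta>)"
        by simp
      then show "norm (?w \<zeta> * fourier (\<kappa>' n) (\<xi> + \<zeta>)) \<le> ?K * wt (\<xi> + \<zeta>)"
        unfolding Q_def norm_mult by (simp only: mult_ac)
    qed
    then have "norm ?c * norm (LINT \<zeta>|lborel. ?w \<zeta> * fourier (\<kappa>' n) (\<xi> + \<zeta>)) \<le> norm ?c * (?K * ?I)"
      by (rule mult_left_mono) simp
    moreover have "fourier (\<lambda>x. \<kappa>' n x * g \<epsilon> x) \<xi> = ?c * (LINT \<zeta>|lborel. ?w \<zeta> * fourier (\<kappa>' n) (\<xi> + \<zeta>))"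
      unfolding loc fourier_cmult
        fourier_mult_fourier[OF decreasing_integrable[OF d\<kappa>'] rapidly_decreasing_integrable[OF rw]] ..
    ultimately have "norm (fourier (\<lambda>x. \<kappa>' n x * g \<epsilon> x) \<xi>) \<le> (norm ?c * Q * ?I) * (G0 * real n / ?X) ^ n"
      by (simp only: norm_mult mult_ac)
    also have "\<dots> \<le> G * (G * real n / ?X) ^ n"
      using G G0(1) by (intro mult_mono power_mono divide_right_mono mult_right_mono) auto
    finally show ?thesis .
  qed
  \<comment> \<open>The bound in \<open>main\<close> is uniform in \<epsilon>, and \<epsilon> powr
    (- 1) is at least 1, so it implies the required form with a = 1.\<close>
  have "norm (fourier (\<lambda>x. \<kappa>' n x * g \<epsilon> x) \<xi>) \<le> G * \<epsilon> powr (- 1) * (G * real n / (1 + norm \<xi>)) ^ n"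
    if "1 \<le> n" "\<xi> \<in> \<Gamma>'" "\<epsilon> \<in> {0<..<1 / 2}" for n \<xi> \<epsilon>
  proof -
    have \<epsilon>: "\<epsilon> \<in> {0<..<1}" using that(3) by auto
    have "1 \<le> \<epsilon> powr (- 1)" using \<epsilon> by (simp add: powr_minus_divide)
    then have "G * (G * real n / (1 + norm \<xi>)) ^ n * 1 \<le> G * (G * real n / (1 + norm \<xi>)) ^ n * \<epsilon> powr (- 1)"
      using G(1) by (intro mult_left_mono mult_nonneg_nonneg zero_le_power divide_nonneg_nonneg) auto
    with main[OF that(1,2) \<epsilon>] show ?thesis by (simp only: mult_ac mult_1_right)
  qed
  then show ?thesis
    unfolding g_microanalytic_at_def F_def[symmetric] using gF adm' \<Gamma>' G(1)
    by (intro exI[of _ "L -` W"] exI[of _ "L -` U"] exI[of _ \<kappa>'] exI[of _ \<Gamma>'] exI[of _ G] exI[of _ 1]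
        exI[of _ "1 / 2"] bexI[of _ g] conjI allI impI ballI) auto
qed

theorem theorem8:
  fixes \<omega> :: "(real ^ 'n::finite) set"
    and \<phi> :: "real ^ 'n \<Rightarrow> complex"
    and f :: "(real ^ 'n \<Rightarrow> complex) \<Rightarrow> complex"
  assumes "\<phi> \<in> schwartz"
    and "(LINT t|lborel. \<phi> t) = 1"
    and "\<And>m :: 'n multi_index. mi_abs m > 0 \<Longrightarrow> (LINT t|lborel. of_real (mi_power t m) * \<phi> t) = 0"
    and "open \<omega>"
    and "f \<in> compact_distributions \<omega>"
  shows "WF_a \<omega> f =
    WF_ga \<omega> (colombeau_class \<omega> (\<lambda>\<epsilon>. restrict (dist_convol \<omega> f (mollifier \<phi> \<epsilon>)) \<omega>))"
proof -
  have \<phi>: "decreasing \<phi>" using assms(1) by (rule schwartz_decreasing)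
  have "fourier \<phi> 0 = 1" using assms(2) by (simp add: fourier_eq)
  then have eq: "microanalytic_at \<omega> f x \<xi> \<longleftrightarrow> g_microanalytic_at \<omega>
      (colombeau_class \<omega> (\<lambda>\<epsilon>. restrict (dist_convol \<omega> f (mollifier \<phi> \<epsilon>)) \<omega>)) x \<xi>" for x \<xi>
    using microanalytic_imp_g_microanalytic[OF assms(4,5) \<phi>]
      g_microanalytic_imp_microanalytic[OF assms(4,5) \<phi>] by blast
  show ?thesis unfolding WF_a_def WF_ga_def eq ..
qed

end
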